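(* In the quantized jammed MIMO model described in the context, assume that $w\sim\mathcal{CN}(0,\rho I_I)$ for some $\rho\ge0$, that $n\sim\mathcal{CN}(0,N_0I_B)$, and that the entries $s_u$ of $s$ are uncorrelated (i.e. $\mathbb{E}[s_us_v^*]=0$ for $u\ne v$) and satisfy $\mathbb{E}[|s_u|^2]\le1$. For $c\in\{(b,\mathfrak{r}),(b,\mathfrak{i})\}$ define $$\overline{\mathsf{SINR}}_c=\frac{2\|h_{(b)}\|_2^2}{\rho\|j_{(b)}\|_2^2+N_0},$$ where $h_{(b)}$ and $j_{(b)}$ denote the $b$-th rows of $H$ and $J$. Then $$ I(q;s)\le \bar I(M,\rho,H,J)\triangleq\min\Big\{\sum_{c\in\mathcal{C}}\bar\iota(M,\overline{\mathsf{SINR}}_c),\ \log\big|N_0^{-1}HH^H+I_B\big|\Big\}. $$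
   Context: Let $B,U,I$ be positive integers, $H\in\mathbb{C}^{B\times U}$ and $J\in\mathbb{C}^{B\times I}$ fixed matrices, and $N_0>0$. Let $s\in\mathbb{C}^U$, $w\in\mathbb{C}^I$, $n\in\mathbb{C}^B$ be mutually independent random vectors and $y=Hs+Jw+n$. Let $\mathcal{C}=\{1,\dots,B\}\times\{\mathfrak{r},\mathfrak{i}\}$, and for $v\in\mathbb{C}^B$ write $v_{(b,\mathfrak{r})}=\mathrm{Re}(v_b)$, $v_{(b,\mathfrak{i})}=\mathrm{Im}(v_b)$. For each $c\in\mathcal{C}$, $Q_c:\mathbb{R}\to\mathfrak{Q}_c$ is a scalar quantizer with $M=|\mathfrak{Q}_c|\ge2$ levels (partitioning $\mathbb{R}$ into $M$ intervals, separated by at most $M-1$ boundary points, each mapped to a distinct level; possibly non-uniform and different for each $c$), and $q=(Q_c(y_c))_{c\in\mathcal{C}}$. Logarithms are base 2; $|\cdot|$ is the determinant. $H_b(x)=-x\log x-(1-x)\log(1-x)$, $\bar H_b(x)=H_b(\min\{x,1/2\})$, $\mathrm{erf}(x)=\frac{2}{\sqrt\pi}\int_0^xe^{-t^2}dt$, $\mathrm{erfc}=1-\mathrm{erf}$, $$\bar f(M,x)=\mathrm{erf}\Big(\tfrac{(M-1)\sqrt{x}}{\sqrt2}\Big)+\sqrt{\tfrac{2}{\pi}}(M-1)\sqrt{x}\,e^{-(M-1)^2x/2}-(M-1)^2x\,\mathrm{erfc}\Big(\tfrac{(M-1)\sqrt{x}}{\sqrt2}\Big),$$ $$\bar\iota(M,x)=\min\big\{\log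 M,\ \bar H_b(\bar f(M,x))+\bar f(M,x)\log(M-1)\big\}.$$ *)

theory Defs
  imports "HOL-Probability.Probability"
begin

text \<open>Real/imaginary component label: the index set C is 'b x ri.\<close>
datatype ri = Rp | Ip

lemma UNIV_ri: "(UNIV :: ri set) = {Rp, Ip}"
  using ri.exhaust by auto

instance ri :: finite
  by standard (simp add: UNIV_ri)

fun ri_part :: "ri \<Rightarrow> complex \<Rightarrow> real" where
  "ri_part Rp z = Re z"
| "ri_part Ip z = Im z"

definition is_quantizer :: "nat \<Rightarrow> (real \<Rightarrow> real) \<Rightarrow> bool" where
  "is_quantizer M Q \<longleftrightarrow> finite (range Q) \<and> card (range Q) = M \<and>
     (\<forall>l \<in> range Q. is_interval (Q -` {l}))"

definition circ_gaussian :: "'a measure \<Rightarrow> real \<Rightarrow> ('a \<Rightarrow> complex ^ 'k) \<Rightarrow> bool" where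
  "circ_gaussian P \<rho> w \<longleftrightarrow> w \<in> borel_measurable P \<and>
     (if \<rho> = 0 then (AE x in P. w x = 0)
      else prob_space.indep_vars P (\<lambda>_. borel) (\<lambda>(k, p) x. ri_part p (w x $ k)) UNIV \<and>
           (\<forall>k p. distributed P lborel (\<lambda>x. ri_part p (w x $ k))
                     (\<lambda>t. ennreal (normal_density 0 (sqrt (\<rho> / 2)) t))))"

definition indep3 :: "'a measure \<Rightarrow> ('a \<Rightarrow> 'x::topological_space) \<Rightarrow> ('a \<Rightarrow> 'y::topological_space) \<Rightarrow> ('a \<Rightarrow> 'z::topological_space) \<Rightarrow> bool" where
  "indep3 P X Y Z \<longleftrightarrow> X \<in> borel_measurable P \<and> Y \<in> borel_measurable P \<and> Z \<in> borel_measurable P \<and>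
     (\<forall>A\<in>sets borel. \<forall>B\<in>sets borel. \<forall>C\<in>sets borel.
        measure P {x \<in> space P. X x \<in> A \<and> Y x \<in> B \<and> Z x \<in> C} =
        measure P {x \<in> space P. X x \<in> A} * measure P {x \<in> space P. Y x \<in> B} *
        measure P {x \<in> space P. Z x \<in> C})"

definition herm :: "complex ^ 'n ^ 'm \<Rightarrow> complex ^ 'm ^ 'n" where
  "herm A = (\<chi> i j. cnj (A $ j $ i))"

definition quant_out ::
  "('b \<times> ri \<Rightarrow> real \<Rightarrow> real) \<Rightarrow> complex ^ 'u ^ 'b \<Rightarrow> complex ^ 'i ^ 'b \<Rightarrow>
   ('a \<Rightarrow> complex ^ 'u) \<Rightarrow> ('a \<Rightarrow> complex ^ 'i) \<Rightarrow> ('a \<Rightarrow> complex ^ 'b) \<Rightarrow>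
   'a \<Rightarrow> real ^ ('b \<times> ri)" where
  "quant_out Q H J s w n x =
     (\<chi> c. Q c (ri_part (snd c) ((H *v s x + J *v w x + n x) $ fst c)))"

definition erf :: "real \<Rightarrow> real" where
  "erf x = 2 / sqrt pi *
     (if 0 \<le> x then integral {0..x} (\<lambda>t. exp (- t\<^sup>2))
      else - integral {x..0} (\<lambda>t. exp (- t\<^sup>2)))"

definition erfc :: "real \<Rightarrow> real" where
  "erfc x = 1 - erf x"

text \<open>Binary entropy in bits, with the convention 0 log 0 = 0.\<close>
definition Hb :: "real \<Rightarrow> real" where
  "Hb x = (if x = 0 \<or> x = 1 then 0 else - x * log 2 x - (1 - x) * log 2 (1 - x))"

definition Hb_bar :: "real \<Rightarrow> real" where
  "Hb_bar x = Hb (min x (1/2))"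

definition f_bar :: "nat \<Rightarrow> real \<Rightarrow> real" where
  "f_bar M x =
     erf ((real M - 1) * sqrt x / sqrt 2)
     + sqrt (2 / pi) * (real M - 1) * sqrt x * exp (- ((real M - 1)\<^sup>2 * x / 2))
     - (real M - 1)\<^sup>2 * x * erfc ((real M - 1) * sqrt x / sqrt 2)"

definition iota_bar :: "nat \<Rightarrow> real \<Rightarrow> real" where
  "iota_bar M x = min (log 2 (real M)) (Hb_bar (f_bar M x) + f_bar M x * log 2 (real M - 1))"

definition SINR_bar :: "real \<Rightarrow> real \<Rightarrow> complex ^ 'u ^ 'b \<Rightarrow> complex ^ 'i ^ 'b \<Rightarrow> 'b \<times> ri \<Rightarrow> real" where
  "SINR_bar N0 \<rho> H J c = 2 * (norm (H $ fst c))\<^sup>2 / (\<rho> * (norm (J $ fst c))\<^sup>2 + N0)"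

definition I_bar :: "nat \<Rightarrow> real \<Rightarrow> real \<Rightarrow> complex ^ 'u ^ 'b \<Rightarrow> complex ^ 'i ^ 'b \<Rightarrow> real" where
  "I_bar M N0 \<rho> H J =
     min (\<Sum>c\<in>(UNIV :: ('b \<times> ri) set). iota_bar M (SINR_bar N0 \<rho> H J c))
         (log 2 (Re (det ((1 / of_real N0) *\<^sub>R (H ** herm H) + mat 1 :: complex ^ 'b ^ 'b))))"

end

theory Submission
  imports Defs "HOL-Real_Asymp.Real_Asymp"
begin

text \<open>
  Let \<open>f\<close> be the density of the joint law of \<open>(s, q)\<close> against the product of its marginals. If a
  positive random variable \<open>R\<close>, a function of the signal and of the noise \<open>(w, n)\<close>, satisfies
  \<open>E (f R) \<le> 1\<close>, then \<open>log x \<le> (x - 1) / ln 2\<close> gives \<open>I(q; s) \<le> - E (log R)\<close>. Two choices of \<open>R\<close> yield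
  the two bounds.

  For the sum over components, compare \<open>q\<close> with the output \<open>q'\<close> that would be observed for \<open>s = 0\<close>:
  it is independent of \<open>s\<close>, and \<open>R\<close> is a product over the components of Fano-type channel weights
  between \<open>q'\<close> and \<open>q\<close>. No conditional independence of the components is needed. In a
  component, \<open>q\<close> and \<open>q'\<close> differ only if the Gaussian noise \<open>z\<close> lies within the signal amplitude \<open>|a|\<close> of
  one of the \<open>M - 1\<close> quantizer boundaries; among sets of that length the centred interval has the
  largest Gaussian measure, so the error probability is at most the probability of
  \<open>|z| \<le> (M - 1) |a|\<close>. Chebyshev's inequality in \<open>a\<close> and integration over \<open>z\<close> produce \<open>f_bar\<close>.

  For the log-determinant bound, \<open>R\<close> is the ratio at \<open>H s + n\<close> of the density of the circular
  Gaussian law with covariance \<open>N0 I + H H*\<close> to the density of \<open>H s + n\<close> given \<open>s\<close>.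
\<close>

text \<open>Both choices of \<open>R\<close> hide an auxiliary output law \<open>r\<close> on the
  finite alphabet. Mutual information is at most the mean divergence of the law of q given s from
  any such r. Asking that \<open>R\<close>, integrated for a fixed signal over the noise that leads
  to output v, stay below \<open>r v\<close> expresses this on the noise space and replaces data
  processing for the quantizer. In the component bound r is the law of q' after independent
  symmetric channels. In the determinant bound it is the law of the quantized sum of J w and a
  Gaussian vector; the same w occurs on both sides, which is why \<rho> is absent from the
  determinant.

  The law of s is arbitrary up to second moments, so differences of entropies of s are avoided, and
  absolute continuity of the joint law rests on the finite range of the quantizers. Two default
  values shape the details: mutual information is 0 when the logarithm of its density is not
  integrable, and \<open>log 2 0\<close> is 0. Integrability and almost sure positivity are
  therefore tracked throughout.\<close>

section \<open>Mutual information with a finite output\<close>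

context prob_space
begin

text \<open>Jensen's inequality in its tangent form at 1, the one point that matters because the
  mean is compared with 1. The bound on the nonnegative integral also yields integrability of
  \<open>X\<close>, hence of the tangent line at \<open>X\<close>.\<close>

lemma expectation_log_nonpos:
  assumes X: "X \<in> borel_measurable M"
    and pos: "AE x in M. 0 < X x"
    and le: "(\<integral>\<^sup>+x. ennreal (X x) \<partial>M) \<le> 1"
    and int: "integrable M (\<lambda>x. log 2 (X x))"
  shows "expectation (\<lambda>x. log 2 (X x)) \<le> 0"
proof -
  have X_int: "integrable M X"
  proof (rule integrableI_nonneg[OF X])
    show "AE x in M. 0 \<le> X x" using pos by eventually_elim simp
    show "(\<integral>\<^sup>+x. ennreal (X x) \<partial>M) < \<infinity>"
      using le by (auto simp: order_le_less_trans)
  qed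
  have EX: "expectation X \<le> 1"
  proof -
    have "ennreal (expectation X) = (\<integral>\<^sup>+x. ennreal (X x) \<partial>M)"
    proof (intro nn_integral_eq_integral[symmetric] X_int)
      show "AE x in M. 0 \<le> X x" using pos by eventually_elim simp
    qed
    with le have "ennreal (expectation X) \<le> 1" by metis
    then show ?thesis by simp
  qed
  have "expectation (\<lambda>x. log 2 (X x)) \<le> expectation (\<lambda>x. (X x - 1) / ln 2)"
  proof (rule integral_mono_AE[OF int])
    show "integrable M (\<lambda>x. (X x - 1) / ln 2)" using X_int by simp
    show "AE x in M. log 2 (X x) \<le> (X x - 1) / ln 2"
      using pos by eventually_elim (simp add: log_def divide_right_mono ln_le_minus_one)
  qed
  also have "\<dots> = (expectation X - 1) / ln 2"
    using X_int by (simp add: prob_space)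
  also have "\<dots> \<le> 0" using EX by (simp add: divide_nonpos_pos)
  finally show ?thesis .
qed

text \<open>With \<open>f\<close> the density of the joint law against the product of the marginals, the hypotheses
  on \<open>R\<close> give \<open>E (f R) \<le> 1\<close>, whence \<open>E (log f + log R) \<le> 0\<close> because \<open>log x \<le> (x - 1) / ln 2\<close>.\<close>

lemma mutual_information_finite_le:
  fixes r :: "'v \<Rightarrow> ennreal" and s :: "'a \<Rightarrow> 's" and Z :: "'a \<Rightarrow> 'z"
  assumes s[measurable]: "s \<in> measurable M S" and Z[measurable]: "Z \<in> measurable M N"
    and indep: "distr M (S \<Otimes>\<^sub>M N) (\<lambda>x. (s x, Z x)) = distr M S s \<Otimes>\<^sub>M distr M N Z"
    and F[measurable]: "(\<lambda>(x, z). F x z) \<in> measurable (S \<Otimes>\<^sub>M N) T"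
    and V: "finite V" "\<And>v. v \<in> V \<Longrightarrow> {v} \<in> sets T"
      "\<And>x z. x \<in> space S \<Longrightarrow> z \<in> space N \<Longrightarrow> F x z \<in> V"
    and R[measurable]: "(\<lambda>(x, z). R x z) \<in> borel_measurable (S \<Otimes>\<^sub>M N)"
    and R_pos: "AE x in M. 0 < R (s x) (Z x)"
    and R_int: "integrable M (\<lambda>x. log 2 (R (s x) (Z x)))"
    and r: "\<And>x v. x \<in> space S \<Longrightarrow> v \<in> V \<Longrightarrow>
      (\<integral>\<^sup>+z. ennreal (R x z) * indicator {v} (F x z) \<partial>distr M N Z) \<le> r v"
    and r_sum: "sum r V \<le> 1"
  shows "mutual_information 2 S T s (\<lambda>x. F (s x) (Z x)) \<le> - expectation (\<lambda>x. log 2 (R (s x) (Z x)))"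
proof -
  define q where "q x = F (s x) (Z x)" for x
  have q[measurable]: "q \<in> measurable M T"
    unfolding q_def using measurable_compose[OF measurable_Pair[OF s Z] F] by simp
  define \<mu> where "\<mu> = distr M S s"
  define \<nu> where "\<nu> = distr M N Z"
  define \<kappa> where "\<kappa> = distr M T q"
  define joint where "joint = distr M (S \<Otimes>\<^sub>M T) (\<lambda>x. (s x, q x))"
  interpret \<mu>: prob_space \<mu> unfolding \<mu>_def by (rule prob_space_distr) measurable
  interpret \<nu>: prob_space \<nu> unfolding \<nu>_def by (rule prob_space_distr) measurable
  interpret \<kappa>: prob_space \<kappa> unfolding \<kappa>_def by (rule prob_space_distr) measurable
  interpret J: prob_space joint unfolding joint_def by (rule prob_space_distr) measurable
  interpret \<mu>\<kappa>: pair_prob_space \<mu> \<kappa> ..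
  have sets_eq[measurable_cong, simp]: "sets \<mu> = sets S" "sets \<nu> = sets N" "sets \<kappa> = sets T"
    "sets joint = sets (S \<Otimes>\<^sub>M T)"
    by (auto simp: \<mu>_def \<nu>_def \<kappa>_def joint_def)
  have space_eq[simp]: "space \<mu> = space S" "space \<nu> = space N" "space \<kappa> = space T"
    by (auto simp: \<mu>_def \<nu>_def \<kappa>_def)
  have qV: "q x \<in> V" if "x \<in> space M" for x
    unfolding q_def using V(3)[OF measurable_space[OF s that] measurable_space[OF Z that]] .
  have singleton_meas: "{x\<in>space M. q x = v} \<in> events" if "v \<in> V" for v
  proof -
    have "{x\<in>space M. q x = v} = q -` {v} \<inter> space M" by auto
    then show ?thesis using measurable_sets[OF q V(2)[OF that]] by simp
  qed

  \<comment> \<open>Stated for a general weight \<open>g\<close> because it is used twice: with the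
    constant 1 it bounds the mean of \<open>R\<close>, with the density it bounds the mean of
    \<open>f\<close> times \<open>R\<close>. Independence permits integrating over the noise first,
    one output value \<open>v\<close> at a time, which is where \<open>r v\<close> enters.\<close>
  have key: "(\<integral>\<^sup>+x. g (s x, q x) * ennreal (R (s x) (Z x)) \<partial>M) \<le> 1"
    if g[measurable]: "g \<in> borel_measurable (S \<Otimes>\<^sub>M T)"
      and g_le: "\<And>v. v \<in> V \<Longrightarrow> (\<integral>\<^sup>+x. g (x, v) \<partial>\<mu>) \<le> 1" for g :: "'s \<times> 'v \<Rightarrow> ennreal"
  proof -
    have Fx[measurable]: "F x \<in> measurable N T" if "x \<in> space S" for x
      using measurable_compose[OF measurable_Pair1'[OF that] F] by simp
    have Rx[measurable]: "R x \<in> borel_measurable N" if "x \<in> space S" for x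
      using measurable_compose[OF measurable_Pair1'[OF that] R] by simp
    have gv[measurable]: "(\<lambda>x. g (x, v)) \<in> borel_measurable S" if "v \<in> V" for v
    proof -
      have "v \<in> space T" using V(2)[OF that] by (meson insert_subset sets.sets_into_space)
      then show ?thesis using g by measurable
    qed
    have dist_eq: "distr M (S \<Otimes>\<^sub>M N) (\<lambda>x. (s x, Z x)) = \<mu> \<Otimes>\<^sub>M \<nu>"
      using indep unfolding \<mu>_def \<nu>_def .
    define h where "h = (\<lambda>(x, z). g (x, F x z) * ennreal (R x z))"
    have h[measurable]: "h \<in> borel_measurable (S \<Otimes>\<^sub>M N)"
    proof -
      have "(\<lambda>p. (fst p, (\<lambda>(x, z). F x z) p)) \<in> measurable (S \<Otimes>\<^sub>M N) (S \<Otimes>\<^sub>M T)" by measurable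
      from measurable_compose[OF this g]
      have [measurable]: "(\<lambda>p. g (fst p, (\<lambda>(x, z). F x z) p)) \<in> borel_measurable (S \<Otimes>\<^sub>M N)" .
      have "(\<lambda>p. g (fst p, (\<lambda>(x, z). F x z) p) * ennreal ((\<lambda>(x, z). R x z) p)) \<in> borel_measurable (S \<Otimes>\<^sub>M N)"
        by measurable
      then show ?thesis by (simp add: h_def split_beta)
    qed
    have "(\<integral>\<^sup>+x. g (s x, q x) * ennreal (R (s x) (Z x)) \<partial>M) = (\<integral>\<^sup>+p. h p \<partial>(\<mu> \<Otimes>\<^sub>M \<nu>))"
      unfolding dist_eq[symmetric] by (subst nn_integral_distr) (simp_all add: h_def q_def)
    also have "\<dots> = (\<integral>\<^sup>+x. \<integral>\<^sup>+z. h (x, z) \<partial>\<nu> \<partial>\<mu>)"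
      by (subst \<nu>.nn_integral_fst) simp_all
    also have "\<dots> \<le> (\<integral>\<^sup>+x. (\<Sum>v\<in>V. r v * g (x, v)) \<partial>\<mu>)"
    proof (rule nn_integral_mono)
      fix x assume "x \<in> space \<mu>"
      then have x: "x \<in> space S" by simp
      note [measurable] = Fx[OF x] Rx[OF x]
      have ind[measurable]: "(\<lambda>z. indicator {v} (F x z) :: ennreal) \<in> borel_measurable N" if "v \<in> V" for v
        using measurable_compose[OF Fx[OF x] borel_measurable_indicator[OF V(2)[OF that]]] .
      have "(\<integral>\<^sup>+z. h (x, z) \<partial>\<nu>) = (\<integral>\<^sup>+z. (\<Sum>v\<in>V. g (x, v) * (ennreal (R x z) * indicator {v} (F x z))) \<partial>\<nu>)"
      proof (rule nn_integral_cong)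
        fix z assume "z \<in> space \<nu>"
        then have Fv: "F x z \<in> V" using V(3) x by simp
        have "(\<Sum>v\<in>V. g (x, v) * (ennreal (R x z) * indicator {v} (F x z))) =
          (\<Sum>v\<in>V. if v = F x z then g (x, v) * ennreal (R x z) else 0)"
          by (rule sum.cong) (auto simp: indicator_def)
        also have "\<dots> = g (x, F x z) * ennreal (R x z)" using V(1) Fv by simp
        finally show "h (x, z) = (\<Sum>v\<in>V. g (x, v) * (ennreal (R x z) * indicator {v} (F x z)))"
          by (simp add: h_def)
      qed
      also have "\<dots> = (\<Sum>v\<in>V. g (x, v) * (\<integral>\<^sup>+z. ennreal (R x z) * indicator {v} (F x z) \<partial>\<nu>))"
        by (subst nn_integral_sum) (auto intro!: sum.cong nn_integral_cmult)
      also have "\<dots> \<le> (\<Sum>v\<in>V. g (x, v) * r v)"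
        using r[OF x] by (intro sum_mono mult_left_mono) (auto simp: \<nu>_def)
      finally show "(\<integral>\<^sup>+z. h (x, z) \<partial>\<nu>) \<le> (\<Sum>v\<in>V. r v * g (x, v))" by (simp add: mult.commute)
    qed
    also have "\<dots> = (\<Sum>v\<in>V. r v * (\<integral>\<^sup>+x. g (x, v) \<partial>\<mu>))"
      by (subst nn_integral_sum) (auto intro!: sum.cong nn_integral_cmult)
    also have "\<dots> \<le> (\<Sum>v\<in>V. r v * 1)"
      using g_le by (intro sum_mono mult_left_mono) auto
    also have "\<dots> \<le> 1" using r_sum by simp
    finally show ?thesis .
  qed

  have RZ[measurable]: "(\<lambda>x. R (s x) (Z x)) \<in> borel_measurable M"
    using measurable_compose[OF measurable_Pair[OF s Z] R] by simp
  have R_le: "(\<integral>\<^sup>+x. ennreal (R (s x) (Z x)) \<partial>M) \<le> 1"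
    using key[of "\<lambda>_. 1"] \<mu>.emeasure_space_1 by simp
  define f where "f = RN_deriv (\<mu> \<Otimes>\<^sub>M \<kappa>) joint"
  have f[measurable]: "f \<in> borel_measurable (S \<Otimes>\<^sub>M T)"
    unfolding f_def using borel_measurable_RN_deriv[of "\<mu> \<Otimes>\<^sub>M \<kappa>" joint]
    by (simp cong: measurable_cong_sets sets_pair_measure_cong)
  \<comment> \<open>A product null set has null slices over every atom of positive mass, and outputs
    of mass zero are almost surely avoided. As \<open>V\<close> is finite, these pieces cover the
    joint law.\<close>
  have slice: "emeasure joint A = 0" if A: "A \<in> null_sets (\<mu> \<Otimes>\<^sub>M \<kappa>)" for A
  proof -
    have A_sets[measurable]: "A \<in> sets (S \<Otimes>\<^sub>M T)" using A by (auto simp: null_sets_def cong: sets_pair_measure_cong)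
    have "emeasure M {x\<in>space M. (s x, q x) \<in> A \<and> q x = v} = 0" if v: "v \<in> V" for v
    proof (cases "emeasure \<kappa> {v} = 0")
      case True
      have "emeasure M {x\<in>space M. (s x, q x) \<in> A \<and> q x = v} \<le> emeasure M (q -` {v} \<inter> space M)"
        using measurable_sets[OF q V(2)[OF v]] by (intro emeasure_mono) auto
      also have "\<dots> = 0" using True V(2)[OF v] by (simp add: \<kappa>_def emeasure_distr)
      finally show ?thesis by simp
    next
      case False
      have "0 = emeasure (\<mu> \<Otimes>\<^sub>M \<kappa>) A" using A by auto
      also have "\<dots> = (\<integral>\<^sup>+y. emeasure \<mu> ((\<lambda>x. (x, y)) -` A) \<partial>\<kappa>)"
        using A by (intro \<mu>\<kappa>.emeasure_pair_measure_alt2) auto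
      also have "\<dots> \<ge> (\<integral>\<^sup>+y. emeasure \<mu> ((\<lambda>x. (x, v)) -` A) * indicator {v} y \<partial>\<kappa>)"
        by (intro nn_integral_mono) (auto simp: indicator_def)
      also have "(\<integral>\<^sup>+y. emeasure \<mu> ((\<lambda>x. (x, v)) -` A) * indicator {v} y \<partial>\<kappa>) =
          emeasure \<mu> ((\<lambda>x. (x, v)) -` A) * emeasure \<kappa> {v}"
        using V(2)[OF v] by (simp add: nn_integral_cmult_indicator)
      finally have "emeasure \<mu> ((\<lambda>x. (x, v)) -` A) = 0" using False by simp
      moreover have "(\<lambda>x. (x, v)) -` A \<in> sets S" using sets_Pair2[OF A_sets, of v] by simp
      ultimately have "emeasure M (s -` ((\<lambda>x. (x, v)) -` A) \<inter> space M) = 0"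
        by (simp add: \<mu>_def emeasure_distr)
      moreover have "{x\<in>space M. (s x, q x) \<in> A \<and> q x = v} \<subseteq> s -` ((\<lambda>x. (x, v)) -` A) \<inter> space M" by auto
      moreover have "s -` ((\<lambda>x. (x, v)) -` A) \<inter> space M \<in> events"
        using \<open>(\<lambda>x. (x, v)) -` A \<in> sets S\<close> by measurable
      ultimately have "emeasure M {x\<in>space M. (s x, q x) \<in> A \<and> q x = v} \<le> 0"
        using emeasure_mono[of _ "s -` ((\<lambda>x. (x, v)) -` A) \<inter> space M" M] by fastforce
      then show ?thesis by simp
    qed
    moreover have "{x\<in>space M. (s x, q x) \<in> A \<and> q x = v} \<in> events" if "v \<in> V" for v
    proof -
      have "{x\<in>space M. (s x, q x) \<in> A \<and> q x = v} = {x\<in>space M. (s x, q x) \<in> A} \<inter> {x\<in>space M. q x = v}" by auto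
      then show ?thesis using singleton_meas[OF that] by (auto intro!: sets.Int)
    qed
    ultimately have "(\<Union>v\<in>V. {x\<in>space M. (s x, q x) \<in> A \<and> q x = v}) \<in> null_sets M"
      using V(1) by (intro null_sets.finite_UN) auto
    moreover have "(\<Union>v\<in>V. {x\<in>space M. (s x, q x) \<in> A \<and> q x = v}) = (\<lambda>x. (s x, q x)) -` A \<inter> space M"
      using qV by blast
    ultimately show ?thesis by (simp add: joint_def emeasure_distr null_sets_def)
  qed
  have ac: "absolutely_continuous (\<mu> \<Otimes>\<^sub>M \<kappa>) joint"
    unfolding absolutely_continuous_def using slice
    by (auto simp: null_sets_def cong: sets_pair_measure_cong)
  have sets_joint: "sets joint = sets (\<mu> \<Otimes>\<^sub>M \<kappa>)" by (simp cong: sets_pair_measure_cong)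
  have dens: "density (\<mu> \<Otimes>\<^sub>M \<kappa>) f = joint"
    unfolding f_def by (rule \<mu>\<kappa>.density_RN_deriv[OF ac sets_joint])
  have f_fin: "AE p in joint. f p \<noteq> \<infinity>"
    using \<mu>\<kappa>.RN_deriv_finite[OF _ ac sets_joint] J.sigma_finite_measure_axioms
    by (auto simp: f_def intro: absolutely_continuous_AE[OF sets_joint ac])
  have f_pos: "AE p in joint. 0 < f p"
    by (subst dens[symmetric], subst AE_density) (auto cong: sets_pair_measure_cong)
  have fq: "AE x in M. 0 < f (s x, q x) \<and> f (s x, q x) \<noteq> \<infinity>"
    using AE_conjI[OF f_pos f_fin] unfolding joint_def by (subst (asm) AE_distr_iff) auto
  \<comment> \<open>Over an atom of mass zero the Radon-Nikodym derivative is arbitrary and its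
    slice integral may exceed 1, while \<open>key\<close> asks for the bound at every
    \<open>v\<close> in \<open>V\<close>. Cutting \<open>f\<close> off there changes nothing almost
    surely.\<close>
  define g where "g p = f p * indicator {v\<in>V. emeasure \<kappa> {v} \<noteq> 0} (snd p)" for p
  have Vsets: "{v\<in>V. emeasure \<kappa> {v} \<noteq> 0} \<in> sets T"
  proof -
    have "(\<Union>v\<in>{v\<in>V. emeasure \<kappa> {v} \<noteq> 0}. {v}) \<in> sets T"
      using V by (intro sets.finite_UN) auto
    then show ?thesis by simp
  qed
  have g[measurable]: "g \<in> borel_measurable (S \<Otimes>\<^sub>M T)"
    unfolding g_def using Vsets by measurable
  have g_le: "(\<integral>\<^sup>+x. g (x, v) \<partial>\<mu>) \<le> 1" if v: "v \<in> V" for v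
  proof (cases "emeasure \<kappa> {v} = 0")
    case True
    then show ?thesis by (simp add: g_def)
  next
    case False
    have vT: "{v} \<in> sets T" using V(2)[OF v] .
    have vs: "v \<in> space T" using vT by (meson insert_subset sets.sets_into_space)
    have [measurable]: "(\<lambda>x. f (x, v)) \<in> borel_measurable S" using f vs by measurable
    \<comment> \<open>The mass of \<open>space S \<times> {v}\<close> is computed from the density
      and from the marginal of \<open>q\<close>; cancelling the nonzero finite mass of the atom
      leaves a slice integral of exactly 1.\<close>
    have "emeasure joint (space S \<times> {v}) = (\<integral>\<^sup>+p. f p * indicator (space S \<times> {v}) p \<partial>(\<mu> \<Otimes>\<^sub>M \<kappa>))"
      using vT by (subst dens[symmetric], subst emeasure_density) (auto cong: sets_pair_measure_cong)
    also have "\<dots> = (\<integral>\<^sup>+x. \<integral>\<^sup>+y. f (x, y) * indicator (space S \<times> {v}) (x, y) \<partial>\<kappa> \<partial>\<mu>)"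
      using vT by (subst \<kappa>.nn_integral_fst) auto
    also have "\<dots> = (\<integral>\<^sup>+x. f (x, v) * emeasure \<kappa> {v} \<partial>\<mu>)"
    proof (rule nn_integral_cong)
      fix x assume x: "x \<in> space \<mu>"
      have "(\<integral>\<^sup>+y. f (x, y) * indicator (space S \<times> {v}) (x, y) \<partial>\<kappa>) =
        (\<integral>\<^sup>+y. f (x, v) * indicator {v} y \<partial>\<kappa>)"
        using x by (intro nn_integral_cong) (auto simp: indicator_def)
      then show "(\<integral>\<^sup>+y. f (x, y) * indicator (space S \<times> {v}) (x, y) \<partial>\<kappa>) = f (x, v) * emeasure \<kappa> {v}"
        using vT by (simp add: nn_integral_cmult_indicator)
    qed
    also have "\<dots> = (\<integral>\<^sup>+x. f (x, v) \<partial>\<mu>) * emeasure \<kappa> {v}"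
      by (intro nn_integral_multc) auto
    finally have "(\<integral>\<^sup>+x. f (x, v) \<partial>\<mu>) * emeasure \<kappa> {v} = emeasure joint (space S \<times> {v})" by simp
    also have "\<dots> = emeasure M (q -` {v} \<inter> space M)"
      unfolding joint_def using vT measurable_space[OF s]
      by (subst emeasure_distr) (auto intro!: arg_cong[where f="emeasure M"])
    also have "\<dots> = emeasure \<kappa> {v}" using vT by (simp add: \<kappa>_def emeasure_distr)
    finally have *: "(\<integral>\<^sup>+x. f (x, v) \<partial>\<mu>) * emeasure \<kappa> {v} = 1 * emeasure \<kappa> {v}" by simp
    have "(\<integral>\<^sup>+x. f (x, v) \<partial>\<mu>) = 1"
      using * False \<kappa>.emeasure_finite[of "{v}"]
      unfolding mult.commute[of _ "emeasure \<kappa> {v}"] ennreal_mult_cancel_left by (simp add: less_top)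
    then show ?thesis using False v by (simp add: g_def)
  qed
  have "AE x in M. q x = v \<longrightarrow> emeasure \<kappa> {v} \<noteq> 0" if v: "v \<in> V" for v
  proof (cases "emeasure \<kappa> {v} = 0")
    case True
    then have "{x\<in>space M. q x = v} \<in> null_sets M"
      using V(2)[OF v] singleton_meas[OF v]
      by (auto simp: \<kappa>_def emeasure_distr null_sets_def vimage_def Int_def conj_commute)
    from AE_not_in[OF this] AE_space show ?thesis by eventually_elim auto
  qed simp
  then have "AE x in M. \<forall>v\<in>V. q x = v \<longrightarrow> emeasure \<kappa> {v} \<noteq> 0"
    using V(1) by (intro AE_finite_allI)
  with AE_space have g_eq: "AE x in M. g (s x, q x) = f (s x, q x)"
    by eventually_elim (use qV in \<open>auto simp: g_def indicator_def\<close>)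
  define \<phi> where "\<phi> x = enn2real (f (s x, q x))" for x
  have fsq: "(\<lambda>x. f (s x, q x)) \<in> borel_measurable M"
    using measurable_compose[OF measurable_Pair[OF s q] f] .
  then have \<phi>[measurable]: "\<phi> \<in> borel_measurable M" unfolding \<phi>_def by measurable
  have \<phi>_pos: "AE x in M. 0 < \<phi> x" using fq
    by eventually_elim (auto simp: \<phi>_def enn2real_positive_iff less_top)
  have fR: "(\<integral>\<^sup>+x. ennreal (\<phi> x * R (s x) (Z x)) \<partial>M) \<le> 1"
  proof -
    have "(\<integral>\<^sup>+x. ennreal (\<phi> x * R (s x) (Z x)) \<partial>M) = (\<integral>\<^sup>+x. g (s x, q x) * ennreal (R (s x) (Z x)) \<partial>M)"
    proof (rule nn_integral_cong_AE)
      show "AE x in M. ennreal (\<phi> x * R (s x) (Z x)) = g (s x, q x) * ennreal (R (s x) (Z x))"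
        using g_eq fq R_pos \<phi>_pos
        by eventually_elim (auto simp: \<phi>_def ennreal_mult less_top)
    qed
    also have "\<dots> \<le> 1" using g g_le by (rule key)
    finally show ?thesis .
  qed
  have MI: "mutual_information 2 S T s q = expectation (\<lambda>x. log 2 (\<phi> x))"
    unfolding mutual_information_def KL_divergence_def entropy_density_def
    using f unfolding \<mu>_def[symmetric] \<kappa>_def[symmetric] joint_def[symmetric] f_def[symmetric]
    by (subst joint_def, subst integral_distr) (auto simp: \<phi>_def)
  have "expectation (\<lambda>x. log 2 (\<phi> x)) \<le> - expectation (\<lambda>x. log 2 (R (s x) (Z x)))"
  proof (cases "integrable M (\<lambda>x. log 2 (\<phi> x))")
    case True
    have log_eq: "AE x in M. log 2 (\<phi> x * R (s x) (Z x)) = log 2 (\<phi> x) + log 2 (R (s x) (Z x))"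
      using \<phi>_pos R_pos by eventually_elim (simp add: log_mult)
    have int: "integrable M (\<lambda>x. log 2 (\<phi> x * R (s x) (Z x)))"
      using log_eq by (subst integrable_cong_AE) (auto intro: True R_int)
    have "expectation (\<lambda>x. log 2 (\<phi> x * R (s x) (Z x))) \<le> 0"
    proof (intro expectation_log_nonpos int fR)
      show "AE x in M. 0 < \<phi> x * R (s x) (Z x)"
        using \<phi>_pos R_pos by eventually_elim simp
    qed measurable
    moreover have "expectation (\<lambda>x. log 2 (\<phi> x * R (s x) (Z x))) =
        expectation (\<lambda>x. log 2 (\<phi> x)) + expectation (\<lambda>x. log 2 (R (s x) (Z x)))"
      using log_eq by (subst integral_cong_AE[OF _ _ log_eq]) (auto simp: True R_int)
    ultimately show ?thesis by simp
  next
    case False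
    \<comment> \<open>Here the mutual information is 0 by the default value of the Bochner integral,
      so the right-hand side has to be nonnegative on its own; \<open>R_le\<close> provides
      this.\<close>
    have "expectation (\<lambda>x. log 2 (R (s x) (Z x))) \<le> 0"
      by (intro expectation_log_nonpos RZ R_pos R_le R_int)
    with False show ?thesis by (simp add: not_integrable_integral_eq)
  qed
  with MI show ?thesis by (simp add: q_def[abs_def])
qed

end

section \<open>Scalar quantizers in Gaussian noise\<close>

text \<open>The boundaries are the suprema of the cells that are bounded above. Finitely many cells
  cover the line, so at least one is unbounded above and has no such boundary, whence the count
  \<open>M - 1\<close>. If \<open>Q\<close> differs at two points, the cell of the left one is an
  interval that cannot reach past the right one, so its supremum lies between them.\<close>

lemma quantizer_boundaries:
  assumes "is_quantizer M Q"
  obtains T where "finite T" "card T \<le> M - 1"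
    "\<And>z a. Q (z + a) \<noteq> Q z \<Longrightarrow> \<exists>t\<in>T. \<bar>z - t\<bar> \<le> \<bar>a\<bar>"
proof -
  have fin: "finite (range Q)" and card_M: "card (range Q) = M"
    and int: "\<And>l. l \<in> range Q \<Longrightarrow> is_interval (Q -` {l})"
    using assms by (auto simp: is_quantizer_def)
  define L where "L = {l\<in>range Q. bdd_above (Q -` {l})}"
  define T where "T = (\<lambda>l. Sup (Q -` {l})) ` L"
  have "L \<noteq> range Q"
  proof
    assume "L = range Q"
    then have "bdd_above (\<Union>l\<in>range Q. Q -` {l})"
      using fin by (subst bdd_above_UN) (auto simp: L_def)
    moreover have "(\<Union>l\<in>range Q. Q -` {l}) = UNIV" by auto
    ultimately have "bdd_above (UNIV :: real set)" by simp
    then obtain b where "\<And>x::real. x \<le> b" unfolding bdd_above_def by blast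
    from this[of "b + 1"] show False by simp
  qed
  then have "L \<subset> range Q" by (auto simp: L_def)
  from psubset_card_mono[OF fin this] have "card L < M" by (simp only: card_M)
  moreover have "finite L" using fin by (simp add: L_def)
  ultimately have "card T \<le> M - 1" unfolding T_def using card_image_le[of L "\<lambda>l. Sup (Q -` {l})"] by linarith
  moreover have "finite T" using \<open>finite L\<close> by (simp add: T_def)
  moreover have between: "\<exists>t\<in>T. x \<le> t \<and> t \<le> y" if "Q x \<noteq> Q y" "x < y" for x y
  proof -
    have le_y: "u \<le> y" if u: "u \<in> Q -` {Q x}" for u
    proof (rule ccontr)
      assume "\<not> u \<le> y"
      then have "y \<in> Q -` {Q x}"
        using int[of "Q x"] u \<open>x < y\<close> unfolding is_interval_1
        by (smt (verit) rangeI vimage_singleton_eq)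
      with \<open>Q x \<noteq> Q y\<close> show False by simp
    qed
    then have bdd: "bdd_above (Q -` {Q x})" by (auto simp: bdd_above_def)
    then have "Sup (Q -` {Q x}) \<in> T" by (auto simp: T_def L_def)
    moreover have "x \<le> Sup (Q -` {Q x})" using bdd by (intro cSup_upper) auto
    moreover have "Sup (Q -` {Q x}) \<le> y" using le_y by (intro cSup_least) auto
    ultimately show ?thesis by blast
  qed
  have "\<exists>t\<in>T. \<bar>z - t\<bar> \<le> \<bar>a\<bar>" if "Q (z + a) \<noteq> Q z" for z a
  proof (cases "a > 0")
    case True
    then show ?thesis using between[of z "z + a"] that by force
  next
    case False
    moreover have "a \<noteq> 0" using that by auto
    ultimately show ?thesis using between[of "z + a" z] that by force
  qed
  ultimately show ?thesis using that by blast
qed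

lemma quantizer_measurable:
  assumes "is_quantizer M Q"
  shows "Q \<in> borel_measurable borel"
proof -
  have fin: "finite (range Q)" and int: "\<And>l. l \<in> range Q \<Longrightarrow> Q -` {l} \<in> sets borel"
    using assms by (auto simp: is_quantizer_def intro: real_interval_borel_measurable)
  show ?thesis
  proof (rule measurableI)
    fix A :: "real set"
    have "Q -` A \<inter> space borel = (\<Union>l\<in>A \<inter> range Q. Q -` {l})" by auto
    also have "\<dots> \<in> sets borel" using fin int by (intro sets.finite_UN) auto
    finally show "Q -` A \<inter> space borel \<in> sets borel" .
  qed simp
qed

section \<open>Standard normal law: rearrangement and the integral behind
  \<open>f_bar\<close>\<close>

abbreviation std_normal :: "real measure" where
  "std_normal \<equiv> density lborel (\<lambda>x. ennreal (std_normal_density x))"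

lemma std_normal_density_antimono:
  assumes "\<bar>x\<bar> \<le> \<bar>y\<bar>"
  shows "std_normal_density y \<le> std_normal_density x"
  using abs_le_square_iff[of x y] assms by (simp add: std_normal_density_def divide_right_mono)

text \<open>Bathtub argument. Let \<open>c\<close> be the density at the edge \<open>R\<close>. The
  density can exceed \<open>c\<close> only inside the centred interval, so any set collects at most
  that whole excess plus \<open>c\<close> times its length, and the centred interval attains this
  total for length \<open>2 * R\<close>.\<close>

lemma std_normal_emeasure_le_centred:
  assumes S[measurable]: "S \<in> sets borel" and R: "0 \<le> R" and le: "emeasure lborel S \<le> ennreal (2 * R)"
  shows "emeasure std_normal S \<le> emeasure std_normal {-R..R}"
proof -
  define c where "c = std_normal_density R"
  have c: "0 \<le> c" by (simp add: c_def)
  have split: "ennreal (std_normal_density x) * indicator S x \<le>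
     ennreal (std_normal_density x - c) * indicator {-R..R} x + ennreal c * indicator S x" for x
  proof (cases "x \<in> {-R..R}")
    case True
    then have "c \<le> std_normal_density x" unfolding c_def by (intro std_normal_density_antimono) auto
    then have "ennreal (std_normal_density x - c) + ennreal c = ennreal (std_normal_density x)"
      using c by (subst ennreal_plus[symmetric]) auto
    with True show ?thesis by (auto simp: indicator_def)
  next
    case False
    then have "std_normal_density x \<le> c" unfolding c_def using R by (intro std_normal_density_antimono) auto
    with False show ?thesis by (auto simp: indicator_def intro!: ennreal_leI)
  qed
  have "emeasure std_normal S \<le> (\<integral>\<^sup>+x. ennreal (std_normal_density x - c) * indicator {-R..R} x + ennreal c * indicator S x \<partial>lborel)"
    by (subst emeasure_density) (auto intro!: nn_integral_mono split)
  also have "\<dots> = (\<integral>\<^sup>+x. ennreal (std_normal_density x - c) * indicator {-R..R} x \<partial>lborel) + ennreal c * emeasure lborel S"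
    by (subst nn_integral_add) (auto simp: nn_integral_cmult_indicator)
  also have "\<dots> \<le> (\<integral>\<^sup>+x. ennreal (std_normal_density x - c) * indicator {-R..R} x \<partial>lborel) + ennreal c * emeasure lborel {-R..R}"
    using le R by (intro add_left_mono mult_left_mono) auto
  also have "\<dots> = (\<integral>\<^sup>+x. ennreal (std_normal_density x - c) * indicator {-R..R} x + ennreal c * indicator {-R..R} x \<partial>lborel)"
    by (subst nn_integral_add) (auto simp: nn_integral_cmult_indicator)
  also have "\<dots> = (\<integral>\<^sup>+x. ennreal (std_normal_density x) * indicator {-R..R} x \<partial>lborel)"
  proof (rule nn_integral_cong)
    fix x :: real
    have "ennreal (std_normal_density x - c) + ennreal c = ennreal (std_normal_density x)" if "x \<in> {-R..R}"
    proof -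
      have "c \<le> std_normal_density x" unfolding c_def using that by (intro std_normal_density_antimono) auto
      then show ?thesis using c by (subst ennreal_plus[symmetric]) auto
    qed
    then show "ennreal (std_normal_density x - c) * indicator {-R..R} x + ennreal c * indicator {-R..R} x =
      ennreal (std_normal_density x) * indicator {-R..R} x" by (auto simp: indicator_def)
  qed
  also have "\<dots> = emeasure std_normal {-R..R}" by (subst emeasure_density) auto
  finally show ?thesis .
qed

text \<open>Windows of radius \<open>r\<close> around at most \<open>m\<close> points cover a total
  length of at most \<open>2 * m * r\<close>, so rearrangement leaves a single centred interval as
  the worst case. The unknown positions of the boundaries disappear here.\<close>

lemma std_normal_near_finite_le:
  assumes T: "finite T" "card T \<le> m" and r: "0 \<le> r"
  shows "emeasure std_normal {z. \<exists>t\<in>T. \<bar>z - t\<bar> \<le> r} \<le> emeasure std_normal {z. \<bar>z\<bar> \<le> real m * r}"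
proof -
  have eq: "{z. \<exists>t\<in>T. \<bar>z - t\<bar> \<le> r} = (\<Union>t\<in>T. {t - r..t + r})"
    by (rule set_eqI) (simp add: abs_le_iff algebra_simps conj_commute)
  have "emeasure lborel (\<Union>t\<in>T. {t - r..t + r}) \<le> (\<Sum>t\<in>T. emeasure lborel {t - r..t + r})"
    using T by (intro emeasure_subadditive_finite) auto
  also have "\<dots> = (\<Sum>t\<in>T. ennreal (2 * r))" using r by (intro sum.cong) auto
  also have "\<dots> = ennreal (real (card T) * (2 * r))"
    by (simp add: ennreal_mult r ennreal_of_nat_eq_real_of_nat)
  also have "\<dots> \<le> ennreal (2 * (real m * r))"
    using T r by (intro ennreal_leI) (simp add: mult_right_mono)
  finally have "emeasure std_normal (\<Union>t\<in>T. {t - r..t + r}) \<le> emeasure std_normal {-(real m * r)..real m * r}"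
    using r T by (intro std_normal_emeasure_le_centred sets.finite_UN) auto
  moreover have "{z. \<bar>z\<bar> \<le> real m * r} = {-(real m * r)..real m * r}" by (auto simp: abs_le_iff)
  ultimately show ?thesis by (simp add: eq)
qed

lemma std_normal_emeasure_erf:
  assumes k: "0 \<le> k"
  shows "emeasure std_normal {-k..k} = ennreal (erf (k / sqrt 2))"
proof -
  define y where "y = k / sqrt 2"
  have y: "0 \<le> y" using k by (simp add: y_def)
  let ?e = "\<lambda>t::real. exp (- t\<^sup>2)"
  have cont: "continuous_on A ?e" for A by (intro continuous_intros)
  have "emeasure std_normal {-k..k} = (\<integral>\<^sup>+x. ennreal (std_normal_density x) * indicator {-k..k} x \<partial>lborel)"
    by (subst emeasure_density) auto
  also have "\<dots> = \<bar>sqrt 2\<bar> * (\<integral>\<^sup>+x. ennreal (std_normal_density (0 + sqrt 2 * x)) * indicator {-k..k} (0 + sqrt 2 * x) \<partial>lborel)"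
    by (rule nn_integral_real_affine) auto
  also have "(\<integral>\<^sup>+x. ennreal (std_normal_density (0 + sqrt 2 * x)) * indicator {-k..k} (0 + sqrt 2 * x) \<partial>lborel) =
     (\<integral>\<^sup>+x. ennreal (1 / sqrt (2 * pi)) * ennreal (indicator {-y..y} x * ?e x) \<partial>lborel)"
  proof (rule nn_integral_cong)
    fix x :: real
    have "sqrt 2 * x \<in> {-k..k} \<longleftrightarrow> x \<in> {-y..y}"
      by (auto simp: y_def field_simps)
    then show "ennreal (std_normal_density (0 + sqrt 2 * x)) * indicator {-k..k} (0 + sqrt 2 * x) =
       ennreal (1 / sqrt (2 * pi)) * ennreal (indicator {-y..y} x * ?e x)"
      by (auto simp: std_normal_density_def indicator_def power_mult_distrib ennreal_mult[symmetric])
  qed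
  also have "\<dots> = ennreal (1 / sqrt (2 * pi)) * (\<integral>\<^sup>+x. ennreal (indicator {-y..y} x * ?e x) \<partial>lborel)"
    by (rule nn_integral_cmult) auto
  also have "(\<integral>\<^sup>+x. ennreal (indicator {-y..y} x * ?e x) \<partial>lborel) = ennreal (LINT x:{-y..y}|lborel. ?e x)"
    unfolding set_lebesgue_integral_def using borel_integrable_atLeastAtMost'[OF cont, of "-y" y]
    by (subst nn_integral_eq_integral) (auto simp: set_integrable_def)
  also have "(LINT x:{-y..y}|lborel. ?e x) = integral {-y..y} ?e"
    by (rule set_borel_integral_eq_integral borel_integrable_atLeastAtMost' cont)+
  also have "integral {-y..y} ?e = 2 * integral {0..y} ?e"
  proof -
    have "integral {-y..y} ?e = integral {-y..0} ?e + integral {0..y} ?e"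
      using y by (intro Henstock_Kurzweil_Integration.integral_combine[symmetric] integrable_continuous_interval cont) auto
    moreover have "integral {-y..-0} (\<lambda>x. ?e (-x)) = integral {0..y} ?e" using Henstock_Kurzweil_Integration.integral_reflect_real[where f="?e" and a=0 and b=y] .
    ultimately show ?thesis by simp
  qed
  also have "ennreal \<bar>sqrt 2\<bar> * (ennreal (1 / sqrt (2 * pi)) * ennreal (2 * integral {0..y} ?e)) =
    ennreal (2 / sqrt pi * integral {0..y} ?e)"
  proof -
    have "0 \<le> integral {0..y} ?e" by (rule Henstock_Kurzweil_Integration.integral_nonneg)
      (auto intro!: integrable_continuous_interval cont)
    then show ?thesis by (subst ennreal_mult[symmetric], simp_all)+ (simp add: real_sqrt_mult)
  qed
  also have "\<dots> = ennreal (erf y)" using y by (simp add: erf_def)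
  finally show ?thesis by (simp add: y_def)
qed

lemma erf_nonneg:
  assumes "0 \<le> y"
  shows "0 \<le> erf y"
proof -
  have "0 \<le> integral {0..y} (\<lambda>t. exp (- t\<^sup>2))"
    by (rule Henstock_Kurzweil_Integration.integral_nonneg)
      (auto intro!: integrable_continuous_interval continuous_intros)
  then show ?thesis using assms by (simp add: erf_def)
qed

text \<open>Writing \<phi> for the density, \<phi>' = - z \<phi> makes - \<phi>(z) / z a primitive
  of \<phi>(z) / z^2 + \<phi>(z) that vanishes at infinity. The Chebyshev tail thus reduces to
  \<phi>(k) / k minus a Gaussian tail mass.\<close>

lemma std_normal_tail_inverse_square:
  assumes k: "0 < k"
  shows "(\<integral>\<^sup>+z. ennreal (1 / z\<^sup>2) * indicator {k..} z \<partial>std_normal) + emeasure std_normal {k..}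
    = ennreal (std_normal_density k / k)"
proof -
  let ?f = "\<lambda>z. std_normal_density z * (1 / z\<^sup>2) + std_normal_density z"
  let ?F = "\<lambda>z. - (std_normal_density z / z)"
  have "(\<integral>\<^sup>+z. ennreal (?f z) * indicator {k..} z \<partial>lborel) = ennreal (0 - ?F k)"
  proof (rule nn_integral_FTC_atLeast)
    show "?f \<in> borel_measurable borel" by measurable
    fix z :: real assume "k \<le> z"
    then have z: "0 < z" using k by simp
    show "DERIV ?F z :> ?f z"
    proof -
      define c where "c = 1 / sqrt (2 * pi)"
      have "DERIV (\<lambda>z. - (c * exp (- z\<^sup>2 / 2) / z)) z :> c * exp (- z\<^sup>2 / 2) * (1 / z\<^sup>2) + c * exp (- z\<^sup>2 / 2)"
        using z by (auto intro!: derivative_eq_intros simp: field_simps power2_eq_square)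
      then show ?thesis by (simp add: std_normal_density_def c_def)
    qed
    show "0 \<le> ?f z" using z by simp
  next
    show "(?F \<longlongrightarrow> 0) at_top"
      unfolding std_normal_density_def by real_asymp
  qed
  moreover have "(\<integral>\<^sup>+z. ennreal (?f z) * indicator {k..} z \<partial>lborel) =
     (\<integral>\<^sup>+z. ennreal (std_normal_density z) * (ennreal (1 / z\<^sup>2) * indicator {k..} z) + ennreal (std_normal_density z) * indicator {k..} z \<partial>lborel)"
    by (intro nn_integral_cong) (auto simp: indicator_def simp flip: ennreal_mult ennreal_plus)
  moreover have "\<dots> = (\<integral>\<^sup>+z. ennreal (1 / z\<^sup>2) * indicator {k..} z \<partial>std_normal) + emeasure std_normal {k..}"
    by (subst nn_integral_add) (auto simp: nn_integral_density emeasure_density)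
  ultimately show ?thesis by simp
qed

lemma std_normal_symmetric:
  assumes [measurable]: "f \<in> borel_measurable borel"
  shows "(\<integral>\<^sup>+z. f (- z) \<partial>std_normal) = (\<integral>\<^sup>+z. f z \<partial>std_normal)"
  using nn_integral_real_affine[of "\<lambda>z. ennreal (std_normal_density z) * f z" "-1" 0]
  by (simp add: nn_integral_density std_normal_density_def)

text \<open>The integrand is the Chebyshev bound, capped at 1, on the probability that
  \<open>(M - 1) * \<bar>a\<bar>\<close> reaches \<open>\<bar>z\<bar>\<close> for a random
  \<open>a\<close> of second moment at most \<open>x\<close>. The centre gives the error function.
  The two tails give 2 k^2 (\<phi>(k) / k - t), where t is the mass of one tail and 2 t = 1 - erf(k
  / sqrt 2); these are the remaining terms of \<open>f_bar\<close>.\<close>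

lemma f_bar_eq_nn_integral:
  fixes M :: nat and x :: real
  assumes M: "1 \<le> M" and x: "0 \<le> x"
  defines "k \<equiv> (real M - 1) * sqrt x"
  shows "(\<integral>\<^sup>+z. (if \<bar>z\<bar> \<le> k then 1 else ennreal (k\<^sup>2 / z\<^sup>2)) \<partial>std_normal) = ennreal (f_bar M x)" (is "?I = _")
    and f_bar_nonneg: "0 \<le> f_bar M x"
proof -
  interpret N: prob_space std_normal by (rule prob_space_normal_density) simp
  have k0: "0 \<le> k" using M x by (simp add: k_def)
  define e where "e = erf (k / sqrt 2)"
  have e: "emeasure std_normal {-k..k} = ennreal e" unfolding e_def by (rule std_normal_emeasure_erf[OF k0])
  have k2: "k\<^sup>2 = (real M - 1)\<^sup>2 * x" using x by (simp add: k_def power_mult_distrib)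
  have f_bar: "f_bar M x = e + 2 * k * std_normal_density k - k\<^sup>2 * (1 - e)"
  proof -
    have "sqrt (2 / pi) = 2 / sqrt (2 * pi)"
      by (simp add: real_sqrt_divide real_sqrt_mult real_div_sqrt field_simps)
    then show ?thesis
      unfolding f_bar_def erfc_def e_def std_normal_density_def k2 by (simp add: k_def mult.assoc power_mult_distrib x)
  qed
  show "?I = ennreal (f_bar M x)" "0 \<le> f_bar M x"
  \<comment> \<open>The tail formula divides by \<open>k\<close>; for \<open>k = 0\<close> the
    integrand is the indicator of a null set.\<close>
  proof (atomize (full), cases "k = 0")
    case True
    have "(\<integral>\<^sup>+z. (if \<bar>z\<bar> \<le> k then 1 else ennreal (k\<^sup>2 / z\<^sup>2)) \<partial>std_normal) = (\<integral>\<^sup>+z. indicator {-k..k} z \<partial>std_normal)"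
      by (intro nn_integral_cong) (auto simp: True)
    also have "\<dots> = ennreal e" by (simp add: e)
    also have "e = 0" by (simp add: e_def True erf_def)
    finally show "?I = ennreal (f_bar M x) \<and> 0 \<le> f_bar M x" using f_bar True \<open>e = 0\<close> by simp
  next
    case False
    then have k: "0 < k" using k0 by simp
    define I where "I = (\<integral>\<^sup>+z. ennreal (1 / z\<^sup>2) * indicator {k..} z \<partial>std_normal)"
    define \<tau> where "\<tau> = emeasure std_normal {k..}"
    have sum: "I + \<tau> = ennreal (std_normal_density k / k)"
      unfolding I_def \<tau>_def by (rule std_normal_tail_inverse_square[OF k])
    have I_refl: "(\<integral>\<^sup>+z. ennreal (1 / z\<^sup>2) * indicator {..-k} z \<partial>std_normal) = I"
    proof -
      have "(\<integral>\<^sup>+z. ennreal (1 / z\<^sup>2) * indicator {..-k} z \<partial>std_normal) =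
        (\<integral>\<^sup>+z. ennreal (1 / (-z)\<^sup>2) * indicator {k..} (-z) \<partial>std_normal)"
        by (intro nn_integral_cong) (auto simp: indicator_def)
      also have "\<dots> = I" unfolding I_def
        by (rule std_normal_symmetric[where f="\<lambda>z. ennreal (1 / z\<^sup>2) * indicator {k..} z"]) measurable
      finally show ?thesis .
    qed
    have \<tau>_refl: "emeasure std_normal {..-k} = \<tau>"
    proof -
      have "emeasure std_normal {..-k} = (\<integral>\<^sup>+z. indicator {..-k} z \<partial>std_normal)" by simp
      also have "\<dots> = (\<integral>\<^sup>+z. indicator {k..} (-z) \<partial>std_normal)"
        by (intro nn_integral_cong) (auto simp: indicator_def)
      also have "\<dots> = (\<integral>\<^sup>+z. indicator {k..} z \<partial>std_normal)"
        by (rule std_normal_symmetric[where f="indicator {k..}"]) simp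
      finally show ?thesis by (simp add: \<tau>_def)
    qed
    \<comment> \<open>The closed centre and the two closed tails overlap at these endpoints
      only.\<close>
    have ae: "AE z in std_normal. z \<noteq> k \<and> z \<noteq> - k"
      using AE_lborel_singleton[of k] AE_lborel_singleton[of "-k"] by (auto simp: AE_density)
    obtain i t where i: "I = ennreal i" "0 \<le> i" and t: "\<tau> = ennreal t" "0 \<le> t"
      using sum by (cases I; cases \<tau>) auto
    have it: "i + t = std_normal_density k / k"
      using sum i t k by (simp flip: ennreal_plus)
    have e0: "0 \<le> e"
      unfolding e_def using k0 by (intro erf_nonneg) simp
    have "1 = (\<integral>\<^sup>+z. indicator {-k..k} z + (indicator {k..} z + indicator {..-k} z) \<partial>std_normal)"
    proof -
      have "1 = (\<integral>\<^sup>+z. 1 \<partial>std_normal)" using N.emeasure_space_1 by simp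
      also have "\<dots> = (\<integral>\<^sup>+z. indicator {-k..k} z + (indicator {k..} z + indicator {..-k} z) \<partial>std_normal)"
        by (rule nn_integral_cong_AE, use ae in eventually_elim) (use k in \<open>auto simp: indicator_def\<close>)
      finally show ?thesis .
    qed
    also have "\<dots> = ennreal e + (\<tau> + \<tau>)"
      by (simp add: nn_integral_add e \<tau>_refl) (simp add: \<tau>_def)
    finally have et: "e + 2 * t = 1"
      using t e0 by (simp flip: ennreal_plus ennreal_1)
    have "(\<integral>\<^sup>+z. (if \<bar>z\<bar> \<le> k then 1 else ennreal (k\<^sup>2 / z\<^sup>2)) \<partial>std_normal) =
       (\<integral>\<^sup>+z. indicator {-k..k} z + ennreal (k\<^sup>2) * (ennreal (1 / z\<^sup>2) * indicator {k..} z + ennreal (1 / z\<^sup>2) * indicator {..-k} z) \<partial>std_normal)"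
      by (rule nn_integral_cong_AE, use ae in eventually_elim) (use k in \<open>auto simp: indicator_def simp flip: ennreal_mult\<close>)
    also have "\<dots> = ennreal e + ennreal (k\<^sup>2) * (I + I)"
      by (simp add: nn_integral_add nn_integral_cmult e I_refl) (simp add: I_def)
    also have "\<dots> = ennreal (e + k\<^sup>2 * (2 * i))"
    proof -
      have "I + I = ennreal (2 * i)" using i by (simp flip: ennreal_plus)
      then show ?thesis using i e0 by (simp flip: ennreal_plus ennreal_mult)
    qed
    also have "e + k\<^sup>2 * (2 * i) = f_bar M x"
    proof -
      have "i = std_normal_density k / k - t" and "2 * t = 1 - e" using it et by auto
      then have "2 * i = 2 * (std_normal_density k / k) - (1 - e)" by linarith
      then have "k\<^sup>2 * (2 * i) = 2 * (k\<^sup>2 * (std_normal_density k / k)) - k\<^sup>2 * (1 - e)"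
        by (simp only: right_diff_distrib mult.left_commute)
      moreover have "k\<^sup>2 * (std_normal_density k / k) = k * std_normal_density k"
        using k by (simp add: power2_eq_square)
      ultimately show ?thesis by (simp add: f_bar)
    qed
    finally have "?I = ennreal (f_bar M x)" .
    moreover have "0 \<le> f_bar M x"
      using e0 i \<open>e + k\<^sup>2 * (2 * i) = f_bar M x\<close> by (metis add_nonneg_nonneg mult_nonneg_nonneg zero_le_numeral zero_le_power2)
    ultimately show "?I = ennreal (f_bar M x) \<and> 0 \<le> f_bar M x" ..
  qed
qed

text \<open>Two conditionings are combined. For a fixed amplitude, rearrangement bounds the
  probability that the noise is near a boundary; for fixed noise, the amplitude is random and only
  its second moment is known. Exchanging the integrals passes from the first to the second. Dividing
  everything by \<sigma> beforehand makes \<open>x\<close> the bound on the second moment of the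
  amplitude.\<close>

lemma (in prob_space) quantizer_error_le_f_bar:
  assumes Q: "is_quantizer m Q" and \<sigma>: "0 < \<sigma>" and x: "0 \<le> x"
    and Y: "distributed M lborel Y (\<lambda>t. ennreal (normal_density 0 \<sigma> t))"
    and indep: "indep_var borel A borel Y"
    and A_le: "(\<integral>\<^sup>+\<omega>. ennreal ((A \<omega>)\<^sup>2) \<partial>M) \<le> ennreal (x * \<sigma>\<^sup>2)"
  shows "prob {\<omega>\<in>space M. Q (Y \<omega> + A \<omega>) \<noteq> Q (Y \<omega>)} \<le> f_bar m x"
proof -
  have m1: "1 \<le> m" using Q by (auto simp: is_quantizer_def Suc_le_eq card_gt_0_iff)
  define k where "k = (real m - 1) * sqrt x"
  have k2: "k\<^sup>2 = (real m - 1)\<^sup>2 * x" using x by (simp add: k_def power_mult_distrib)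
  obtain T where T: "finite T" "card T \<le> m - 1"
    "\<And>z a. Q (z + a) \<noteq> Q z \<Longrightarrow> \<exists>t\<in>T. \<bar>z - t\<bar> \<le> \<bar>a\<bar>"
    using quantizer_boundaries[OF Q] by blast
  define T' where "T' = (\<lambda>t. t / \<sigma>) ` T"
  have T': "finite T'" "card T' \<le> m - 1"
    using T card_image_le[of T "\<lambda>t. t / \<sigma>"] by (auto simp: T'_def)
  define a where "a \<omega> = A \<omega> / \<sigma>" for \<omega>
  define Z where "Z \<omega> = Y \<omega> / \<sigma>" for \<omega>
  note [measurable] = quantizer_measurable[OF Q]
  have [measurable]: "A \<in> borel_measurable M" "Y \<in> borel_measurable M"
    using indep by (auto dest: indep_var_rv1 indep_var_rv2)
  have [measurable]: "a \<in> borel_measurable M" "Z \<in> borel_measurable M"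
    unfolding a_def Z_def by measurable
  have "indep_var borel ((\<lambda>y. y / \<sigma>) \<circ> A) borel ((\<lambda>y. y / \<sigma>) \<circ> Y)"
    by (rule indep_var_compose[OF indep]) auto
  then have joint: "distr M (borel \<Otimes>\<^sub>M borel) (\<lambda>\<omega>. (a \<omega>, Z \<omega>)) = distr M borel a \<Otimes>\<^sub>M distr M borel Z"
    unfolding indep_var_distribution_eq by (simp add: comp_def a_def[abs_def] Z_def[abs_def])
  have "distributed M lborel (\<lambda>\<omega>. (Y \<omega> - 0) / \<sigma>) (\<lambda>t. ennreal (std_normal_density t))"
    using Y normal_standard_normal_convert[OF \<sigma>] by blast
  then have Z: "distr M borel Z = std_normal"
    using distributed_distr_eq_density[of M lborel Z] by (simp add: Z_def[abs_def] cong: distr_cong)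
  have a_le: "(\<integral>\<^sup>+\<omega>. ennreal ((a \<omega>)\<^sup>2) \<partial>M) \<le> ennreal x"
  proof -
    have "(\<integral>\<^sup>+\<omega>. ennreal ((a \<omega>)\<^sup>2) \<partial>M) = (\<integral>\<^sup>+\<omega>. ennreal ((A \<omega>)\<^sup>2) * ennreal (1 / \<sigma>\<^sup>2) \<partial>M)"
      by (intro nn_integral_cong) (simp add: a_def power_divide flip: ennreal_mult)
    also have "\<dots> = (\<integral>\<^sup>+\<omega>. ennreal ((A \<omega>)\<^sup>2) \<partial>M) * ennreal (1 / \<sigma>\<^sup>2)"
      by (rule nn_integral_multc) measurable
    also have "\<dots> \<le> ennreal (x * \<sigma>\<^sup>2) * ennreal (1 / \<sigma>\<^sup>2)" using A_le by (intro mult_right_mono) auto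
    also have "\<dots> = ennreal x" using \<sigma> x by (simp flip: ennreal_mult)
    finally show ?thesis .
  qed
  interpret N: prob_space std_normal by (rule prob_space_normal_density) simp
  interpret a: prob_space "distr M borel a" by (rule prob_space_distr) measurable
  interpret pair_sigma_finite "distr M borel a" std_normal ..
  let ?near = "\<lambda>\<alpha>. {z. \<exists>t\<in>T'. \<bar>z - t\<bar> \<le> \<bar>\<alpha>\<bar>}"
  have near_eq: "{p. \<exists>t\<in>T'. \<bar>snd p - t\<bar> \<le> \<bar>fst p\<bar>} = (\<Union>t\<in>T'. {p::real\<times>real. \<bar>snd p - t\<bar> \<le> \<bar>fst p\<bar>})" by auto
  have near_sets: "{p. \<exists>t\<in>T'. \<bar>snd p - t\<bar> \<le> \<bar>fst p\<bar>} \<in> sets (borel \<Otimes>\<^sub>M borel :: (real \<times> real) measure)"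
  proof -
    have "{p::real\<times>real. \<bar>snd p - t\<bar> \<le> \<bar>fst p\<bar>} \<in> sets (borel \<Otimes>\<^sub>M borel)" for t
    proof -
      have "Measurable.pred (borel \<Otimes>\<^sub>M borel) (\<lambda>p::real\<times>real. \<bar>snd p - t\<bar> \<le> \<bar>fst p\<bar>)" by measurable
      then show ?thesis by (simp add: pred_def space_pair_measure)
    qed
    then show ?thesis unfolding near_eq using T' by (intro sets.finite_UN) auto
  qed
  let ?in = "\<lambda>(\<alpha>, z). indicator {z. \<bar>z\<bar> \<le> real (m - 1) * \<bar>\<alpha>\<bar>} z :: ennreal"
  have in_meas[measurable]: "?in \<in> borel_measurable (borel \<Otimes>\<^sub>M borel)"
  proof -
    have "?in = indicator {p. \<bar>snd p\<bar> \<le> real (m - 1) * \<bar>fst p\<bar>}" by (auto simp: indicator_def fun_eq_iff)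
    moreover have "Measurable.pred (borel \<Otimes>\<^sub>M borel) (\<lambda>p::real\<times>real. \<bar>snd p\<bar> \<le> real (m - 1) * \<bar>fst p\<bar>)" by measurable
    ultimately show ?thesis by (simp add: pred_def space_pair_measure)
  qed
  have "emeasure M {\<omega>\<in>space M. Q (Y \<omega> + A \<omega>) \<noteq> Q (Y \<omega>)} \<le>
      emeasure M ((\<lambda>\<omega>. (a \<omega>, Z \<omega>)) -` {p. \<exists>t\<in>T'. \<bar>snd p - t\<bar> \<le> \<bar>fst p\<bar>} \<inter> space M)"
  proof (rule emeasure_mono)
    show "{\<omega>\<in>space M. Q (Y \<omega> + A \<omega>) \<noteq> Q (Y \<omega>)} \<subseteq> (\<lambda>\<omega>. (a \<omega>, Z \<omega>)) -` {p. \<exists>t\<in>T'. \<bar>snd p - t\<bar> \<le> \<bar>fst p\<bar>} \<inter> space M"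
    proof (intro subsetI)
      fix \<omega> assume "\<omega> \<in> {\<omega>\<in>space M. Q (Y \<omega> + A \<omega>) \<noteq> Q (Y \<omega>)}"
      then have \<omega>: "\<omega> \<in> space M" and "Q (Y \<omega> + A \<omega>) \<noteq> Q (Y \<omega>)"
        by auto
      from T(3)[OF this(2)] obtain t where t: "t \<in> T" "\<bar>Y \<omega> - t\<bar> \<le> \<bar>A \<omega>\<bar>" by blast
      then have "\<bar>Y \<omega> - t\<bar> / \<sigma> \<le> \<bar>A \<omega>\<bar> / \<sigma>" using \<sigma> by (simp add: divide_right_mono)
      then have "\<bar>Z \<omega> - t / \<sigma>\<bar> \<le> \<bar>a \<omega>\<bar>"
        using \<sigma> by (simp add: Z_def a_def flip: diff_divide_distrib)
      then show "\<omega> \<in> (\<lambda>\<omega>. (a \<omega>, Z \<omega>)) -` {p. \<exists>t\<in>T'. \<bar>snd p - t\<bar> \<le> \<bar>fst p\<bar>} \<inter> space M"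
        using t \<omega> by (auto simp: T'_def)
    qed
    show "(\<lambda>\<omega>. (a \<omega>, Z \<omega>)) -` {p. \<exists>t\<in>T'. \<bar>snd p - t\<bar> \<le> \<bar>fst p\<bar>} \<inter> space M \<in> sets M"
      by (rule measurable_sets[OF _ near_sets]) measurable
  qed
  also have "\<dots> = emeasure (distr M borel a \<Otimes>\<^sub>M std_normal) {p. \<exists>t\<in>T'. \<bar>snd p - t\<bar> \<le> \<bar>fst p\<bar>}"
    using near_sets unfolding Z[symmetric] joint[symmetric] by (subst emeasure_distr) auto
  also have "\<dots> = (\<integral>\<^sup>+\<alpha>. emeasure std_normal (?near \<alpha>) \<partial>distr M borel a)"
  proof -
    have "Pair \<alpha> -` {p. \<exists>t\<in>T'. \<bar>snd p - t\<bar> \<le> \<bar>fst p\<bar>} = ?near \<alpha>" for \<alpha> by auto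
    then show ?thesis using near_sets by (subst N.emeasure_pair_measure_alt) (simp_all cong: sets_pair_measure_cong)
  qed
  also have "\<dots> \<le> (\<integral>\<^sup>+\<alpha>. emeasure std_normal {z. \<bar>z\<bar> \<le> real (m - 1) * \<bar>\<alpha>\<bar>} \<partial>distr M borel a)"
    using T' by (intro nn_integral_mono std_normal_near_finite_le) auto
  also have "\<dots> = (\<integral>\<^sup>+\<alpha>. \<integral>\<^sup>+z. ?in (\<alpha>, z) \<partial>std_normal \<partial>distr M borel a)"
  proof (rule nn_integral_cong)
    fix \<alpha>
    have "{z. \<bar>z\<bar> \<le> real (m - 1) * \<bar>\<alpha>\<bar>} = {- (real (m - 1) * \<bar>\<alpha>\<bar>)..real (m - 1) * \<bar>\<alpha>\<bar>}" by (auto simp: abs_le_iff)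
    then have "{z. \<bar>z\<bar> \<le> real (m - 1) * \<bar>\<alpha>\<bar>} \<in> sets borel" by simp
    then show "emeasure std_normal {z. \<bar>z\<bar> \<le> real (m - 1) * \<bar>\<alpha>\<bar>} = (\<integral>\<^sup>+z. ?in (\<alpha>, z) \<partial>std_normal)" by simp
  qed
  also have "\<dots> = (\<integral>\<^sup>+z. \<integral>\<^sup>+\<alpha>. ?in (\<alpha>, z) \<partial>distr M borel a \<partial>std_normal)"
    by (rule Fubini'[symmetric]) (simp cong: measurable_cong_sets sets_pair_measure_cong)
  also have "\<dots> \<le> (\<integral>\<^sup>+z. (if \<bar>z\<bar> \<le> k then 1 else ennreal (k\<^sup>2 / z\<^sup>2)) \<partial>std_normal)"
  proof (rule nn_integral_mono)
    fix z :: real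
    show "(\<integral>\<^sup>+\<alpha>. ?in (\<alpha>, z) \<partial>distr M borel a) \<le> (if \<bar>z\<bar> \<le> k then 1 else ennreal (k\<^sup>2 / z\<^sup>2))"
    proof (cases "\<bar>z\<bar> \<le> k")
      case True
      have "(\<integral>\<^sup>+\<alpha>. ?in (\<alpha>, z) \<partial>distr M borel a) \<le> (\<integral>\<^sup>+\<alpha>. 1 \<partial>distr M borel a)"
        by (intro nn_integral_mono) (auto simp: indicator_def)
      then show ?thesis using True a.emeasure_space_1 by simp
    next
      case False
      then have z: "z \<noteq> 0" using k_def m1 x by auto
      have "(\<integral>\<^sup>+\<alpha>. ?in (\<alpha>, z) \<partial>distr M borel a) \<le> (\<integral>\<^sup>+\<alpha>. ennreal ((real m - 1)\<^sup>2 / z\<^sup>2) * ennreal (\<alpha>\<^sup>2) \<partial>distr M borel a)"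
      proof (rule nn_integral_mono)
        fix \<alpha> :: real
        show "?in (\<alpha>, z) \<le> ennreal ((real m - 1)\<^sup>2 / z\<^sup>2) * ennreal (\<alpha>\<^sup>2)"
        proof (cases "\<bar>z\<bar> \<le> real (m - 1) * \<bar>\<alpha>\<bar>")
          case True
          then have "\<bar>z\<bar>\<^sup>2 \<le> (real (m - 1) * \<bar>\<alpha>\<bar>)\<^sup>2" by (intro power_mono) auto
          then have "z\<^sup>2 \<le> (real m - 1)\<^sup>2 * \<alpha>\<^sup>2" using m1 by (simp add: power_mult_distrib of_nat_diff)
          then have "1 \<le> (real m - 1)\<^sup>2 / z\<^sup>2 * \<alpha>\<^sup>2" using z by (simp add: field_simps)
          then show ?thesis using True by (simp add: flip: ennreal_mult)
        qed simp
      qed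
      also have "\<dots> = ennreal ((real m - 1)\<^sup>2 / z\<^sup>2) * (\<integral>\<^sup>+\<omega>. ennreal ((a \<omega>)\<^sup>2) \<partial>M)"
        by (subst nn_integral_cmult) (auto simp: nn_integral_distr)
      also have "\<dots> \<le> ennreal ((real m - 1)\<^sup>2 / z\<^sup>2) * ennreal x" using a_le by (rule mult_left_mono) simp
      also have "\<dots> = ennreal (k\<^sup>2 / z\<^sup>2)" using x by (simp add: k2 flip: ennreal_mult)
      finally show ?thesis using False by simp
    qed
  qed
  also have "\<dots> = ennreal (f_bar m x)" unfolding k_def by (rule f_bar_eq_nn_integral[OF m1 x])
  finally have le: "emeasure M {\<omega>\<in>space M. Q (Y \<omega> + A \<omega>) \<noteq> Q (Y \<omega>)} \<le> ennreal (f_bar m x)" .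
  have nonneg: "0 \<le> f_bar m x" by (rule f_bar_nonneg[OF m1 x])
  show "prob {\<omega>\<in>space M. Q (Y \<omega> + A \<omega>) \<noteq> Q (Y \<omega>)} \<le> f_bar m x"
    using le nonneg by (simp add: emeasure_eq_measure)
qed

section \<open>Fano bounds over components\<close>

lemma borel_measurable_vec_nth[measurable (raw)]:
  fixes f :: "'a \<Rightarrow> 'b::euclidean_space ^ 'n"
  assumes "f \<in> borel_measurable M"
  shows "(\<lambda>x. f x $ i) \<in> borel_measurable M"
  using assms by (rule borel_measurable_continuous_on[rotated]) (intro continuous_intros)

lemma borel_measurable_vec_lambda[measurable (raw)]:
  fixes f :: "'n::finite \<Rightarrow> 'a \<Rightarrow> 'b::euclidean_space"
  assumes "\<And>i. f i \<in> borel_measurable M"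
  shows "(\<lambda>x. \<chi> i. f i x) \<in> borel_measurable M"
proof (subst borel_measurable_euclidean_space, rule ballI)
  fix b :: "'b ^ 'n" assume "b \<in> Basis"
  then obtain i u where b: "b = axis i u" by (auto simp: Basis_vec_def)
  have "(\<lambda>x. f i x \<bullet> u) \<in> borel_measurable M" using assms by measurable
  then show "(\<lambda>x. (\<chi> i. f i x) \<bullet> b) \<in> borel_measurable M" by (simp add: b inner_axis)
qed

lemma borel_measurable_matrix_vector_mult[measurable (raw)]:
  fixes A :: "complex ^ 'n ^ 'm"
  assumes [measurable]: "f \<in> borel_measurable M"
  shows "(\<lambda>x. A *v f x) \<in> borel_measurable M"
  unfolding matrix_vector_mult_def by measurable

lemma borel_measurable_cnj[measurable (raw)]:
  assumes "f \<in> borel_measurable M"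
  shows "(\<lambda>x. cnj (f x)) \<in> borel_measurable M"
  using assms by (rule borel_measurable_continuous_on[rotated]) (intro continuous_intros)

lemma borel_measurable_ri_part[measurable (raw)]:
  assumes [measurable]: "f \<in> borel_measurable M"
  shows "(\<lambda>x. ri_part p (f x)) \<in> borel_measurable M"
  by (cases p) simp_all

text \<open>The pair \<open>(\<alpha>, \<beta>)\<close> is the row of a symmetric channel (correct, each single error). Using
  crossover weight \<open>min f (1/2)\<close> instead of \<open>p\<close> itself makes monotonicity of the binary
  entropy unnecessary.\<close>

lemma fano_weights:
  fixes p f :: real
  assumes M: "2 \<le> M" and p: "0 \<le> p" "p \<le> f"
  obtains \<alpha> \<beta> :: real where "0 < \<alpha>" "0 \<le> \<beta>" "p \<noteq> 0 \<Longrightarrow> 0 < \<beta>" "\<alpha> + (real M - 1) * \<beta> = 1"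
    "- ((1 - p) * log 2 \<alpha> + p * log 2 \<beta>) \<le> min (log 2 (real M)) (Hb_bar f + f * log 2 (real M - 1))"
proof (cases "log 2 (real M) \<le> Hb_bar f + f * log 2 (real M - 1)")
  case True
  show thesis
  \<comment> \<open>Uniform weights cost log M whatever the error probability is.\<close>
  proof (rule that[of "1 / real M" "1 / real M"])
    show "1 / real M + (real M - 1) * (1 / real M) = 1" using M by (simp add: field_simps)
    show "- ((1 - p) * log 2 (1 / real M) + p * log 2 (1 / real M)) \<le> min (log 2 (real M)) (Hb_bar f + f * log 2 (real M - 1))"
      using True M by (simp add: log_divide algebra_simps)
  qed (use M in auto)
next
  case False
  define m where "m = real M - 1"
  have m: "1 \<le> m" using M by (simp add: m_def)
  have lm: "0 \<le> log 2 m" using m by simp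
  consider "f = 0" | "0 < f" "f < 1/2" | "1/2 \<le> f" using p by linarith
  then show thesis
  proof cases
    case 1
    \<comment> \<open>\<open>f = 0\<close> forces \<open>p = 0\<close>, so a zero error weight is
      permitted and no error is charged.\<close>
    then show thesis using False p by (intro that[of 1 0]) (auto simp: Hb_bar_def Hb_def)
  next
    case 2
    \<comment> \<open>For \<open>f < 1/2\<close> this makes the coefficient of \<open>p\<close>
      below nonnegative, so \<open>p\<close> may be raised to \<open>f\<close>.\<close>
    have l: "log 2 f \<le> log 2 (1 - f)" using 2 by simp
    have "- ((1 - p) * log 2 (1 - f) + p * log 2 (f / m)) = - log 2 (1 - f) + p * (log 2 (1 - f) - log 2 f + log 2 m)"
      using 2 m by (simp add: log_divide algebra_simps)
    also have "\<dots> \<le> - log 2 (1 - f) + f * (log 2 (1 - f) - log 2 f + log 2 m)"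
      using p l lm by (intro add_left_mono mult_right_mono) auto
    also have "\<dots> = Hb_bar f + f * log 2 m"
      using 2 by (simp add: Hb_bar_def Hb_def algebra_simps)
    finally show thesis using False 2 m by (intro that[of "1 - f" "f / m"]) (auto simp: m_def)
  next
    case 3
    \<comment> \<open>With weight 1/2 on the correct symbol the binary part is one bit for every
      \<open>p\<close>, and one bit is the constant value of \<open>Hb_bar\<close> from 1/2
      on.\<close>
    have "- ((1 - p) * log 2 (1/2) + p * log 2 (1 / (2 * m))) = 1 + p * log 2 m"
      using m by (simp add: log_divide log_mult algebra_simps)
    also have "\<dots> \<le> 1 + f * log 2 m" using p lm by (intro add_left_mono mult_right_mono) auto
    also have "\<dots> = Hb_bar f + f * log 2 m" using 3 by (simp add: Hb_bar_def Hb_def log_divide)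
    finally have le: "- ((1 - p) * log 2 (1/2) + p * log 2 (1 / (2 * m))) \<le> Hb_bar f + f * log 2 m" .
    show thesis
    proof (rule that[of "1/2" "1 / (2 * m)"])
      show "1 / 2 + (real M - 1) * (1 / (2 * m)) = 1" using m by (simp flip: m_def)
    qed (use False m le in \<open>auto simp flip: m_def\<close>)
  qed
qed

text \<open>Distributivity, transported from dependent functions to vectors: a product channel is
  normalised as soon as each of its factors is.\<close>

lemma sum_vec_prod:
  fixes g :: "'c::finite \<Rightarrow> 'v \<Rightarrow> 'r::comm_semiring_1"
  assumes "\<And>c. finite (L c)"
  shows "finite {v :: 'v ^ 'c. \<forall>c. v $ c \<in> L c}"
    and "(\<Sum>v\<in>{v :: 'v ^ 'c. \<forall>c. v $ c \<in> L c}. \<Prod>c\<in>UNIV. g c (v $ c)) = (\<Prod>c\<in>UNIV. \<Sum>l\<in>L c. g c l)"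
proof -
  have bij: "bij_betw vec_lambda (PiE UNIV L) {v :: 'v ^ 'c. \<forall>c. v $ c \<in> L c}"
    by (rule bij_betw_byWitness[where f'=vec_nth]) (auto simp: PiE_UNIV_domain)
  show "finite {v :: 'v ^ 'c. \<forall>c. v $ c \<in> L c}"
    using bij_betw_finite[OF bij] assms finite_PiE[of UNIV L] by simp
  show "(\<Sum>v\<in>{v :: 'v ^ 'c. \<forall>c. v $ c \<in> L c}. \<Prod>c\<in>UNIV. g c (v $ c)) = (\<Prod>c\<in>UNIV. \<Sum>l\<in>L c. g c l)"
    using assms by (subst sum.reindex_bij_betw[OF bij, symmetric], subst prod_sum_PiE) auto
qed

text \<open>Conditioning on the reference output \<open>G Z\<close>, which is independent of \<open>s\<close>, turns the
  dependence between the components into a union of scalar Fano bounds.\<close>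

lemma (in prob_space) mutual_information_le_sum_fano:
  fixes F :: "'s \<Rightarrow> 'z \<Rightarrow> real ^ 'c" and G :: "'z \<Rightarrow> real ^ 'c"
  assumes s[measurable]: "s \<in> measurable M S" and Z[measurable]: "Z \<in> measurable M N"
    and indep: "distr M (S \<Otimes>\<^sub>M N) (\<lambda>x. (s x, Z x)) = distr M S s \<Otimes>\<^sub>M distr M N Z"
    and F[measurable]: "(\<lambda>(x, z). F x z) \<in> borel_measurable (S \<Otimes>\<^sub>M N)"
    and G[measurable]: "G \<in> borel_measurable N"
    and L: "\<And>c. finite (L c)" "\<And>c. card (L c) = m" "\<And>x z c. F x z $ c \<in> L c" "\<And>z c. G z $ c \<in> L c"
    and m: "2 \<le> m"
    and f: "\<And>c. prob {x\<in>space M. F (s x) (Z x) $ c \<noteq> G (Z x) $ c} \<le> f c"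
  shows "mutual_information 2 S borel s (\<lambda>x. F (s x) (Z x))
    \<le> (\<Sum>c\<in>UNIV. min (log 2 (real m)) (Hb_bar (f c) + f c * log 2 (real m - 1)))"
proof -
  define err where "err c = {x\<in>space M. F (s x) (Z x) $ c \<noteq> G (Z x) $ c}" for c
  define p where "p c = prob (err c)" for c
  have FsZ[measurable]: "(\<lambda>x. F (s x) (Z x)) \<in> borel_measurable M"
    using measurable_compose[OF measurable_Pair[OF s Z] F] by simp
  have err[measurable]: "err c \<in> events" for c unfolding err_def by measurable
  have "\<forall>c. \<exists>\<alpha> \<beta>. 0 < \<alpha> \<and> 0 \<le> \<beta> \<and> (p c \<noteq> 0 \<longrightarrow> 0 < \<beta>) \<and> \<alpha> + (real m - 1) * \<beta> = 1 \<and>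
    - ((1 - p c) * log 2 \<alpha> + p c * log 2 \<beta>) \<le> min (log 2 (real m)) (Hb_bar (f c) + f c * log 2 (real m - 1))"
  proof
    fix c
    have "0 \<le> p c" "p c \<le> f c" using f[of c] by (auto simp: p_def err_def)
    then show "\<exists>\<alpha> \<beta>. 0 < \<alpha> \<and> 0 \<le> \<beta> \<and> (p c \<noteq> 0 \<longrightarrow> 0 < \<beta>) \<and> \<alpha> + (real m - 1) * \<beta> = 1 \<and>
    - ((1 - p c) * log 2 \<alpha> + p c * log 2 \<beta>) \<le> min (log 2 (real m)) (Hb_bar (f c) + f c * log 2 (real m - 1))"
      using fano_weights[OF m, of "p c" "f c"] by metis
  qed
  then obtain \<alpha> \<beta> where \<alpha>: "\<And>c. 0 < \<alpha> c" and \<beta>: "\<And>c. 0 \<le> \<beta> c" "\<And>c. p c \<noteq> 0 \<Longrightarrow> 0 < \<beta> c"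
    and \<alpha>\<beta>: "\<And>c. \<alpha> c + (real m - 1) * \<beta> c = 1"
    and fano: "\<And>c. - ((1 - p c) * log 2 (\<alpha> c) + p c * log 2 (\<beta> c)) \<le> min (log 2 (real m)) (Hb_bar (f c) + f c * log 2 (real m - 1))"
    by metis
  define \<rho> where "\<rho> c v u = (if v = u then \<alpha> c else \<beta> c)" for c and v u :: real
  have \<rho>_nonneg: "0 \<le> \<rho> c v u" for c v u using \<alpha>[of c] \<beta>(1)[of c] by (simp add: \<rho>_def)
  define V where "V = {v :: real ^ 'c. \<forall>c. v $ c \<in> L c}"
  define R where "R x z = (\<Prod>c\<in>UNIV. \<rho> c (F x z $ c) (G z $ c))" for x z
  define r where "r v = (\<integral>\<^sup>+z. ennreal (\<Prod>c\<in>UNIV. \<rho> c (v $ c) (G z $ c)) \<partial>distr M N Z)" for v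
  have \<rho>_meas[measurable (raw)]: "(\<lambda>x. \<rho> c (g x) (h x)) \<in> borel_measurable K"
    if [measurable]: "g \<in> borel_measurable K" "h \<in> borel_measurable K" for g h c and K :: "'k measure"
    unfolding \<rho>_def by measurable
  \<comment> \<open>Each factor of \<open>R\<close> takes two values, so its logarithm is affine in
    one error indicator. The expectation therefore involves the marginal error probabilities alone
    and no joint law of the errors.\<close>
  have log_R: "AE x in M. 0 < R (s x) (Z x) \<and>
      log 2 (R (s x) (Z x)) = (\<Sum>c\<in>UNIV. log 2 (\<alpha> c) + (log 2 (\<beta> c) - log 2 (\<alpha> c)) * indicator (err c) x)"
  proof -
    \<comment> \<open>A weight \<open>\<beta> c\<close> may be 0, but only if the error event is
      null, so \<open>R\<close> stays positive almost surely.\<close>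
    have "AE x in M. x \<in> err c \<longrightarrow> 0 < \<beta> c" for c
    proof (cases "p c = 0")
      case True
      then have "err c \<in> null_sets M" by (simp add: p_def emeasure_eq_measure null_sets_def)
      from AE_not_in[OF this] show ?thesis by eventually_elim simp
    qed (use \<beta>(2) in auto)
    then have "AE x in M. \<forall>c\<in>UNIV. x \<in> err c \<longrightarrow> 0 < \<beta> c"
      by (intro AE_finite_allI) auto
    with AE_space show ?thesis
    proof eventually_elim
      fix x assume x: "x \<in> space M" "\<forall>c\<in>UNIV. x \<in> err c \<longrightarrow> 0 < \<beta> c"
      have pos: "0 < \<rho> c (F (s x) (Z x) $ c) (G (Z x) $ c)" for c
        using x \<alpha> by (auto simp: \<rho>_def err_def)
      have "log 2 (R (s x) (Z x)) = (\<Sum>c\<in>UNIV. log 2 (\<rho> c (F (s x) (Z x) $ c) (G (Z x) $ c)))"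
        unfolding log_def R_def using pos by (subst ln_prod) (auto simp: sum_divide_distrib less_le)
      also have "\<dots> = (\<Sum>c\<in>UNIV. log 2 (\<alpha> c) + (log 2 (\<beta> c) - log 2 (\<alpha> c)) * indicator (err c) x)"
        using x(1) by (intro sum.cong) (auto simp: \<rho>_def err_def)
      finally show "0 < R (s x) (Z x) \<and>
        log 2 (R (s x) (Z x)) = (\<Sum>c\<in>UNIV. log 2 (\<alpha> c) + (log 2 (\<beta> c) - log 2 (\<alpha> c)) * indicator (err c) x)"
        using pos by (simp add: R_def prod_pos)
    qed
  qed
  have R_meas[measurable]: "(\<lambda>(x, z). R x z) \<in> borel_measurable (S \<Otimes>\<^sub>M N)"
  proof -
    have [measurable]: "(\<lambda>p. F (fst p) (snd p)) \<in> borel_measurable (S \<Otimes>\<^sub>M N)"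
      using F by (simp add: split_beta)
    show ?thesis unfolding R_def split_beta by measurable
  qed
  have RsZ[measurable]: "(\<lambda>x. R (s x) (Z x)) \<in> borel_measurable M"
    using measurable_compose[OF measurable_Pair[OF s Z] R_meas] by simp
  have int: "integrable M (\<lambda>x. \<Sum>c\<in>UNIV. log 2 (\<alpha> c) + (log 2 (\<beta> c) - log 2 (\<alpha> c)) * indicator (err c) x)"
    by (auto intro!: Bochner_Integration.integrable_sum simp: less_top[symmetric])
  have "mutual_information 2 S borel s (\<lambda>x. F (s x) (Z x)) \<le> - expectation (\<lambda>x. log 2 (R (s x) (Z x)))"
  proof (rule mutual_information_finite_le[where V=V and r=r])
    show "finite V" unfolding V_def by (rule sum_vec_prod(1)[OF L(1)])
    show "F x z \<in> V" for x z using L(3) by (simp add: V_def)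
    show "AE x in M. 0 < R (s x) (Z x)" using log_R by eventually_elim simp
    show "integrable M (\<lambda>x. log 2 (R (s x) (Z x)))"
    proof (subst integrable_cong_AE)
      show "AE x in M. log 2 (R (s x) (Z x)) =
          (\<Sum>c\<in>UNIV. log 2 (\<alpha> c) + (log 2 (\<beta> c) - log 2 (\<alpha> c)) * indicator (err c) x)"
        using log_R by eventually_elim simp
    qed (simp_all add: int)
    \<comment> \<open>Where the indicator is 1, \<open>F x z\<close> equals \<open>v\<close>; once
      \<open>v\<close> is substituted and the indicator dropped, the integrand no longer involves
      \<open>x\<close>.\<close>
    show "(\<integral>\<^sup>+z. ennreal (R x z) * indicator {v} (F x z) \<partial>distr M N Z) \<le> r v" for x v
      unfolding r_def R_def by (intro nn_integral_mono) (auto simp: indicator_def)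
    have "sum r V = (\<integral>\<^sup>+z. (\<Sum>v\<in>V. ennreal (\<Prod>c\<in>UNIV. \<rho> c (v $ c) (G z $ c))) \<partial>distr M N Z)"
      unfolding r_def by (rule nn_integral_sum[symmetric]) measurable
    also have "\<dots> = (\<integral>\<^sup>+z. 1 \<partial>distr M N Z)"
    proof (rule nn_integral_cong)
      fix z
      have "(\<Sum>l\<in>L c. \<rho> c l (G z $ c)) = 1" for c
      proof -
        have "(\<Sum>l\<in>L c. \<rho> c l (G z $ c)) = \<alpha> c + (\<Sum>l\<in>L c - {G z $ c}. \<beta> c)"
          using L(1)[of c] L(4)[of z c] by (subst sum.remove[of _ "G z $ c"]) (auto simp: \<rho>_def intro!: sum.cong)
        also have "\<dots> = 1" using L(1)[of c] L(4)[of z c] L(2)[of c] m \<alpha>\<beta>[of c] by (simp add: of_nat_diff)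
        finally show ?thesis .
      qed
      then have "(\<Sum>v\<in>V. \<Prod>c\<in>UNIV. \<rho> c (v $ c) (G z $ c)) = 1"
        unfolding V_def using sum_vec_prod(2)[where L=L and g="\<lambda>c l. \<rho> c l (G z $ c)", OF L(1)] by simp
      then show "(\<Sum>v\<in>V. ennreal (\<Prod>c\<in>UNIV. \<rho> c (v $ c) (G z $ c))) = 1"
        by (subst sum_ennreal) (auto intro!: prod_nonneg \<rho>_nonneg)
    qed
    also have "\<dots> = 1" using prob_space.emeasure_space_1[OF prob_space_distr[OF Z]] by simp
    finally show "sum r V \<le> 1" by simp
  qed (use indep F R_meas in auto)
  also have "expectation (\<lambda>x. log 2 (R (s x) (Z x))) =
      expectation (\<lambda>x. \<Sum>c\<in>UNIV. log 2 (\<alpha> c) + (log 2 (\<beta> c) - log 2 (\<alpha> c)) * indicator (err c) x)"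
    using log_R by (intro integral_cong_AE) (auto elim!: eventually_mono)
  also have "\<dots> = (\<Sum>c\<in>UNIV. log 2 (\<alpha> c) + (log 2 (\<beta> c) - log 2 (\<alpha> c)) * p c)"
    by (simp add: Bochner_Integration.integral_sum Bochner_Integration.integral_add prob_space p_def less_top[symmetric])
  also have "- \<dots> = (\<Sum>c\<in>UNIV. - ((1 - p c) * log 2 (\<alpha> c) + p c * log 2 (\<beta> c)))"
    unfolding sum_negf[symmetric] by (intro sum.cong) (auto simp: algebra_simps)
  also have "\<dots> \<le> (\<Sum>c\<in>UNIV. min (log 2 (real m)) (Hb_bar (f c) + f c * log 2 (real m - 1)))"
    by (intro sum_mono fano)
  finally show ?thesis .
qed

section \<open>Independence and second moments\<close>

context prob_space
begin

lemma joint_distr_eq_pairI: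
  assumes X[measurable]: "X \<in> measurable M S" and Y[measurable]: "Y \<in> measurable M N"
    and eq: "\<And>A B. A \<in> sets S \<Longrightarrow> B \<in> sets N \<Longrightarrow>
      prob {x\<in>space M. X x \<in> A \<and> Y x \<in> B} = prob {x\<in>space M. X x \<in> A} * prob {x\<in>space M. Y x \<in> B}"
  shows "distr M (S \<Otimes>\<^sub>M N) (\<lambda>x. (X x, Y x)) = distr M S X \<Otimes>\<^sub>M distr M N Y"
proof (rule pair_measure_eqI[symmetric])
  show "sigma_finite_measure (distr M S X)" "sigma_finite_measure (distr M N Y)"
    by (simp_all add: prob_space_distr prob_space_imp_sigma_finite)
  fix A B assume AB: "A \<in> sets (distr M S X)" "B \<in> sets (distr M N Y)"
  then have [measurable]: "A \<in> sets S" "B \<in> sets N" by auto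
  have "(\<lambda>x. (X x, Y x)) -` (A \<times> B) \<inter> space M = {x\<in>space M. X x \<in> A \<and> Y x \<in> B}"
    "X -` A \<inter> space M = {x\<in>space M. X x \<in> A}" "Y -` B \<inter> space M = {x\<in>space M. Y x \<in> B}" by auto
  then show "emeasure (distr M S X) A * emeasure (distr M N Y) B =
      emeasure (distr M (S \<Otimes>\<^sub>M N) (\<lambda>x. (X x, Y x))) (A \<times> B)"
    using eq[of A B] by (simp add: emeasure_distr emeasure_eq_measure flip: ennreal_mult)
qed (simp cong: sets_pair_measure_cong)

lemma indep_var_of_joint_distr:
  assumes X[measurable]: "X \<in> measurable M S" and Y[measurable]: "Y \<in> measurable M N"
    and eq: "distr M (S \<Otimes>\<^sub>M N) (\<lambda>x. (X x, Y x)) = distr M S X \<Otimes>\<^sub>M distr M N Y"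
    and f[measurable]: "f \<in> measurable S K" and g[measurable]: "g \<in> measurable N L"
  shows "indep_var K (\<lambda>x. f (X x)) L (\<lambda>x. g (Y x))"
  unfolding indep_var_distribution_eq
proof (intro conjI)
  interpret X: prob_space "distr M S X" by (rule prob_space_distr) measurable
  interpret Y: prob_space "distr M N Y" by (rule prob_space_distr) measurable
  show "distr M K (\<lambda>x. f (X x)) \<Otimes>\<^sub>M distr M L (\<lambda>x. g (Y x)) = distr M (K \<Otimes>\<^sub>M L) (\<lambda>x. (f (X x), g (Y x)))"
  proof (rule joint_distr_eq_pairI[symmetric])
    fix A B assume AB[measurable]: "A \<in> sets K" "B \<in> sets L"
    let ?A = "f -` A \<inter> space S" and ?B = "g -` B \<inter> space N"
    have "emeasure (distr M (S \<Otimes>\<^sub>M N) (\<lambda>x. (X x, Y x))) (?A \<times> ?B) =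
        emeasure (distr M S X) ?A * emeasure (distr M N Y) ?B"
      unfolding eq by (rule Y.emeasure_pair_measure_Times) auto
    moreover have "(\<lambda>x. (X x, Y x)) -` (?A \<times> ?B) \<inter> space M = {x\<in>space M. f (X x) \<in> A \<and> g (Y x) \<in> B}"
      "X -` ?A \<inter> space M = {x\<in>space M. f (X x) \<in> A}" "Y -` ?B \<inter> space M = {x\<in>space M. g (Y x) \<in> B}"
      using measurable_space[OF X] measurable_space[OF Y] by auto
    moreover have "?A \<times> ?B \<in> sets (S \<Otimes>\<^sub>M N)" by (intro pair_measureI) auto
    ultimately show "prob {x\<in>space M. f (X x) \<in> A \<and> g (Y x) \<in> B} =
        prob {x\<in>space M. f (X x) \<in> A} * prob {x\<in>space M. g (Y x) \<in> B}"
      by (simp add: emeasure_distr emeasure_eq_measure flip: ennreal_mult)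
  qed measurable
qed measurable

text \<open>\<open>indep3\<close> speaks of three separate events, while the pair
  \<open>(Y, Z)\<close> needs arbitrary sets of the product. For fixed \<open>A\<close> both sides
  are finite measures of such a set that agree on rectangles. Putting \<open>UNIV\<close> in one
  slot gives the pairwise statements.\<close>

lemma indep3_joint_distr:
  assumes "indep3 M X Y Z"
  shows "distr M (borel \<Otimes>\<^sub>M (borel \<Otimes>\<^sub>M borel)) (\<lambda>x. (X x, (Y x, Z x))) =
      distr M borel X \<Otimes>\<^sub>M distr M (borel \<Otimes>\<^sub>M borel) (\<lambda>x. (Y x, Z x))"
    and "distr M (borel \<Otimes>\<^sub>M borel) (\<lambda>x. (Y x, Z x)) = distr M borel Y \<Otimes>\<^sub>M distr M borel Z"
    and "distr M (borel \<Otimes>\<^sub>M borel) (\<lambda>x. (X x, Z x)) = distr M borel X \<Otimes>\<^sub>M distr M borel Z"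
proof -
  have [measurable]: "X \<in> borel_measurable M" "Y \<in> borel_measurable M" "Z \<in> borel_measurable M"
    and eq: "\<And>A B C. A \<in> sets borel \<Longrightarrow> B \<in> sets borel \<Longrightarrow> C \<in> sets borel \<Longrightarrow>
      prob {x\<in>space M. X x \<in> A \<and> Y x \<in> B \<and> Z x \<in> C} =
      prob {x\<in>space M. X x \<in> A} * prob {x\<in>space M. Y x \<in> B} * prob {x\<in>space M. Z x \<in> C}"
    using assms by (auto simp: indep3_def)
  have eq2: "prob {x\<in>space M. Y x \<in> B \<and> Z x \<in> C} = prob {x\<in>space M. Y x \<in> B} * prob {x\<in>space M. Z x \<in> C}"
    if "B \<in> sets borel" "C \<in> sets borel" for B C
    using eq[of UNIV B C] that by (simp add: prob_space)
  show "distr M (borel \<Otimes>\<^sub>M borel) (\<lambda>x. (Y x, Z x)) = distr M borel Y \<Otimes>\<^sub>M distr M borel Z"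
    by (rule joint_distr_eq_pairI) (auto intro: eq2)
  have "prob {x\<in>space M. X x \<in> A \<and> Z x \<in> C} = prob {x\<in>space M. X x \<in> A} * prob {x\<in>space M. Z x \<in> C}"
    if "A \<in> sets borel" "C \<in> sets borel" for A C
    using eq[of A UNIV C] that by (simp add: prob_space)
  then show "distr M (borel \<Otimes>\<^sub>M borel) (\<lambda>x. (X x, Z x)) = distr M borel X \<Otimes>\<^sub>M distr M borel Z"
    by (intro joint_distr_eq_pairI) simp_all
  show "distr M (borel \<Otimes>\<^sub>M (borel \<Otimes>\<^sub>M borel)) (\<lambda>x. (X x, (Y x, Z x))) =
      distr M borel X \<Otimes>\<^sub>M distr M (borel \<Otimes>\<^sub>M borel) (\<lambda>x. (Y x, Z x))"
  proof (rule joint_distr_eq_pairI)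
    fix A :: "'b set" and E :: "('c \<times> 'd) set"
    assume A[measurable]: "A \<in> sets borel" and E[measurable]: "E \<in> sets (borel \<Otimes>\<^sub>M borel)"
    define \<mu>1 where "\<mu>1 = distr (density M (indicator {x\<in>space M. X x \<in> A})) (borel \<Otimes>\<^sub>M borel) (\<lambda>x. (Y x, Z x))"
    define \<mu>2 where "\<mu>2 = scale_measure (ennreal (prob {x\<in>space M. X x \<in> A})) (distr M (borel \<Otimes>\<^sub>M borel) (\<lambda>x. (Y x, Z x)))"
    have \<mu>1: "emeasure \<mu>1 D = ennreal (prob {x\<in>space M. X x \<in> A \<and> (Y x, Z x) \<in> D})"
      if D[measurable]: "D \<in> sets (borel \<Otimes>\<^sub>M borel)" for D
    proof -
      have "emeasure \<mu>1 D = emeasure (density M (indicator {x\<in>space M. X x \<in> A})) ((\<lambda>x. (Y x, Z x)) -` D \<inter> space M)"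
        unfolding \<mu>1_def by (subst emeasure_distr) auto
      also have "\<dots> = (\<integral>\<^sup>+x. indicator {x\<in>space M. X x \<in> A} x * indicator ((\<lambda>x. (Y x, Z x)) -` D \<inter> space M) x \<partial>M)"
        by (rule emeasure_density) measurable
      also have "\<dots> = (\<integral>\<^sup>+x. indicator {x\<in>space M. X x \<in> A \<and> (Y x, Z x) \<in> D} x \<partial>M)"
        by (intro nn_integral_cong) (auto simp: indicator_def)
      finally show ?thesis by (simp add: emeasure_eq_measure)
    qed
    have \<mu>2: "emeasure \<mu>2 D = ennreal (prob {x\<in>space M. X x \<in> A} * prob {x\<in>space M. (Y x, Z x) \<in> D})"
      if D[measurable]: "D \<in> sets (borel \<Otimes>\<^sub>M borel)" for D
    proof -
      have "(\<lambda>x. (Y x, Z x)) -` D \<inter> space M = {x\<in>space M. (Y x, Z x) \<in> D}" by auto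
      then show ?thesis unfolding \<mu>2_def
        by (simp add: emeasure_distr emeasure_eq_measure ennreal_mult)
    qed
    have "\<mu>1 = \<mu>2"
    proof (rule measure_eqI_generator_eq)
      let ?G = "{B \<times> C | B C. B \<in> sets (borel :: 'c measure) \<and> C \<in> sets (borel :: 'd measure)}"
      show "Int_stable ?G" by (rule Int_stable_pair_measure_generator)
      show "?G \<subseteq> Pow UNIV" by simp
      show "sets \<mu>1 = sigma_sets UNIV ?G" "sets \<mu>2 = sigma_sets UNIV ?G"
        by (simp_all add: \<mu>1_def \<mu>2_def sets_pair_measure)
      show "range (\<lambda>_::nat. UNIV) \<subseteq> ?G" by (auto intro!: exI[of _ UNIV])
      show "emeasure \<mu>1 UNIV \<noteq> \<infinity>" using \<mu>1[of UNIV] sets.top[of "borel \<Otimes>\<^sub>M borel :: ('c \<times> 'd) measure"]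
        by (simp add: space_pair_measure)
      fix D assume "D \<in> ?G"
      then obtain B C where D: "D = B \<times> C" and BC[measurable]: "B \<in> sets borel" "C \<in> sets borel" by blast
      have "D \<in> sets (borel \<Otimes>\<^sub>M borel)" unfolding D by measurable
      then show "emeasure \<mu>1 D = emeasure \<mu>2 D"
        using eq[OF A BC] eq2[OF BC] by (simp add: \<mu>1 \<mu>2 D)
    qed simp
    then show "prob {x\<in>space M. X x \<in> A \<and> (Y x, Z x) \<in> E} =
        prob {x\<in>space M. X x \<in> A} * prob {x\<in>space M. (Y x, Z x) \<in> E}"
      using \<mu>1[OF E] \<mu>2[OF E] by simp
  qed measurable
qed

text \<open>Multiplication by a complex number is a scaled rotation of the plane, so either part of
  the inner product is a real combination of independent normals whose squared coefficients add up
  to \<open>(norm j)\<^sup>2\<close>.\<close>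

lemma circ_gaussian_inner_distributed:
  fixes w :: "'a \<Rightarrow> complex ^ 'k" and j :: "complex ^ 'k"
  assumes w: "circ_gaussian M \<rho> w" and \<rho>: "0 < \<rho>" and j: "j \<noteq> 0"
  shows "distributed M lborel (\<lambda>x. ri_part p (\<Sum>i\<in>UNIV. j $ i * w x $ i))
    (\<lambda>t. ennreal (normal_density 0 (sqrt (\<rho> / 2) * norm j) t))"
proof -
  define a where "a = (\<lambda>(i, p'). case (p, p') of (Rp, Rp) \<Rightarrow> Re (j $ i) | (Rp, Ip) \<Rightarrow> - Im (j $ i)
    | (Ip, Rp) \<Rightarrow> Im (j $ i) | (Ip, Ip) \<Rightarrow> Re (j $ i))"
  define W where "W = (\<lambda>(i, p') x. ri_part p' (w x $ i))"
  \<comment> \<open>\<open>sum_indep_normal\<close> needs a positive deviation in every summand, so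
    vanishing coefficients are removed; \<open>j \<noteq> 0\<close> keeps \<open>K\<close>
    nonempty.\<close>
  define K where "K = {c. a c \<noteq> 0}"
  have indep: "indep_vars (\<lambda>_. borel) W UNIV"
    and normal: "\<And>c. distributed M lborel (W c) (\<lambda>t. ennreal (normal_density 0 (sqrt (\<rho> / 2)) t))"
    using w \<rho> by (simp_all add: circ_gaussian_def W_def split_beta)
  have sum_ri: "(\<Sum>c\<in>UNIV. g c) = (\<Sum>i\<in>UNIV. g (i, Rp) + g (i, Ip))" for g :: "'k \<times> ri \<Rightarrow> real"
  proof -
    have "(\<Sum>c\<in>UNIV. g c) = (\<Sum>(i, p')\<in>UNIV \<times> UNIV. g (i, p'))" by simp
    also have "\<dots> = (\<Sum>i\<in>UNIV. \<Sum>p'\<in>UNIV. g (i, p'))" by (rule sum.cartesian_product[symmetric])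
    finally show ?thesis by (simp add: UNIV_ri)
  qed
  have expand: "ri_part p (\<Sum>i\<in>UNIV. j $ i * w x $ i) = (\<Sum>c\<in>K. a c * W c x)" for x
  proof -
    have "(\<Sum>c\<in>K. a c * W c x) = (\<Sum>c\<in>UNIV. a c * W c x)"
      by (rule sum.mono_neutral_left) (auto simp: K_def)
    then show ?thesis unfolding sum_ri
      by (cases p) (simp_all add: a_def W_def add.commute)
  qed
  have norm_j: "(\<Sum>c\<in>K. (a c)\<^sup>2) = (norm j)\<^sup>2"
  proof -
    have "(\<Sum>c\<in>K. (a c)\<^sup>2) = (\<Sum>c\<in>UNIV. (a c)\<^sup>2)"
      by (rule sum.mono_neutral_left) (auto simp: K_def)
    also have "\<dots> = (\<Sum>i\<in>UNIV. (cmod (j $ i))\<^sup>2)"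
      unfolding sum_ri by (cases p) (simp_all add: a_def cmod_power2 add.commute)
    finally show ?thesis by (simp add: norm_vec_def L2_set_def sum_nonneg)
  qed
  have "K \<noteq> {}" using norm_j j by auto
  have "distributed M lborel (\<lambda>x. \<Sum>c\<in>K. a c * W c x)
     (\<lambda>t. ennreal (normal_density (\<Sum>c\<in>K. 0) (sqrt (\<Sum>c\<in>K. (\<bar>a c\<bar> * sqrt (\<rho> / 2))\<^sup>2)) t))"
  proof (rule sum_indep_normal)
    show "indep_vars (\<lambda>i. borel) (\<lambda>c x. a c * W c x) K"
      by (rule indep_vars_compose2[OF indep_vars_subset[OF indep]]) auto
    show "distributed M lborel (\<lambda>x. a c * W c x) (\<lambda>t. ennreal (normal_density 0 (\<bar>a c\<bar> * sqrt (\<rho> / 2)) t))"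
      if "c \<in> K" for c
      using normal_density_affine[OF normal, of "a c" 0 c] \<rho> that by (simp add: K_def)
  qed (use \<rho> \<open>K \<noteq> {}\<close> in \<open>auto simp: K_def\<close>)
  moreover have "sqrt (\<Sum>c\<in>K. (\<bar>a c\<bar> * sqrt (\<rho> / 2))\<^sup>2) = sqrt (\<rho> / 2) * norm j"
  proof -
    have eq: "(\<Sum>c\<in>K. (\<bar>a c\<bar> * sqrt (\<rho> / 2))\<^sup>2) = (norm j)\<^sup>2 * (\<rho> / 2)"
      using \<rho> by (simp add: power_mult_distrib sum_distrib_right flip: norm_j)
    show ?thesis unfolding eq real_sqrt_mult by simp
  qed
  ultimately show ?thesis by (simp add: expand)
qed

lemma distributed_cong_AE:
  assumes "distributed M N X f" "AE x in M. X x = Y x" "Y \<in> measurable M N"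
  shows "distributed M N Y f"
proof -
  have X: "X \<in> measurable M N" using assms(1) by (rule distributed_measurable)
  have "distr M N X = distr M N Y" using assms(2,3) X by (intro distr_cong_AE) auto
  then show ?thesis using assms(1,3) unfolding distributed_def by simp
qed

lemma jammed_noise_distributed:
  fixes w :: "'a \<Rightarrow> complex ^ 'i" and n :: "'a \<Rightarrow> complex ^ 'b" and J :: "complex ^ 'i ^ 'b"
  assumes w: "circ_gaussian M \<rho> w" and n: "circ_gaussian M N0 n" and \<rho>: "0 \<le> \<rho>" and N0: "0 < N0"
    and wn: "distr M (borel \<Otimes>\<^sub>M borel) (\<lambda>x. (w x, n x)) = distr M borel w \<Otimes>\<^sub>M distr M borel n"
  shows "distributed M lborel (\<lambda>x. ri_part p ((J *v w x + n x) $ b))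
    (\<lambda>t. ennreal (normal_density 0 (sqrt ((\<rho> * (norm (J $ b))\<^sup>2 + N0) / 2)) t))"
proof -
  have [measurable]: "w \<in> borel_measurable M" "n \<in> borel_measurable M"
    using w n by (simp_all add: circ_gaussian_def)
  have nb: "distributed M lborel (\<lambda>x. ri_part p (n x $ b)) (\<lambda>t. ennreal (normal_density 0 (sqrt (N0 / 2)) t))"
    using n N0 by (simp add: circ_gaussian_def)
  have add: "ri_part p ((J *v w x + n x) $ b) = ri_part p (\<Sum>i\<in>UNIV. J $ b $ i * w x $ i) + ri_part p (n x $ b)" for x
    by (cases p) (simp_all add: matrix_vector_mult_def)
  show ?thesis
  \<comment> \<open>In both degenerate cases the jamming term vanishes almost surely and has no
    Lebesgue density, so the rule for sums of independent normals does not apply to it.\<close>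
  proof (cases "\<rho> = 0 \<or> J $ b = 0")
    case True
    have "AE x in M. ri_part p (n x $ b) = ri_part p ((J *v w x + n x) $ b)"
    proof (cases "\<rho> = 0")
      case True
      then have "AE x in M. w x = 0" using w by (simp add: circ_gaussian_def)
      then show ?thesis by eventually_elim simp
    next
      case False
      then have "J $ b = 0" using True by simp
      then show ?thesis by (simp add: matrix_vector_mult_def)
    qed
    from distributed_cong_AE[OF nb this]
    have "distributed M lborel (\<lambda>x. ri_part p ((J *v w x + n x) $ b)) (\<lambda>t. ennreal (normal_density 0 (sqrt (N0 / 2)) t))"
      by simp
    moreover have "\<rho> * (norm (J $ b))\<^sup>2 = 0" using True by auto
    ultimately show ?thesis by (simp only: add_0)
  next
    case False
    have "indep_var borel (\<lambda>x. (\<lambda>v. ri_part p (\<Sum>i\<in>UNIV. J $ b $ i * v $ i)) (w x)) borel (\<lambda>x. (\<lambda>v. ri_part p (v $ b)) (n x))"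
      by (rule indep_var_of_joint_distr[OF _ _ wn]) measurable
    moreover have "distributed M lborel (\<lambda>x. ri_part p (\<Sum>i\<in>UNIV. J $ b $ i * w x $ i))
      (\<lambda>t. ennreal (normal_density 0 (sqrt (\<rho> / 2) * norm (J $ b)) t))"
      using False \<rho> by (intro circ_gaussian_inner_distributed w) auto
    ultimately have "distributed M lborel (\<lambda>x. ri_part p (\<Sum>i\<in>UNIV. J $ b $ i * w x $ i) + ri_part p (n x $ b))
      (\<lambda>t. ennreal (normal_density (0 + 0) (sqrt ((sqrt (\<rho> / 2) * norm (J $ b))\<^sup>2 + (sqrt (N0 / 2))\<^sup>2)) t))"
      using False \<rho> N0 nb by (intro add_indep_normal) auto
    moreover have "(sqrt (\<rho> / 2) * norm (J $ b))\<^sup>2 + (sqrt (N0 / 2))\<^sup>2 = (\<rho> * (norm (J $ b))\<^sup>2 + N0) / 2"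
      using \<rho> N0 by (simp add: power_mult_distrib add_divide_distrib)
    ultimately show ?thesis by (simp only: add add_0)
  qed
qed

text \<open>A bound on the nonnegative integral, unlike one on a Bochner expectation, certifies
  integrability. Products and first moments inherit it from
  \<open>a * b \<le> a\<^sup>2 + b\<^sup>2\<close> and \<open>a \<le> a\<^sup>2 + 1\<close>.\<close>

lemma second_moments:
  fixes s :: "'a \<Rightarrow> complex ^ 'u"
  assumes s[measurable]: "s \<in> borel_measurable M"
    and s_le: "\<And>u. (\<integral>\<^sup>+x. ennreal ((cmod (s x $ u))\<^sup>2) \<partial>M) \<le> 1"
  shows "integrable M (\<lambda>x. s x $ u * cnj (s x $ v))" and "integrable M (\<lambda>x. (cmod (s x $ u))\<^sup>2)"
    and "expectation (\<lambda>x. s x $ u * cnj (s x $ u)) = of_real (expectation (\<lambda>x. (cmod (s x $ u))\<^sup>2))"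
    and "expectation (\<lambda>x. (cmod (s x $ u))\<^sup>2) \<le> 1"
    and "integrable M (\<lambda>x. s x $ u)"
proof -
  have sq: "integrable M (\<lambda>x. (cmod (s x $ u))\<^sup>2)" for u
    using s_le[of u] by (intro integrableI_nonneg) (auto simp: order_le_less_trans)
  show "integrable M (\<lambda>x. (cmod (s x $ u))\<^sup>2)" by (rule sq)
  have sq2: "integrable M (\<lambda>x. (cmod (s x $ u))\<^sup>2 + (cmod (s x $ v))\<^sup>2)" for u v using sq by simp
  show "integrable M (\<lambda>x. s x $ u * cnj (s x $ v))"
  proof (rule Bochner_Integration.integrable_bound[OF sq2[of u v]])
    have "a * b \<le> a\<^sup>2 + b\<^sup>2" if "0 \<le> a" "0 \<le> b" for a b :: real
    proof -
      have "2 * a * b \<le> a\<^sup>2 + b\<^sup>2" by (rule sum_squares_bound)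
      moreover have "0 \<le> a * b" using that by simp
      ultimately show ?thesis by simp
    qed
    then show "AE x in M. norm (s x $ u * cnj (s x $ v)) \<le> norm ((cmod (s x $ u))\<^sup>2 + (cmod (s x $ v))\<^sup>2)"
      by (simp add: norm_mult)
  qed measurable
  have "integrable M (\<lambda>x. (cmod (s x $ u))\<^sup>2 + 1)" using sq by simp
  then show "integrable M (\<lambda>x. s x $ u)"
  proof (rule Bochner_Integration.integrable_bound)
    have "a \<le> a\<^sup>2 + 1" for a :: real
      using sum_squares_bound[of a 1] zero_le_power2[of a] by (smt (verit) one_power2 mult_cancel_left1)
    then show "AE x in M. norm (s x $ u) \<le> norm ((cmod (s x $ u))\<^sup>2 + 1)" by simp
  qed measurable
  have "expectation (\<lambda>x. s x $ u * cnj (s x $ u)) = expectation (\<lambda>x. complex_of_real ((cmod (s x $ u))\<^sup>2))"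
    by (intro Bochner_Integration.integral_cong) (simp_all only: complex_norm_square)
  then show "expectation (\<lambda>x. s x $ u * cnj (s x $ u)) = of_real (expectation (\<lambda>x. (cmod (s x $ u))\<^sup>2))"
    by (simp only: integral_complex_of_real)
  have "ennreal (expectation (\<lambda>x. (cmod (s x $ u))\<^sup>2)) = (\<integral>\<^sup>+x. ennreal ((cmod (s x $ u))\<^sup>2) \<partial>M)"
    by (intro nn_integral_eq_integral[symmetric] sq) simp
  with s_le[of u] have "ennreal (expectation (\<lambda>x. (cmod (s x $ u))\<^sup>2)) \<le> 1" by metis
  then show "expectation (\<lambda>x. (cmod (s x $ u))\<^sup>2) \<le> 1" by simp
qed

text \<open>Expanding the product leaves the diagonal, since the off-diagonal moments vanish. Two
  different vectors are allowed so that the result covers the power of one received component as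
  well as every entry of the output covariance.\<close>

lemma uncorrelated_sesquilinear:
  fixes s :: "'a \<Rightarrow> complex ^ 'u" and h k :: "complex ^ 'u"
  assumes s: "s \<in> borel_measurable M"
    and s_le: "\<And>u. (\<integral>\<^sup>+x. ennreal ((cmod (s x $ u))\<^sup>2) \<partial>M) \<le> 1"
    and unc: "\<And>u v. u \<noteq> v \<Longrightarrow> expectation (\<lambda>x. s x $ u * cnj (s x $ v)) = 0"
  shows "integrable M (\<lambda>x. (\<Sum>u\<in>UNIV. h $ u * s x $ u) * cnj (\<Sum>u\<in>UNIV. k $ u * s x $ u))"
    and "expectation (\<lambda>x. (\<Sum>u\<in>UNIV. h $ u * s x $ u) * cnj (\<Sum>u\<in>UNIV. k $ u * s x $ u)) =
      (\<Sum>u\<in>UNIV. h $ u * cnj (k $ u) * of_real (expectation (\<lambda>x. (cmod (s x $ u))\<^sup>2)))"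
proof -
  note mom = second_moments[OF s s_le]
  have expand: "(\<Sum>u\<in>UNIV. h $ u * s x $ u) * cnj (\<Sum>u\<in>UNIV. k $ u * s x $ u) =
      (\<Sum>u\<in>UNIV. \<Sum>v\<in>UNIV. h $ u * cnj (k $ v) * (s x $ u * cnj (s x $ v)))" for x
    by (simp add: sum_product algebra_simps)
  show "integrable M (\<lambda>x. (\<Sum>u\<in>UNIV. h $ u * s x $ u) * cnj (\<Sum>u\<in>UNIV. k $ u * s x $ u))"
    unfolding expand using mom(1) by simp
  have "expectation (\<lambda>x. (\<Sum>u\<in>UNIV. h $ u * s x $ u) * cnj (\<Sum>u\<in>UNIV. k $ u * s x $ u)) =
    (\<Sum>u\<in>UNIV. \<Sum>v\<in>UNIV. h $ u * cnj (k $ v) * expectation (\<lambda>x. s x $ u * cnj (s x $ v)))"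
    unfolding expand using mom(1) by simp
  also have "\<dots> = (\<Sum>u\<in>UNIV. \<Sum>v\<in>UNIV. if v = u then h $ u * cnj (k $ u) * of_real (expectation (\<lambda>x. (cmod (s x $ u))\<^sup>2)) else 0)"
    by (intro sum.cong refl) (auto simp: unc mom(3))
  finally show "expectation (\<lambda>x. (\<Sum>u\<in>UNIV. h $ u * s x $ u) * cnj (\<Sum>u\<in>UNIV. k $ u * s x $ u)) =
      (\<Sum>u\<in>UNIV. h $ u * cnj (k $ u) * of_real (expectation (\<lambda>x. (cmod (s x $ u))\<^sup>2)))"
    by simp
qed

text \<open>The real or imaginary part is bounded by the full modulus, because without circularity
  all the power of the signal may sit in one part. The noise splits evenly between its two parts,
  and this mismatch is the factor 2 in \<open>SINR_bar\<close>.\<close>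

lemma signal_component_power_le:
  fixes s :: "'a \<Rightarrow> complex ^ 'u" and h :: "complex ^ 'u"
  assumes s[measurable]: "s \<in> borel_measurable M"
    and s_le: "\<And>u. (\<integral>\<^sup>+x. ennreal ((cmod (s x $ u))\<^sup>2) \<partial>M) \<le> 1"
    and unc: "\<And>u v. u \<noteq> v \<Longrightarrow> expectation (\<lambda>x. s x $ u * cnj (s x $ v)) = 0"
  shows "(\<integral>\<^sup>+x. ennreal ((ri_part p (\<Sum>u\<in>UNIV. h $ u * s x $ u))\<^sup>2) \<partial>M) \<le> ennreal ((norm h)\<^sup>2)"
proof -
  define X where "X x = (\<Sum>u\<in>UNIV. h $ u * s x $ u)" for x
  define d where "d u = expectation (\<lambda>x. (cmod (s x $ u))\<^sup>2)" for u
  have X_sq: "X x * cnj (X x) = of_real ((cmod (X x))\<^sup>2)" for x by (simp only: complex_norm_square)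
  have int: "integrable M (\<lambda>x. (cmod (X x))\<^sup>2)"
    using integrable_Re[OF uncorrelated_sesquilinear(1)[OF assms, where h=h and k=h]] by (simp add: X_sq flip: X_def)
  have "complex_of_real (expectation (\<lambda>x. (cmod (X x))\<^sup>2)) = (\<Sum>u\<in>UNIV. of_real ((cmod (h $ u))\<^sup>2 * d u))"
  proof -
    have "h $ u * cnj (h $ u) * of_real (d u) = of_real ((cmod (h $ u))\<^sup>2 * d u)" for u
      by (simp only: of_real_mult complex_norm_square)
    note eq = this
    show ?thesis
      using uncorrelated_sesquilinear(2)[OF assms, where h=h and k=h]
      unfolding X_def[symmetric] X_sq d_def[symmetric] eq integral_complex_of_real .
  qed
  then have E: "expectation (\<lambda>x. (cmod (X x))\<^sup>2) = (\<Sum>u\<in>UNIV. (cmod (h $ u))\<^sup>2 * d u)"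
    unfolding of_real_sum[symmetric] of_real_eq_iff .
  have "(ri_part p z)\<^sup>2 \<le> (cmod z)\<^sup>2" for z by (cases p) (simp_all add: cmod_power2)
  then have "(\<integral>\<^sup>+x. ennreal ((ri_part p (X x))\<^sup>2) \<partial>M) \<le> (\<integral>\<^sup>+x. ennreal ((cmod (X x))\<^sup>2) \<partial>M)"
    by (intro nn_integral_mono ennreal_leI)
  also have "\<dots> = ennreal (\<Sum>u\<in>UNIV. (cmod (h $ u))\<^sup>2 * d u)"
    using int by (subst nn_integral_eq_integral) (auto simp: E)
  also have "\<dots> \<le> ennreal (\<Sum>u\<in>UNIV. (cmod (h $ u))\<^sup>2 * 1)"
    unfolding d_def by (intro ennreal_leI sum_mono mult_left_mono second_moments(4)[OF s s_le]) simp
  also have "(\<Sum>u\<in>UNIV. (cmod (h $ u))\<^sup>2 * 1) = (norm h)\<^sup>2"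
    by (simp add: norm_vec_def L2_set_def sum_nonneg)
  finally show ?thesis by (simp add: X_def)
qed

end

section \<open>Sum of the component bounds\<close>

text \<open>Signal and noise are separate arguments: independence then concerns \<open>x\<close>
  against the pair \<open>z\<close>, and \<open>x = 0\<close> yields the reference output on the
  same noise.\<close>

definition quant_map ::
  "('b \<times> ri \<Rightarrow> real \<Rightarrow> real) \<Rightarrow> complex ^ 'u ^ 'b \<Rightarrow> complex ^ 'i ^ 'b \<Rightarrow>
   complex ^ 'u \<Rightarrow> (complex ^ 'i) \<times> (complex ^ 'b) \<Rightarrow> real ^ ('b \<times> ri)" where
  "quant_map Q H J x z = (\<chi> c. Q c (ri_part (snd c) ((H *v x + J *v fst z + snd z) $ fst c)))"

lemma quant_out_eq_quant_map: "quant_out Q H J s w n = (\<lambda>x. quant_map Q H J (s x) (w x, n x))"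
  by (simp add: fun_eq_iff quant_out_def quant_map_def)

lemma measurable_quant_map[measurable (raw)]:
  assumes Q: "\<And>c. Q c \<in> borel_measurable borel"
    and [measurable]: "f \<in> borel_measurable N" "g \<in> borel_measurable N" "h \<in> borel_measurable N"
  shows "(\<lambda>x. quant_map Q H J (f x) (g x, h x)) \<in> borel_measurable N"
proof -
  have "(\<lambda>x. Q c (ri_part (snd c) ((H *v f x + J *v g x + h x) $ fst c))) \<in> borel_measurable N" for c
    by (rule measurable_compose[OF _ Q]) measurable
  then show ?thesis unfolding quant_map_def by (simp add: borel_measurable_vec_lambda)
qed

lemma measurable_quant_map_pair:
  assumes Q: "\<And>c. Q c \<in> borel_measurable borel"
  shows "(\<lambda>(x, z). quant_map Q H J x z) \<in> borel_measurable (borel \<Otimes>\<^sub>M (borel \<Otimes>\<^sub>M borel))"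
  unfolding split_beta by (subst (2) surjective_pairing) (rule measurable_quant_map[OF Q]; measurable)

lemma (in prob_space) quantized_mutual_information_le_sum_iota_bar:
  fixes s :: "'a \<Rightarrow> complex ^ 'u" and w :: "'a \<Rightarrow> complex ^ 'i" and n :: "'a \<Rightarrow> complex ^ 'b"
    and H :: "complex ^ 'u ^ 'b" and J :: "complex ^ 'i ^ 'b"
  assumes N0: "0 < N0" and \<rho>: "0 \<le> \<rho>" and m: "2 \<le> m"
    and Q: "\<And>c. is_quantizer m (Q c)"
    and s[measurable]: "s \<in> borel_measurable M"
    and w: "circ_gaussian M \<rho> w" and n: "circ_gaussian M N0 n" and indep: "indep3 M s w n"
    and s_le: "\<And>u. (\<integral>\<^sup>+x. ennreal ((cmod (s x $ u))\<^sup>2) \<partial>M) \<le> 1"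
    and unc: "\<And>u v. u \<noteq> v \<Longrightarrow> expectation (\<lambda>x. s x $ u * cnj (s x $ v)) = 0"
  shows "mutual_information 2 borel borel s (quant_out Q H J s w n)
    \<le> (\<Sum>c\<in>UNIV. iota_bar m (SINR_bar N0 \<rho> H J c))"
proof -
  have wn[measurable]: "w \<in> borel_measurable M" "n \<in> borel_measurable M"
    using indep by (simp_all add: indep3_def)
  note Qm = quantizer_measurable[OF Q]
  have err: "prob {x\<in>space M. quant_map Q H J (s x) (w x, n x) $ c \<noteq> quant_map Q H J 0 (w x, n x) $ c}
      \<le> f_bar m (SINR_bar N0 \<rho> H J c)" for c
  proof -
    obtain b p where c: "c = (b, p)" by (cases c)
    define \<sigma> where "\<sigma> = sqrt ((\<rho> * (norm (J $ b))\<^sup>2 + N0) / 2)"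
    define Y where "Y x = ri_part p ((J *v w x + n x) $ b)" for x
    define A where "A x = ri_part p (\<Sum>u\<in>UNIV. H $ b $ u * s x $ u)" for x
    have denom: "0 < \<rho> * (norm (J $ b))\<^sup>2 + N0" using \<rho> N0 by (simp add: add_nonneg_pos)
    have \<sigma>: "0 < \<sigma>" using denom by (simp add: \<sigma>_def)
    have x0: "0 \<le> SINR_bar N0 \<rho> H J c" using denom by (simp add: SINR_bar_def c)
    \<comment> \<open>\<open>\<sigma>\<^sup>2\<close> is half of the complex noise power, which the
      factor 2 in \<open>SINR_bar\<close> undoes.\<close>
    have power: "SINR_bar N0 \<rho> H J c * \<sigma>\<^sup>2 = (norm (H $ b))\<^sup>2"
      using denom by (simp add: SINR_bar_def c \<sigma>_def)
    have sum: "ri_part p ((H *v s x + J *v w x + n x) $ b) = Y x + A x" for x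
      by (cases p) (simp_all add: Y_def A_def matrix_vector_mult_def)
    have zero: "ri_part p ((H *v 0 + J *v w x + n x) $ b) = Y x" for x
      by (simp add: Y_def)
    have "prob {x\<in>space M. Q c (Y x + A x) \<noteq> Q c (Y x)} \<le> f_bar m (SINR_bar N0 \<rho> H J c)"
    proof (rule quantizer_error_le_f_bar[OF Q \<sigma> x0])
      show "distributed M lborel Y (\<lambda>t. ennreal (normal_density 0 \<sigma> t))"
        unfolding Y_def \<sigma>_def by (rule jammed_noise_distributed[OF w n \<rho> N0 indep3_joint_distr(2)[OF indep]])
      have "indep_var borel (\<lambda>x. (\<lambda>v. ri_part p (\<Sum>u\<in>UNIV. H $ b $ u * v $ u)) (s x))
          borel (\<lambda>x. (\<lambda>z. ri_part p ((J *v fst z + snd z) $ b)) (w x, n x))"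
        by (rule indep_var_of_joint_distr[OF _ _ indep3_joint_distr(1)[OF indep]]) measurable
      then show "indep_var borel A borel Y" by (simp add: A_def[abs_def] Y_def[abs_def])
      show "(\<integral>\<^sup>+x. ennreal ((A x)\<^sup>2) \<partial>M) \<le> ennreal (SINR_bar N0 \<rho> H J c * \<sigma>\<^sup>2)"
        unfolding power A_def by (rule signal_component_power_le[OF s s_le unc])
    qed
    then show ?thesis by (simp only: quant_map_def vec_lambda_beta c fst_conv snd_conv sum zero)
  qed
  note Fm = measurable_quant_map_pair[OF Qm]
  have Gm: "quant_map Q H J 0 \<in> borel_measurable (borel \<Otimes>\<^sub>M borel)"
  proof -
    have "(\<lambda>z. quant_map Q H J 0 (fst z, snd z)) \<in> borel_measurable (borel \<Otimes>\<^sub>M borel)"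
      by (rule measurable_quant_map[OF Qm]; measurable)
    then show ?thesis by simp
  qed
  have "mutual_information 2 borel borel s (\<lambda>x. quant_map Q H J (s x) (w x, n x))
    \<le> (\<Sum>c\<in>UNIV. min (log 2 (real m)) (Hb_bar (f_bar m (SINR_bar N0 \<rho> H J c))
        + f_bar m (SINR_bar N0 \<rho> H J c) * log 2 (real m - 1)))"
  proof (rule mutual_information_le_sum_fano[where L="\<lambda>c. range (Q c)" and Z="\<lambda>x. (w x, n x)"
        and N="borel \<Otimes>\<^sub>M borel" and F="quant_map Q H J" and G="quant_map Q H J 0", OF s _ _ Fm Gm])
    show "finite (range (Q c))" "card (range (Q c)) = m" for c using Q by (simp_all add: is_quantizer_def)
  qed (use err m indep3_joint_distr(1)[OF indep] in \<open>simp_all add: quant_map_def\<close>)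
  then show ?thesis unfolding quant_out_eq_quant_map iota_bar_def .
qed

section \<open>Rank-one determinants and Gaussian integrals\<close>

text \<open>No conjugation is built in, so that the determinant identities hold over any field;
  Hermitian rank-one matrices are written \<open>outer v (cnj_vec v)\<close>.\<close>

definition outer :: "'r::comm_ring_1 ^ 'm \<Rightarrow> 'r ^ 'n \<Rightarrow> 'r ^ 'n ^ 'm" where
  "outer u v = (\<chi> i j. u $ i * v $ j)"

definition cnj_vec :: "complex ^ 'n \<Rightarrow> complex ^ 'n" where
  "cnj_vec v = (\<chi> i. cnj (v $ i))"

text \<open>Conjugate-linear in \<open>x\<close>, so that \<open>sesq K y y\<close> is the Hermitian
  form of \<open>K\<close> at \<open>y\<close>.\<close>

definition sesq :: "complex ^ 'n ^ 'n \<Rightarrow> complex ^ 'n \<Rightarrow> complex ^ 'n \<Rightarrow> complex" where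
  "sesq K x y = (\<Sum>i\<in>UNIV. \<Sum>j\<in>UNIV. cnj (x $ i) * K $ i $ j * y $ j)"

lemma matrix_mult_outer: "A ** outer u v = outer (A *v u) v"
  by (simp add: outer_def matrix_matrix_mult_def matrix_vector_mult_def vec_eq_iff sum_distrib_right mult.assoc)

lemma outer_mult_matrix: "outer u v ** A = outer u (v v* A)"
  by (simp add: outer_def matrix_matrix_mult_def vector_matrix_mult_def vec_eq_iff sum_distrib_left mult_ac)

text \<open>Cramer's rule for the identity matrix, whose system is solved by \<open>v\<close>
  itself.\<close>

lemma det_replace_identity_row:
  fixes v :: "'r::field ^ 'n"
  shows "det (\<chi> i. if i = k then v else axis i 1) = v $ k"
proof -
  have row: "row i (mat 1 :: 'r ^ 'n ^ 'n) = axis i 1" for i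
    by (auto simp: row_def mat_def axis_def vec_eq_iff)
  show ?thesis using cramer_lemma_transpose[of k v "mat 1"] unfolding row basis_expansion by simp
qed

text \<open>With \<open>v\<close> itself in row \<open>k\<close>, the multiples of \<open>v\<close>
  in the other rows are removed by row operations.\<close>

lemma det_replace_row_outer:
  fixes u v :: "'r::field ^ 'n"
  assumes "finite T" "k \<notin> T"
  shows "det (\<chi> i. if i = k then v else if i \<in> T then axis i 1 + u $ i *s v else axis i 1) = v $ k"
  using assms
proof (induction T rule: finite_induct)
  case empty
  have "(\<chi> i. if i = k then v else if i \<in> {} then axis i 1 + u $ i *s v else axis i 1) =
      (\<chi> i. if i = k then v else axis i 1)"
    by (simp add: vec_eq_iff)
  then show ?case using det_replace_identity_row[of k v] by (simp only:)
next
  case (insert l T)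
  let ?A = "(\<chi> i. if i = k then v else if i \<in> T then axis i 1 + u $ i *s v else axis i 1) :: 'r ^ 'n ^ 'n"
  have eq: "(\<chi> i. if i = k then v else if i \<in> insert l T then axis i 1 + u $ i *s v else axis i 1) =
      (\<chi> i. if i = l then row l ?A + u $ l *s row k ?A else row i ?A)"
  proof -
    have row: "row i ?A = ?A $ i" for i by (simp add: row_def)
    have "(if i = k then v else if i \<in> insert l T then axis i 1 + u $ i *s v else axis i 1) =
      (if i = l then row l ?A + u $ l *s row k ?A else row i ?A)" for i
      unfolding row vec_lambda_beta using insert.hyps insert.prems by (cases "i = l"; cases "i = k") simp_all
    then show ?thesis by (simp only:)
  qed
  have "det (\<chi> i. if i = l then row l ?A + u $ l *s row k ?A else row i ?A) = det ?A"
  proof (rule det_row_operation)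
    show "l \<noteq> k" using insert.prems by auto
  qed
  moreover have "det ?A = v $ k"
  proof (rule insert.IH)
    show "k \<notin> T" using insert.prems by auto
  qed
  ultimately show ?case unfolding eq by (rule trans)
qed

text \<open>Matrix determinant lemma, with the rank-one part switched on row by row. Linearity in
  the new row \<open>k\<close> adds \<open>u $ k\<close> times a determinant that has
  \<open>v\<close> in row \<open>k\<close>, and there the contributions in all other rows can be
  cleared.\<close>

lemma det_identity_plus_outer:
  fixes u v :: "'r::field ^ 'n"
  shows "det (mat 1 + outer u v) = 1 + (\<Sum>i\<in>UNIV. u $ i * v $ i)"
proof -
  have "det (\<chi> i. if i \<in> T then axis i 1 + u $ i *s v else axis i 1) = 1 + (\<Sum>i\<in>T. u $ i * v $ i)"
    if "finite T" for T
    using that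
  proof (induction T rule: finite_induct)
    case empty
    have "(\<chi> i. axis i 1) = (mat 1 :: 'r ^ 'n ^ 'n)" by (auto simp: vec_eq_iff mat_def axis_def)
    then show ?case by simp
  next
    case (insert k T)
    let ?c = "\<lambda>i. if i \<in> T then axis i 1 + u $ i *s v else axis i 1"
    have eq1: "(\<chi> i. if i \<in> insert k T then axis i 1 + u $ i *s v else axis i 1) =
       (\<chi> i. if i = k then axis k 1 + u $ k *s v else ?c i)"
      by (auto simp: vec_eq_iff)
    have eq2: "(\<chi> i. if i = k then axis k 1 else ?c i) = (\<chi> i. ?c i)"
      using insert.hyps by (simp add: vec_eq_iff)
    have "det (\<chi> i. if i = k then axis k 1 + u $ k *s v else ?c i) =
        det (\<chi> i. if i = k then axis k 1 else ?c i) + det (\<chi> i. if i = k then u $ k *s v else ?c i)"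
      by (rule det_row_add)
    moreover have "det (\<chi> i. if i = k then u $ k *s v else ?c i) = u $ k * det (\<chi> i. if i = k then v else ?c i)"
      by (rule det_row_mul)
    moreover have "det (\<chi> i. if i = k then v else ?c i) = v $ k"
      using insert.hyps by (rule det_replace_row_outer)
    ultimately show ?case unfolding eq1 eq2 insert.IH using insert.hyps by (simp add: add_ac)
  qed
  from this[of UNIV] have "det (\<chi> i. axis i 1 + u $ i *s v) = 1 + (\<Sum>i\<in>UNIV. u $ i * v $ i)" by simp
  moreover have "(\<chi> i. axis i 1 + u $ i *s v) = mat 1 + outer u v"
    by (auto simp: vec_eq_iff mat_def axis_def outer_def)
  ultimately show ?thesis by simp
qed

section \<open>Gaussian integrals on Euclidean spaces\<close>

lemma nn_integral_exp_neg_square: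
  assumes "0 < k"
  shows "(\<integral>\<^sup>+x. ennreal (exp (- k * x\<^sup>2)) \<partial>lborel) = ennreal (sqrt (pi / k))"
proof -
  define \<sigma> where "\<sigma> = sqrt (1 / (2 * k))"
  have \<sigma>: "0 < \<sigma>" "\<sigma>\<^sup>2 = 1 / (2 * k)" using assms by (simp_all add: \<sigma>_def)
  have "exp (- k * x\<^sup>2) = sqrt (pi / k) * normal_density 0 \<sigma> x" for x
    using assms by (simp add: normal_density_def \<sigma>(2) real_sqrt_divide)
  then have "(\<integral>\<^sup>+x. ennreal (exp (- k * x\<^sup>2)) \<partial>lborel) = (\<integral>\<^sup>+x. ennreal (sqrt (pi / k)) * ennreal (normal_density 0 \<sigma> x) \<partial>lborel)"
    using assms by (simp add: ennreal_mult)
  also have "\<dots> = ennreal (sqrt (pi / k)) * emeasure (density lborel (\<lambda>x. ennreal (normal_density 0 \<sigma> x))) UNIV"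
    by (subst nn_integral_cmult) (auto simp: emeasure_density)
  also have "emeasure (density lborel (\<lambda>x. ennreal (normal_density 0 \<sigma> x))) UNIV = 1"
    using prob_space.emeasure_space_1[OF prob_space_normal_density[OF \<sigma>(1), of 0]] by simp
  finally show ?thesis by simp
qed

lemma nn_integral_exp_neg_norm_square:
  assumes k: "0 < k"
  shows "(\<integral>\<^sup>+x. ennreal (exp (- k * (norm (x :: 'e::euclidean_space))\<^sup>2)) \<partial>lborel) = ennreal (sqrt (pi / k) ^ DIM('e))"
proof -
  have "ennreal (exp (- k * (norm x)\<^sup>2)) = (\<Prod>b\<in>Basis. ennreal (exp (- k * (x \<bullet> b)\<^sup>2)))" for x :: 'e
  proof -
    have "- k * (norm x)\<^sup>2 = (\<Sum>b\<in>Basis. - k * (x \<bullet> b)\<^sup>2)"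
      unfolding power2_norm_eq_inner by (subst euclidean_inner) (simp add: sum_distrib_left power2_eq_square)
    then show ?thesis by (simp add: exp_sum prod_ennreal)
  qed
  then have "(\<integral>\<^sup>+x. ennreal (exp (- k * (norm (x :: 'e))\<^sup>2)) \<partial>lborel) =
     (\<integral>\<^sup>+x. (\<Prod>b\<in>(Basis::'e set). ennreal (exp (- k * (x \<bullet> b)\<^sup>2))) \<partial>lborel)" by simp
  also have "\<dots> = (\<Prod>b\<in>(Basis::'e set). \<integral>\<^sup>+x. ennreal (exp (- k * x\<^sup>2)) \<partial>lborel)"
    by (rule nn_integral_lborel_prod) auto
  also have "\<dots> = ennreal (sqrt (pi / k) ^ DIM('e))"
    unfolding nn_integral_exp_neg_square[OF k] using k by (simp add: ennreal_power)
  finally show ?thesis .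
qed

lemma nn_integral_lborel_translate:
  fixes f :: "'e::euclidean_space \<Rightarrow> ennreal"
  assumes [measurable]: "f \<in> borel_measurable borel"
  shows "(\<integral>\<^sup>+x. f (x + c) \<partial>lborel) = (\<integral>\<^sup>+x. f x \<partial>lborel)"
  by (subst (2) lborel_distr_plus[of c, symmetric]) (simp add: nn_integral_distr add.commute)

section \<open>Hermitian forms and the reference Gaussian\<close>

lemma sesq_matrix_vector: "sesq K x y = (\<Sum>i\<in>UNIV. cnj (x $ i) * (K *v y) $ i)"
  by (simp add: sesq_def matrix_vector_mult_def sum_distrib_left mult.assoc)

lemma sesq_diff_right: "sesq K x (y - t *s h) = sesq K x y - t * sesq K x h"
  by (simp add: sesq_def algebra_simps sum_subtractf sum_distrib_left)

lemma sesq_diff_left: "sesq K (x - t *s h) y = sesq K x y - cnj t * sesq K h y"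
  by (simp add: sesq_def algebra_simps sum_subtractf sum_distrib_left)

lemma herm_entry:
  assumes "herm K = K"
  shows "cnj (K $ i $ j) = K $ j $ i"
proof -
  have "cnj (K $ i $ j) = herm K $ j $ i" by (simp add: herm_def)
  then show ?thesis by (simp only: assms)
qed

lemma sesq_cnj:
  assumes "herm K = K"
  shows "cnj (sesq K x y) = sesq K y x"
  unfolding sesq_def
  by (subst sum.swap) (simp add: herm_entry[OF assms] mult_ac)

lemma sesq_self_real:
  assumes "herm K = K"
  shows "sesq K x x = of_real (Re (sesq K x x))"
  using sesq_cnj[OF assms, of x x] by (simp add: complex_eq_iff)

lemma sesq_hermitian_left:
  assumes "herm K = K"
  shows "(\<Sum>j\<in>UNIV. cnj ((K *v h) $ j) * y $ j) = sesq K h y"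
proof -
  have "(\<Sum>j\<in>UNIV. cnj ((K *v h) $ j) * y $ j) = (\<Sum>j\<in>UNIV. \<Sum>i\<in>UNIV. cnj (h $ i) * K $ i $ j * y $ j)"
    by (simp add: matrix_vector_mult_def sum_distrib_left herm_entry[OF assms] mult_ac)
  also have "\<dots> = sesq K h y" unfolding sesq_def by (rule sum.swap)
  finally show ?thesis .
qed

lemma sesq_outer:
  "sesq (outer g (cnj_vec g)) y y = of_real ((cmod (\<Sum>j\<in>UNIV. cnj (g $ j) * y $ j))\<^sup>2)"
proof -
  have "sesq (outer g (cnj_vec g)) y y = (\<Sum>i\<in>UNIV. cnj (y $ i) * g $ i) * (\<Sum>j\<in>UNIV. cnj (g $ j) * y $ j)"
    by (simp add: sesq_def outer_def cnj_vec_def sum_product mult_ac)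
  also have "(\<Sum>i\<in>UNIV. cnj (y $ i) * g $ i) = cnj (\<Sum>j\<in>UNIV. cnj (g $ j) * y $ j)"
    by (simp add: mult.commute)
  finally show ?thesis unfolding complex_norm_square by (simp only: mult.commute)
qed

lemma measurable_sesq[measurable (raw)]:
  assumes [measurable]: "f \<in> borel_measurable N" "g \<in> borel_measurable N"
  shows "(\<lambda>x. sesq K (f x) (g x)) \<in> borel_measurable N"
  unfolding sesq_def by measurable

lemma measurable_vector_smult[measurable (raw)]:
  fixes h :: "complex ^ 'n"
  assumes [measurable]: "f \<in> borel_measurable N"
  shows "(\<lambda>x. f x *s h) \<in> borel_measurable N"
  unfolding vector_scalar_mult_def by measurable

text \<open>\<open>N0 * G\<close> is the covariance of a circular Gaussian reference output. Carrying the
  normalisation of its density through rank-one updates of \<open>G\<close> avoids a unitary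
  diagonalisation.\<close>

definition gauss_precision ::
  "real \<Rightarrow> complex ^ 'b ^ 'b \<Rightarrow> complex ^ 'b ^ 'b \<Rightarrow> real \<Rightarrow> bool" where
  "gauss_precision N0 G K D \<longleftrightarrow> herm G = G \<and> herm K = K \<and> K ** G = mat 1 \<and> det G = of_real D \<and> 0 < D \<and>
     (\<forall>y. 0 \<le> Re (sesq K y y)) \<and>
     (\<integral>\<^sup>+y. ennreal (exp (- Re (sesq K y y) / N0) / ((pi * N0) ^ CARD('b) * D)) \<partial>lborel) = 1"

lemma gauss_precision_identity:
  assumes N0: "0 < N0"
  shows "gauss_precision N0 (mat 1 :: complex ^ 'b ^ 'b) (mat 1) 1"
proof -
  have sesq1: "sesq (mat 1 :: complex ^ 'b ^ 'b) y y = of_real ((norm y)\<^sup>2)" for y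
  proof -
    have "sesq (mat 1 :: complex ^ 'b ^ 'b) y y = (\<Sum>i\<in>UNIV. of_real ((cmod (y $ i))\<^sup>2))"
      unfolding sesq_matrix_vector matrix_vector_mul_lid complex_norm_square by (simp only: mult.commute)
    then show ?thesis by (simp add: norm_vec_def L2_set_def sum_nonneg)
  qed
  have "(\<integral>\<^sup>+y. ennreal (exp (- Re (sesq (mat 1 :: complex ^ 'b ^ 'b) y y) / N0) / ((pi * N0) ^ CARD('b) * 1)) \<partial>lborel) =
     (\<integral>\<^sup>+y. ennreal (1 / (pi * N0) ^ CARD('b)) * ennreal (exp (- (1 / N0) * (norm (y :: complex ^ 'b))\<^sup>2)) \<partial>lborel)"
    using N0 by (intro nn_integral_cong) (simp add: sesq1 flip: ennreal_mult)
  also have "\<dots> = ennreal (1 / (pi * N0) ^ CARD('b)) * ennreal (sqrt (pi / (1 / N0)) ^ DIM(complex ^ 'b))"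
    using N0 by (subst nn_integral_cmult) (simp_all only: nn_integral_exp_neg_norm_square zero_less_divide_1_iff, measurable)
  \<comment> \<open>The real dimension is twice \<open>CARD('b)\<close>, so the square root
    disappears.\<close>
  also have "sqrt (pi / (1 / N0)) ^ DIM(complex ^ 'b) = (pi * N0) ^ CARD('b)"
    using N0 by (simp add: power_mult mult.commute[of _ 2])
  also have "ennreal (1 / (pi * N0) ^ CARD('b)) * ennreal ((pi * N0) ^ CARD('b)) = 1"
    using N0 by (simp flip: ennreal_mult)
  finally have norm: "(\<integral>\<^sup>+y. ennreal (exp (- Re (sesq (mat 1 :: complex ^ 'b ^ 'b) y y) / N0) / ((pi * N0) ^ CARD('b) * 1)) \<partial>lborel) = 1" .
  moreover have "herm (mat 1 :: complex ^ 'b ^ 'b) = mat 1" by (simp add: herm_def mat_def vec_eq_iff)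
  ultimately show ?thesis unfolding gauss_precision_def by (simp add: sesq1)
qed

text \<open>If y has covariance \<open>N0 * G\<close> and t is an independent standard circular
  Gaussian scalar, then y + t h has covariance \<open>N0 * G\<close> plus the Hermitian outer
  product of h, that is, \<open>N0\<close> times the new matrix. Integrating the joint density over
  t gives the new density with its normalisation; the inverse follows the Sherman-Morrison formula,
  the determinant the matrix determinant lemma.\<close>

lemma gauss_precision_rank_one:
  fixes h :: "complex ^ 'b"
  assumes N0: "0 < N0" and gp: "gauss_precision N0 G K D"
  shows "\<exists>K' D'. gauss_precision N0 (G + (1 / N0) *\<^sub>R outer h (cnj_vec h)) K' D'"
proof -
  have hG: "herm G = G" and hK: "herm K = K" and KG: "K ** G = mat 1" and det: "det G = of_real D"
    and D: "0 < D" and psd: "\<And>y. 0 \<le> Re (sesq K y y)"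
    and norm: "(\<integral>\<^sup>+y. ennreal (exp (- Re (sesq K y y) / N0) / ((pi * N0) ^ CARD('b) * D)) \<partial>lborel) = 1"
    using gp by (auto simp: gauss_precision_def)
  define a where "a = Re (sesq K h h)"
  have a: "sesq K h h = of_real a" "0 \<le> a" using sesq_self_real[OF hK] psd by (auto simp: a_def)
  \<comment> \<open>\<open>\<kappa>\<close> is both the ratio of the two determinants and the
    coefficient of \<open>(cmod t)\<^sup>2\<close> in the joint exponent.\<close>
  define \<kappa> where "\<kappa> = 1 + a / N0"
  have \<kappa>: "0 < \<kappa>" using a N0 by (simp add: \<kappa>_def add_pos_nonneg)
  define g where "g = K *v h"
  define G' where "G' = G + (1 / N0) *\<^sub>R outer h (cnj_vec h)"
  \<comment> \<open>\<open>N0 * \<kappa>\<close> equals \<open>N0 + a\<close>, the Sherman-Morrison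
    denominator for an update scaled by \<open>1 / N0\<close>.\<close>
  define \<gamma> where "\<gamma> = 1 / (N0 * \<kappa>)"
  have \<kappa>\<gamma>: "\<kappa> * \<gamma> = 1 / N0" using \<kappa> by (simp add: \<gamma>_def)
  define K' where "K' = K - \<gamma> *\<^sub>R outer g (cnj_vec g)"
  define \<beta> where "\<beta> y = sesq K h y" for y
  have sesq_K': "Re (sesq K' y y) = Re (sesq K y y) - \<gamma> * (cmod (\<beta> y))\<^sup>2" for y
  proof -
    have "sesq K' y y = sesq K y y - of_real \<gamma> * sesq (outer g (cnj_vec g)) y y"
      by (simp add: K'_def sesq_def algebra_simps sum_subtractf sum_distrib_left scaleR_conv_of_real[where 'a=complex])
    also have "sesq (outer g (cnj_vec g)) y y = of_real ((cmod (\<beta> y))\<^sup>2)"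
      unfolding sesq_outer g_def sesq_hermitian_left[OF hK] \<beta>_def ..
    finally show ?thesis by simp
  qed
  \<comment> \<open>Completing the square in \<open>t\<close>: the minimiser is
    \<open>\<gamma>\<close> times \<open>\<beta> y\<close>, and what remains is the updated form
    \<open>K'\<close>.\<close>
  have square: "Re (sesq K (y - t *s h) (y - t *s h)) / N0 + (cmod t)\<^sup>2 =
      Re (sesq K' y y) / N0 + \<kappa> * (cmod (t - of_real \<gamma> * \<beta> y))\<^sup>2" for y t
  proof -
    define X where "X = Re t * Re (\<beta> y) + Im t * Im (\<beta> y)"
    have "sesq K (y - t *s h) (y - t *s h) = sesq K y y - cnj t * \<beta> y - (t * cnj (\<beta> y) - t * cnj t * of_real a)"
      unfolding sesq_diff_left sesq_diff_right a(1) \<beta>_def sesq_cnj[OF hK] by (simp add: algebra_simps)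
    then have "Re (sesq K (y - t *s h) (y - t *s h)) =
        Re (sesq K y y - cnj t * \<beta> y - (t * cnj (\<beta> y) - t * cnj t * of_real a))" by (simp only:)
    also have "\<dots> = Re (sesq K y y) - 2 * X + (cmod t)\<^sup>2 * a"
      unfolding cmod_power2 X_def by (simp add: power2_eq_square algebra_simps)
    finally have lhs: "Re (sesq K (y - t *s h) (y - t *s h)) = Re (sesq K y y) - 2 * X + (cmod t)\<^sup>2 * a" .
    have expand: "(cmod (t - of_real \<gamma> * \<beta> y))\<^sup>2 = (cmod t)\<^sup>2 - 2 * \<gamma> * X + \<gamma> * \<gamma> * (cmod (\<beta> y))\<^sup>2"
      by (simp add: X_def cmod_power2) (simp add: power2_eq_square algebra_simps)
    have "\<kappa> * (cmod (t - of_real \<gamma> * \<beta> y))\<^sup>2 = \<kappa> * (cmod t)\<^sup>2 - 2 * (\<kappa> * \<gamma>) * X + (\<kappa> * \<gamma>) * \<gamma> * (cmod (\<beta> y))\<^sup>2"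
      unfolding expand by (simp add: algebra_simps)
    then have "\<kappa> * (cmod (t - of_real \<gamma> * \<beta> y))\<^sup>2 = (1 + a / N0) * (cmod t)\<^sup>2 - 2 * (1 / N0) * X + (1 / N0) * \<gamma> * (cmod (\<beta> y))\<^sup>2"
      unfolding \<kappa>\<gamma> by (simp only: \<kappa>_def)
    then show ?thesis
      unfolding sesq_K' lhs by (simp add: diff_divide_distrib add_divide_distrib algebra_simps)
  qed
  have psd': "0 \<le> Re (sesq K' y y)" for y
  proof -
    \<comment> \<open>At the minimiser the square vanishes, which leaves the new form as a sum of
      nonnegative terms.\<close>
    define t where "t = of_real \<gamma> * \<beta> y"
    have "0 \<le> Re (sesq K (y - t *s h) (y - t *s h)) / N0 + (cmod t)\<^sup>2" using psd N0 by simp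
    also have "\<dots> = Re (sesq K' y y) / N0" unfolding square by (simp add: t_def)
    finally show ?thesis using N0 by (simp add: zero_le_divide_iff)
  qed
  have "G ** K = mat 1" using KG matrix_left_right_inverse by blast
  then have Gg: "G *v g = h" unfolding g_def by (simp add: matrix_vector_mul_assoc)
  have herm_outer: "herm (c *\<^sub>R outer v (cnj_vec v)) = c *\<^sub>R outer v (cnj_vec v)" for c :: real and v :: "complex ^ 'b"
    by (simp add: herm_def outer_def cnj_vec_def vec_eq_iff mult.commute)
  have herm_add: "herm (A + B) = herm A + herm B" "herm (A - B) = herm A - herm B" for A B :: "complex ^ 'b ^ 'b"
    by (simp_all add: herm_def vec_eq_iff)
  have hG': "herm G' = G'" and hK': "herm K' = K'"
    unfolding G'_def K'_def herm_add herm_outer hG hK by simp_all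
  have gG: "cnj_vec g v* G = cnj_vec h"
  proof -
    have "(cnj_vec g v* G) $ j = cnj ((G *v g) $ j)" for j
      by (simp add: vector_matrix_mult_def matrix_vector_mult_def cnj_vec_def herm_entry[OF hG] mult.commute)
    then show ?thesis by (simp add: vec_eq_iff Gg cnj_vec_def)
  qed
  have gh: "cnj_vec g v* outer h (cnj_vec h) = of_real a *s cnj_vec h"
  proof -
    have "(\<Sum>i\<in>UNIV. cnj (g $ i) * h $ i) = of_real a"
      unfolding g_def sesq_hermitian_left[OF hK] a(1) ..
    moreover have "(cnj_vec g v* outer h (cnj_vec h)) $ j = (\<Sum>i\<in>UNIV. cnj (g $ i) * h $ i) * cnj (h $ j)" for j
      by (simp add: vector_matrix_mult_def outer_def cnj_vec_def sum_distrib_left mult_ac)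
    ultimately show ?thesis by (simp add: vec_eq_iff cnj_vec_def)
  qed
  have scale: "A ** (c *\<^sub>R B) = c *\<^sub>R (A ** B)" "(c *\<^sub>R A) ** B = c *\<^sub>R (A ** B)"
    for A B :: "complex ^ 'b ^ 'b" and c :: real
    by (simp_all add: matrix_matrix_mult_def vec_eq_iff scaleR_sum_right)
  have diff: "(A - B) ** C = A ** C - B ** C" for A B C :: "complex ^ 'b ^ 'b"
    by (simp add: matrix_matrix_mult_def vec_eq_iff algebra_simps sum_subtractf)
  have KG': "K' ** G' = mat 1"
  proof -
    have e1: "K ** G' = mat 1 + (1 / N0) *\<^sub>R outer g (cnj_vec h)"
      unfolding G'_def matrix_add_ldistrib scale matrix_mult_outer KG g_def ..
    have e2: "outer g (cnj_vec g) ** G' = \<kappa> *\<^sub>R outer g (cnj_vec h)"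
    proof -
      have "outer g (cnj_vec g) ** G' = outer g (cnj_vec h) + (1 / N0) *\<^sub>R outer g (of_real a *s cnj_vec h)"
        unfolding G'_def matrix_add_ldistrib scale outer_mult_matrix[of g "cnj_vec g"] gG gh ..
      also have "\<dots> = \<kappa> *\<^sub>R outer g (cnj_vec h)"
        by (simp add: vec_eq_iff outer_def \<kappa>_def scaleR_conv_of_real[where 'a=complex] algebra_simps)
      finally show ?thesis .
    qed
    show ?thesis unfolding K'_def diff scale e1 e2 using \<kappa>\<gamma> by (simp add: mult.commute)
  qed
  have det': "det G' = of_real (D * \<kappa>)"
  proof -
    have "G' = G ** (mat 1 + outer ((1 / N0) *\<^sub>R g) (cnj_vec h))"
    proof -
      have "G *v ((1 / N0) *\<^sub>R g) = (1 / N0) *\<^sub>R h"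
        using Gg by (simp add: matrix_vector_mult_def vec_eq_iff scaleR_sum_right[symmetric])
      moreover have "outer ((1 / N0) *\<^sub>R h) (cnj_vec h) = (1 / N0) *\<^sub>R outer h (cnj_vec h)"
        by (simp add: outer_def vec_eq_iff)
      ultimately show ?thesis unfolding matrix_add_ldistrib matrix_mult_outer G'_def by simp
    qed
    moreover have "(\<Sum>i\<in>UNIV. ((1 / N0) *\<^sub>R g) $ i * cnj_vec h $ i) = of_real (a / N0)"
    proof -
      have "(\<Sum>i\<in>UNIV. ((1 / N0) *\<^sub>R g) $ i * cnj_vec h $ i) = of_real (1 / N0) * sesq K h h"
        by (simp add: sesq_matrix_vector g_def cnj_vec_def scaleR_conv_of_real[where 'a=complex] sum_distrib_left mult_ac)
      then show ?thesis by (simp add: a)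
    qed
    ultimately show ?thesis by (simp add: det_mul det_identity_plus_outer det \<kappa>_def)
  qed
  have norm': "(\<integral>\<^sup>+y. ennreal (exp (- Re (sesq K' y y) / N0) / ((pi * N0) ^ CARD('b) * (D * \<kappa>))) \<partial>lborel) = 1"
  proof -
    define c where "c = (pi * N0) ^ CARD('b) * D"
    have c: "0 < c" using N0 D by (simp add: c_def)
    \<comment> \<open>Joint density of the updated vector and \<open>t\<close>: integration over
      \<open>t\<close> leaves the new density, integration over \<open>y\<close> the density of
      \<open>t\<close>, so the total mass is 1.\<close>
    define \<Phi> where "\<Phi> y t = ennreal (exp (- Re (sesq K (y - t *s h) (y - t *s h)) / N0) / c) * ennreal (exp (- (cmod t)\<^sup>2) / pi)"
      for y t
    have [measurable]: "(\<lambda>(y, t). \<Phi> y t) \<in> borel_measurable (lborel \<Otimes>\<^sub>M lborel)"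
      unfolding \<Phi>_def by measurable
    have inner: "(\<integral>\<^sup>+t. \<Phi> y t \<partial>lborel) = ennreal (exp (- Re (sesq K' y y) / N0) / (c * \<kappa>))" for y
    proof -
      have "\<Phi> y t = ennreal (exp (- Re (sesq K' y y) / N0) / (c * pi)) *
          ennreal (exp (- \<kappa> * (cmod (t + - (of_real \<gamma> * \<beta> y)))\<^sup>2))" for t
      proof -
        have "exp (- Re (sesq K (y - t *s h) (y - t *s h)) / N0) * exp (- (cmod t)\<^sup>2) =
           exp (- (Re (sesq K (y - t *s h) (y - t *s h)) / N0 + (cmod t)\<^sup>2))" by (simp flip: exp_add)
        also have "\<dots> = exp (- Re (sesq K' y y) / N0) * exp (- \<kappa> * (cmod (t + - (of_real \<gamma> * \<beta> y)))\<^sup>2)"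
          unfolding square by (simp flip: exp_add)
        finally show ?thesis unfolding \<Phi>_def using c by (simp flip: ennreal_mult)
      qed
      then have "(\<integral>\<^sup>+t. \<Phi> y t \<partial>lborel) = ennreal (exp (- Re (sesq K' y y) / N0) / (c * pi)) *
         (\<integral>\<^sup>+t. ennreal (exp (- \<kappa> * (cmod (t + - (of_real \<gamma> * \<beta> y)))\<^sup>2)) \<partial>lborel)"
        by (simp only:) (rule nn_integral_cmult, measurable)
      also have "(\<integral>\<^sup>+t. ennreal (exp (- \<kappa> * (cmod (t + - (of_real \<gamma> * \<beta> y)))\<^sup>2)) \<partial>lborel) =
          (\<integral>\<^sup>+t. ennreal (exp (- \<kappa> * (cmod t)\<^sup>2)) \<partial>lborel)"
        by (rule nn_integral_lborel_translate[where f="\<lambda>t. ennreal (exp (- \<kappa> * (cmod t)\<^sup>2))"]) measurable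
      also have "\<dots> = ennreal (pi / \<kappa>)"
        using \<kappa> by (simp only: nn_integral_exp_neg_norm_square DIM_complex) simp
      finally show ?thesis using c \<kappa> by (simp flip: ennreal_mult)
    qed
    have outer: "(\<integral>\<^sup>+y. \<Phi> y t \<partial>lborel) = ennreal (exp (- (cmod t)\<^sup>2) / pi)" for t
    proof -
      have "(\<integral>\<^sup>+y. \<Phi> y t \<partial>lborel) =
        (\<integral>\<^sup>+y. ennreal (exp (- Re (sesq K (y + - (t *s h)) (y + - (t *s h))) / N0) / c) \<partial>lborel) * ennreal (exp (- (cmod t)\<^sup>2) / pi)"
        unfolding \<Phi>_def by (simp only: diff_conv_add_uminus) (rule nn_integral_multc, measurable)
      also have "(\<integral>\<^sup>+y. ennreal (exp (- Re (sesq K (y + - (t *s h)) (y + - (t *s h))) / N0) / c) \<partial>lborel) =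
        (\<integral>\<^sup>+y. ennreal (exp (- Re (sesq K y y) / N0) / c) \<partial>lborel)"
        by (rule nn_integral_lborel_translate[where f="\<lambda>y. ennreal (exp (- Re (sesq K y y) / N0) / c)"]) measurable
      also have "\<dots> = 1" using norm by (simp add: c_def)
      finally show ?thesis by simp
    qed
    have "(\<integral>\<^sup>+y. ennreal (exp (- Re (sesq K' y y) / N0) / ((pi * N0) ^ CARD('b) * (D * \<kappa>))) \<partial>lborel) =
        (\<integral>\<^sup>+y. \<integral>\<^sup>+t. \<Phi> y t \<partial>lborel \<partial>lborel)"
      unfolding inner by (simp add: c_def mult.assoc)
    also have "\<dots> = (\<integral>\<^sup>+t. \<integral>\<^sup>+y. \<Phi> y t \<partial>lborel \<partial>lborel)"
      by (rule lborel_pair.Fubini'[symmetric]) measurable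
    also have "\<dots> = (\<integral>\<^sup>+t. ennreal (exp (- 1 * (cmod t)\<^sup>2)) * ennreal (1 / pi) \<partial>lborel)"
      unfolding outer by (intro nn_integral_cong) (simp flip: ennreal_mult)
    also have "\<dots> = (\<integral>\<^sup>+t. ennreal (exp (- 1 * (cmod t)\<^sup>2)) \<partial>lborel) * ennreal (1 / pi)"
      by (rule nn_integral_multc) measurable
    also have "(\<integral>\<^sup>+t. ennreal (exp (- 1 * (cmod t)\<^sup>2)) \<partial>lborel) = ennreal pi"
      by (subst nn_integral_exp_neg_norm_square) simp_all
    also have "ennreal pi * ennreal (1 / pi) = 1" by (simp flip: ennreal_mult)
    finally show ?thesis .
  qed
  have "gauss_precision N0 G' K' (D * \<kappa>)"
    using hG' hK' KG' det' D \<kappa> psd' norm' by (simp add: gauss_precision_def)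
  then show ?thesis unfolding G'_def by blast
qed

text \<open>\<open>H ** herm H\<close> is the sum of the outer products of the columns of
  \<open>H\<close>, so one rank-one update per column leads there from the identity.\<close>

lemma gauss_precision_exists:
  fixes H :: "complex ^ 'u ^ 'b"
  assumes N0: "0 < N0"
  obtains K D where "gauss_precision N0 ((1 / N0) *\<^sub>R (H ** herm H) + mat 1) K D"
proof -
  have ex: "\<exists>K D. gauss_precision N0 (mat 1 + (1 / N0) *\<^sub>R (\<Sum>u\<in>S. outer (column u H) (cnj_vec (column u H)))) K D"
    if "finite S" for S
    using that
  proof (induction S rule: finite_induct)
    case empty
    then show ?case using gauss_precision_identity[OF N0] by auto
  next
    case (insert u S)
    obtain K D where "gauss_precision N0 (mat 1 + (1 / N0) *\<^sub>R (\<Sum>u\<in>S. outer (column u H) (cnj_vec (column u H)))) K D"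
      using insert.IH by blast
    from gauss_precision_rank_one[OF N0 this, of "column u H"] show ?case
      using insert.hyps by (simp add: scaleR_add_right add_ac)
  qed
  moreover have "(\<Sum>u\<in>UNIV. outer (column u H) (cnj_vec (column u H))) = H ** herm H"
    by (simp add: vec_eq_iff outer_def cnj_vec_def column_def herm_def matrix_matrix_mult_def)
  ultimately have "\<exists>K D. gauss_precision N0 (mat 1 + (1 / N0) *\<^sub>R (H ** herm H)) K D"
    using ex[OF finite, of UNIV] by (simp only:)
  then show ?thesis using that by (auto simp: add.commute)
qed

section \<open>The log-determinant bound\<close>

text \<open>Matches the index of a real component with a Euclidean basis vector, so that products
  over components become the products over \<open>Basis\<close> in which Lebesgue integrals
  factor.\<close>

definition ri_axis :: "'b \<times> ri \<Rightarrow> complex ^ 'b" where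
  "ri_axis c = axis (fst c) (case snd c of Rp \<Rightarrow> 1 | Ip \<Rightarrow> \<i>)"

lemma inner_ri_axis: "x \<bullet> ri_axis c = ri_part (snd c) (x $ fst c)"
  by (cases c, cases "snd c") (auto simp: ri_axis_def inner_axis inner_complex_def)

lemma bij_betw_ri_axis: "bij_betw ri_axis UNIV (Basis :: (complex ^ 'b) set)"
proof -
  have "inj (ri_axis :: 'b \<times> ri \<Rightarrow> complex ^ 'b)"
  proof (rule injI)
    fix c d :: "'b \<times> ri" assume eq: "ri_axis c = ri_axis d"
    have "(axis (fst c) (case snd c of Rp \<Rightarrow> 1 | Ip \<Rightarrow> \<i>) :: complex ^ 'b) = axis (fst d) (case snd d of Rp \<Rightarrow> 1 | Ip \<Rightarrow> \<i>)"
      using eq by (simp add: ri_axis_def)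
    then show "c = d" by (cases c; cases d; cases "snd c"; cases "snd d") (auto simp: axis_eq_axis)
  qed
  moreover have "range (ri_axis :: 'b \<times> ri \<Rightarrow> complex ^ 'b) = Basis"
  proof -
    have "range (ri_axis :: 'b \<times> ri \<Rightarrow> complex ^ 'b) = (\<Union>i. {ri_axis (i, Rp), ri_axis (i, Ip)})"
    proof (intro equalityI subsetI)
      fix x :: "complex ^ 'b" assume "x \<in> range ri_axis"
      then obtain i p where "x = ri_axis (i, p)" by auto
      then show "x \<in> (\<Union>i. {ri_axis (i, Rp), ri_axis (i, Ip)})" by (cases p) auto
    qed auto
    then show ?thesis by (simp add: Basis_vec_def Basis_complex_def ri_axis_def insert_commute)
  qed
  ultimately show ?thesis by (simp add: bij_betw_def)
qed

text \<open>Variance \<open>N0 / 2\<close> in each real coordinate puts \<open>pi * N0\<close> under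
  the root of the normalising factor, and the even number of coordinates removes the root.\<close>

lemma gaussian_density_eq_prod:
  fixes y :: "complex ^ 'b"
  assumes N0: "0 < N0"
  shows "ennreal (exp (- (norm y)\<^sup>2 / N0) / (pi * N0) ^ CARD('b)) =
    (\<Prod>b\<in>Basis. ennreal (normal_density 0 (sqrt (N0 / 2)) (y \<bullet> b)))"
proof -
  have "(\<Prod>b\<in>Basis. normal_density 0 (sqrt (N0 / 2)) (y \<bullet> b)) =
     (\<Prod>b\<in>(Basis :: (complex ^ 'b) set). (1 / sqrt (pi * N0)) * exp (- (y \<bullet> b)\<^sup>2 / N0))"
    using N0 by (intro prod.cong refl) (simp add: normal_density_def)
  also have "\<dots> = (1 / sqrt (pi * N0)) ^ (2 * CARD('b)) * exp (\<Sum>b\<in>Basis. - (y \<bullet> b)\<^sup>2 / N0)"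
    unfolding prod.distrib by (simp add: exp_sum mult.commute)
  also have "(1 / sqrt (pi * N0)) ^ (2 * CARD('b)) = 1 / (pi * N0) ^ CARD('b)"
    using N0 by (simp add: power_mult power_divide)
  also have "(\<Sum>b\<in>Basis. - (y \<bullet> b)\<^sup>2 / N0) = - (norm y)\<^sup>2 / N0"
  proof -
    have "(norm y)\<^sup>2 = (\<Sum>b\<in>Basis. (y \<bullet> b)\<^sup>2)"
      unfolding power2_norm_eq_inner by (subst euclidean_inner) (simp add: power2_eq_square)
    then show ?thesis by (simp add: sum_divide_distrib sum_negf)
  qed
  finally show ?thesis by (subst prod_ennreal) simp_all
qed

context prob_space
begin

text \<open>Open boxes form an intersection-stable generator, and on a box both sides factor over
  the coordinates: the law by independence, the Lebesgue integral because its integrand is a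
  product.\<close>

lemma circ_gaussian_density:
  fixes n :: "'a \<Rightarrow> complex ^ 'b"
  assumes n: "circ_gaussian M N0 n" and N0: "0 < N0"
  shows "distr M borel n = density lborel (\<lambda>y. ennreal (exp (- (norm y)\<^sup>2 / N0) / (pi * N0) ^ CARD('b)))"
    (is "_ = density lborel ?p")
proof (rule measure_eqI_generator_eq)
  define W where "W c x = ri_part (snd c) (n x $ fst c)" for c x
  have [measurable]: "n \<in> borel_measurable M" using n by (simp add: circ_gaussian_def)
  have indep: "indep_vars (\<lambda>_. borel) W UNIV"
    and normal: "\<And>c. distributed M lborel (W c) (\<lambda>t. ennreal (normal_density 0 (sqrt (N0 / 2)) t))"
  proof -
    have "(\<lambda>(k, p) x. ri_part p (n x $ k)) = W" by (simp add: fun_eq_iff W_def split_beta)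
    then show "indep_vars (\<lambda>_. borel) W UNIV"
      "\<And>c. distributed M lborel (W c) (\<lambda>t. ennreal (normal_density 0 (sqrt (N0 / 2)) t))"
      using n N0 by (simp_all add: circ_gaussian_def W_def[abs_def])
  qed
  let ?E = "range (\<lambda>(a, b). box a b :: (complex ^ 'b) set)"
  show "Int_stable ?E" by (auto simp: Int_stable_def box_Int_box)
  show "?E \<subseteq> Pow UNIV" "sets (distr M borel n) = sigma_sets UNIV ?E" "sets (density lborel ?p) = sigma_sets UNIV ?E"
    by (simp_all add: borel_eq_box)
  let ?A = "\<lambda>k::nat. box (- (real k *\<^sub>R One)) (real k *\<^sub>R One) :: (complex ^ 'b) set"
  show "range ?A \<subseteq> ?E" "(\<Union>i. ?A i) = UNIV" unfolding UN_box_eq_UNIV by auto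
  show "emeasure (distr M borel n) (?A i) \<noteq> \<infinity>" for i
    by (simp add: emeasure_distr)
  fix X assume "X \<in> ?E"
  then obtain l u where X: "X = box l u" by auto
  let ?I = "\<lambda>b. {l \<bullet> b<..<u \<bullet> b}"
  let ?N = "\<lambda>t. ennreal (normal_density 0 (sqrt (N0 / 2)) t)"
  have "n -` X \<inter> space M = (\<Inter>c\<in>UNIV. W c -` ?I (ri_axis c) \<inter> space M)"
  proof -
    have "x \<in> box l u \<longleftrightarrow> (\<forall>c. ri_part (snd c) (x $ fst c) \<in> ?I (ri_axis c))" for x
    proof -
      have "x \<in> box l u \<longleftrightarrow> (\<forall>b\<in>range ri_axis. x \<bullet> b \<in> ?I b)"
        using bij_betw_ri_axis[where 'b='b] by (simp add: bij_betw_def mem_box)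
      then show ?thesis by (simp add: inner_ri_axis)
    qed
    then show ?thesis by (auto simp: X W_def)
  qed
  then have "emeasure (distr M borel n) X = ennreal (prob (\<Inter>c\<in>UNIV. W c -` ?I (ri_axis c) \<inter> space M))"
    by (simp add: X emeasure_distr emeasure_eq_measure)
  also have "prob (\<Inter>c\<in>UNIV. W c -` ?I (ri_axis c) \<inter> space M) = (\<Prod>c\<in>UNIV. prob (W c -` ?I (ri_axis c) \<inter> space M))"
    by (rule indep_varsD_finite[OF indep]) auto
  also have "ennreal \<dots> = (\<Prod>c\<in>UNIV. \<integral>\<^sup>+t. ?N t * indicator (?I (ri_axis c)) t \<partial>lborel)"
  proof (subst prod_ennreal[symmetric])
    show "(\<Prod>c\<in>UNIV. ennreal (prob (W c -` ?I (ri_axis c) \<inter> space M))) =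
       (\<Prod>c\<in>UNIV. \<integral>\<^sup>+t. ?N t * indicator (?I (ri_axis c)) t \<partial>lborel)"
      using distributed_emeasure[OF normal] by (intro prod.cong refl) (simp add: emeasure_eq_measure)
  qed simp
  also have "\<dots> = (\<Prod>b\<in>Basis. \<integral>\<^sup>+t. ?N t * indicator (?I b) t \<partial>lborel)"
    by (rule prod.reindex_bij_betw[OF bij_betw_ri_axis])
  also have "\<dots> = (\<integral>\<^sup>+y. (\<Prod>b\<in>Basis. ?N (y \<bullet> b) * indicator (?I b) (y \<bullet> b)) \<partial>lborel)"
    by (rule nn_integral_lborel_prod[symmetric]) auto
  also have "\<dots> = (\<integral>\<^sup>+y. ?p y * indicator X y \<partial>lborel)"
  proof (rule nn_integral_cong)
    fix y :: "complex ^ 'b"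
    have "(\<Prod>b\<in>Basis. indicator (?I b) (y \<bullet> b)) = (indicator X y :: ennreal)"
      by (auto simp: X indicator_def mem_box prod_zero_iff)
    then show "(\<Prod>b\<in>Basis. ?N (y \<bullet> b) * indicator (?I b) (y \<bullet> b)) = ?p y * indicator X y"
      unfolding gaussian_density_eq_prod[OF N0] prod.distrib by simp
  qed
  also have "\<dots> = emeasure (density lborel ?p) X"
    by (subst emeasure_density) (auto simp: X)
  finally show "emeasure (distr M borel n) X = emeasure (density lborel ?p) X" .
qed

text \<open>Independence of distinct real coordinates removes every mixed term; on the diagonal the
  real and the imaginary part contribute \<open>N0 / 2\<close> each.\<close>

lemma circ_gaussian_covariance:
  fixes n :: "'a \<Rightarrow> complex ^ 'b"
  assumes n: "circ_gaussian M N0 n" and N0: "0 < N0"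
  shows "integrable M (\<lambda>x. n x $ i)" and "expectation (\<lambda>x. n x $ i) = 0"
    and "integrable M (\<lambda>x. n x $ i * cnj (n x $ j))"
    and "expectation (\<lambda>x. n x $ i * cnj (n x $ j)) = (if i = j then of_real N0 else 0)"
proof -
  define W where "W c x = ri_part (snd c) (n x $ fst c)" for c x
  have indep: "indep_vars (\<lambda>_. borel) W UNIV"
    and normal: "\<And>c. distributed M lborel (W c) (\<lambda>t. ennreal (normal_density 0 (sqrt (N0 / 2)) t))"
  proof -
    have "(\<lambda>(k, p) x. ri_part p (n x $ k)) = W" by (simp add: fun_eq_iff W_def split_beta)
    then show "indep_vars (\<lambda>_. borel) W UNIV"
      "\<And>c. distributed M lborel (W c) (\<lambda>t. ennreal (normal_density 0 (sqrt (N0 / 2)) t))"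
      using n N0 by (simp_all add: circ_gaussian_def W_def[abs_def])
  qed
  have \<sigma>: "0 < sqrt (N0 / 2)" using N0 by simp
  have W_int: "integrable M (W c)" for c
    by (rule distributed_integrable_var[OF normal _ integrable_normal_moment_nz_1[OF \<sigma>]]) simp
  have W_E: "expectation (W c) = 0" for c by (rule normal_distributed_expectation[OF \<sigma> normal])
  have WW: "integrable M (\<lambda>x. W c x * W d x) \<and> expectation (\<lambda>x. W c x * W d x) = (if c = d then N0 / 2 else 0)" for c d
  proof (cases "c = d")
    case True
    have "integrable lborel (\<lambda>t. normal_density 0 (sqrt (N0 / 2)) t * (t - 0) ^ 2)"
      by (rule integrable_normal_moment[OF \<sigma>])
    then have "integrable M (\<lambda>x. (W c x)\<^sup>2)"
      using distributed_integrable[OF normal, of "\<lambda>t. t\<^sup>2" c] by simp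
    moreover have "expectation (\<lambda>x. (W c x)\<^sup>2) = N0 / 2"
      using normal_distributed_variance[OF \<sigma> normal, of c] N0 by (simp add: W_E)
    ultimately show ?thesis using True by (simp add: power2_eq_square)
  next
    case False
    \<comment> \<open>The one-element sum is a device: \<open>indep_vars_sum\<close> then extracts
      independence of a pair from that of the family.\<close>
    have "indep_var borel (W c) borel (\<lambda>x. \<Sum>i\<in>{d}. W i x)"
      using False by (intro indep_vars_sum indep_vars_subset[OF indep]) auto
    then have ind: "indep_var borel (W c) borel (W d)" by simp
    show ?thesis
      using indep_var_integrable[OF ind W_int W_int] indep_var_lebesgue_integral[OF ind W_int W_int] False
      by (simp add: W_E)
  qed
  have n_W: "n x $ i = of_real (W (i, Rp) x) + \<i> * of_real (W (i, Ip) x)" for x i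
    by (simp add: W_def complex_eq_iff)
  show "integrable M (\<lambda>x. n x $ i)" unfolding n_W using W_int by simp
  show "expectation (\<lambda>x. n x $ i) = 0" unfolding n_W using W_int W_E by simp
  have nn: "n x $ i * cnj (n x $ j) =
      of_real (W (i, Rp) x * W (j, Rp) x) + of_real (W (i, Ip) x * W (j, Ip) x) +
      (\<i> * of_real (W (i, Ip) x * W (j, Rp) x) - \<i> * of_real (W (i, Rp) x * W (j, Ip) x))" for x
    unfolding n_W by (simp add: algebra_simps)
  have ints: "integrable M (\<lambda>x. complex_of_real (W c x * W d x))" for c d
    using WW by (subst complex_of_real_integrable_eq) blast
  show "integrable M (\<lambda>x. n x $ i * cnj (n x $ j))"
    unfolding nn by (intro Bochner_Integration.integrable_add Bochner_Integration.integrable_diff integrable_mult_right ints)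
  have Es: "expectation (\<lambda>x. complex_of_real (W c x * W d x)) = of_real (if c = d then N0 / 2 else 0)" for c d
    unfolding integral_complex_of_real using WW by simp
  have "expectation (\<lambda>x. n x $ i * cnj (n x $ j)) =
      expectation (\<lambda>x. complex_of_real (W (i, Rp) x * W (j, Rp) x)) + expectation (\<lambda>x. complex_of_real (W (i, Ip) x * W (j, Ip) x)) +
      (\<i> * expectation (\<lambda>x. complex_of_real (W (i, Ip) x * W (j, Rp) x)) - \<i> * expectation (\<lambda>x. complex_of_real (W (i, Rp) x * W (j, Ip) x)))"
    unfolding nn using ints
    by (simp only: Bochner_Integration.integral_add Bochner_Integration.integral_diff integral_mult_right_zero
        Bochner_Integration.integrable_add Bochner_Integration.integrable_diff integrable_mult_right)
  then show "expectation (\<lambda>x. n x $ i * cnj (n x $ j)) = (if i = j then of_real N0 else 0)"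
    unfolding Es by simp
qed

text \<open>Only \<open>E |s u|\<^sup>2 \<le> 1\<close> is known, so the signal covariance is dominated by the identity; as \<open>K\<close> is
  positive semidefinite the trace can only grow when it is replaced by the identity.\<close>

lemma output_quadratic_form_le:
  fixes s :: "'a \<Rightarrow> complex ^ 'u" and n :: "'a \<Rightarrow> complex ^ 'b" and H :: "complex ^ 'u ^ 'b"
  assumes N0: "0 < N0" and n: "circ_gaussian M N0 n" and s[measurable]: "s \<in> borel_measurable M"
    and sn: "distr M (borel \<Otimes>\<^sub>M borel) (\<lambda>x. (s x, n x)) = distr M borel s \<Otimes>\<^sub>M distr M borel n"
    and s_le: "\<And>u. (\<integral>\<^sup>+x. ennreal ((cmod (s x $ u))\<^sup>2) \<partial>M) \<le> 1"
    and unc: "\<And>u v. u \<noteq> v \<Longrightarrow> expectation (\<lambda>x. s x $ u * cnj (s x $ v)) = 0"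
    and K: "gauss_precision N0 ((1 / N0) *\<^sub>R (H ** herm H) + mat 1) K D"
  shows "integrable M (\<lambda>x. Re (sesq K (n x + H *v s x) (n x + H *v s x)))"
    and "expectation (\<lambda>x. Re (sesq K (n x + H *v s x) (n x + H *v s x))) \<le> N0 * CARD('b)"
proof -
  have n_meas[measurable]: "n \<in> borel_measurable M" using n by (simp add: circ_gaussian_def)
  note cov = circ_gaussian_covariance[OF n N0]
  define d where "d u = expectation (\<lambda>x. (cmod (s x $ u))\<^sup>2)" for u
  define a where "a x i = (\<Sum>u\<in>UNIV. H $ i $ u * s x $ u)" for x i
  define X where "X x = n x + H *v s x" for x
  have X: "X x $ i = n x $ i + a x i" for x i by (simp add: X_def a_def matrix_vector_mult_def)
  have a_int: "integrable M (\<lambda>x. a x i)" for i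
    unfolding a_def using second_moments(5)[OF s s_le] by simp
  have aa: "integrable M (\<lambda>x. a x j * cnj (a x i))"
    "expectation (\<lambda>x. a x j * cnj (a x i)) = (\<Sum>u\<in>UNIV. H $ j $ u * cnj (H $ i $ u) * of_real (d u))" for i j
    unfolding a_def d_def using uncorrelated_sesquilinear[OF s s_le unc, where h="H $ j" and k="H $ i"] by auto
  have na: "integrable M (\<lambda>x. a x i * cnj (n x $ j))" "expectation (\<lambda>x. a x i * cnj (n x $ j)) = 0" for i j
  proof -
    have "indep_var borel (\<lambda>x. (\<lambda>v. \<Sum>u\<in>UNIV. H $ i $ u * v $ u) (s x)) borel (\<lambda>x. (\<lambda>v. cnj (v $ j)) (n x))"
      by (rule indep_var_of_joint_distr[OF s n_meas sn]) measurable
    then have ind: "indep_var borel (\<lambda>x. a x i) borel (\<lambda>x. cnj (n x $ j))" by (simp add: a_def)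
    have cn: "integrable M (\<lambda>x. cnj (n x $ j))" using cov(1)[of j] by simp
    have "expectation (\<lambda>x. cnj (n x $ j)) = 0" using cov(2)[of j] by simp
    then show "integrable M (\<lambda>x. a x i * cnj (n x $ j))" "expectation (\<lambda>x. a x i * cnj (n x $ j)) = 0"
      using indep_var_integrable[OF ind a_int cn] indep_var_lebesgue_integral[OF ind a_int cn] by auto
  qed
  have an: "integrable M (\<lambda>x. n x $ j * cnj (a x i))" "expectation (\<lambda>x. n x $ j * cnj (a x i)) = 0" for i j
  proof -
    have eq: "n x $ j * cnj (a x i) = cnj (a x i * cnj (n x $ j))" for x by simp
    show "integrable M (\<lambda>x. n x $ j * cnj (a x i))" unfolding eq using na(1)[of i j] by (simp only: integrable_cnj)
    show "expectation (\<lambda>x. n x $ j * cnj (a x i)) = 0"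
    proof -
      have "expectation (\<lambda>x. n x $ j * cnj (a x i)) = expectation (\<lambda>x. cnj (a x i * cnj (n x $ j)))"
        by (simp only: eq)
      also have "\<dots> = cnj (expectation (\<lambda>x. a x i * cnj (n x $ j)))" by (rule Bochner_Integration.integral_cnj)
      finally show ?thesis by (simp only: na(2) complex_cnj_zero)
    qed
  qed
  have XX: "X x $ j * cnj (X x $ i) = n x $ j * cnj (n x $ i) + a x j * cnj (n x $ i) + (n x $ j * cnj (a x i) + a x j * cnj (a x i))" for x i j
    by (simp add: X algebra_simps)
  have XX_int: "integrable M (\<lambda>x. X x $ j * cnj (X x $ i))" for i j
    unfolding XX by (intro Bochner_Integration.integrable_add cov(3) na(1) an(1) aa(1))
  have XX_E: "expectation (\<lambda>x. X x $ j * cnj (X x $ i)) =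
      (if j = i then of_real N0 else 0) + (\<Sum>u\<in>UNIV. H $ j $ u * cnj (H $ i $ u) * of_real (d u))" for i j
  proof -
    have "expectation (\<lambda>x. X x $ j * cnj (X x $ i)) =
      (expectation (\<lambda>x. n x $ j * cnj (n x $ i)) + expectation (\<lambda>x. a x j * cnj (n x $ i))) +
      (expectation (\<lambda>x. n x $ j * cnj (a x i)) + expectation (\<lambda>x. a x j * cnj (a x i)))"
      unfolding XX using cov(3)[of j i] na(1)[of j i] an(1)[of j i] aa(1)[of j i]
      by (simp only: Bochner_Integration.integral_add Bochner_Integration.integrable_add)
    then show ?thesis unfolding cov(4) na(2) an(2) aa(2) by simp
  qed
  have sesq_X: "sesq K (X x) (X x) = (\<Sum>i\<in>UNIV. \<Sum>j\<in>UNIV. K $ i $ j * (X x $ j * cnj (X x $ i)))" for x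
    unfolding sesq_def by (simp add: mult_ac)
  have S_int: "integrable M (\<lambda>x. sesq K (X x) (X x))"
    unfolding sesq_X by (intro Bochner_Integration.integrable_sum integrable_mult_right XX_int)
  show "integrable M (\<lambda>x. Re (sesq K (n x + H *v s x) (n x + H *v s x)))"
    using integrable_Re[OF S_int] by (simp add: X_def)
  have col: "sesq K (column u H) (column u H) = (\<Sum>i\<in>UNIV. \<Sum>j\<in>UNIV. K $ i $ j * (H $ j $ u * cnj (H $ i $ u)))" for u
    unfolding sesq_def by (simp add: column_def mult_ac)
  \<comment> \<open>Moves the sum over signal entries outside, where each term is a nonnegative
    Hermitian form weighted by the power of that entry; in this shape the powers can be raised to 1
    term by term.\<close>
  have swap: "(\<Sum>i\<in>UNIV. \<Sum>j\<in>UNIV. K $ i $ j * (\<Sum>u\<in>UNIV. H $ j $ u * cnj (H $ i $ u) * of_real (e u))) =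
      (\<Sum>u\<in>UNIV. of_real (e u) * sesq K (column u H) (column u H))" for e :: "'u \<Rightarrow> real"
  proof -
    have "(\<Sum>i\<in>UNIV. \<Sum>j\<in>UNIV. K $ i $ j * (\<Sum>u\<in>UNIV. H $ j $ u * cnj (H $ i $ u) * of_real (e u))) =
      (\<Sum>i\<in>UNIV. \<Sum>j\<in>UNIV. \<Sum>u\<in>UNIV. of_real (e u) * (K $ i $ j * (H $ j $ u * cnj (H $ i $ u))))"
      by (simp add: sum_distrib_left mult_ac)
    also have "\<dots> = (\<Sum>i\<in>UNIV. \<Sum>u\<in>UNIV. \<Sum>j\<in>UNIV. of_real (e u) * (K $ i $ j * (H $ j $ u * cnj (H $ i $ u))))"
      by (intro sum.cong refl sum.swap)
    also have "\<dots> = (\<Sum>u\<in>UNIV. \<Sum>i\<in>UNIV. \<Sum>j\<in>UNIV. of_real (e u) * (K $ i $ j * (H $ j $ u * cnj (H $ i $ u))))"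
      by (rule sum.swap)
    finally show ?thesis unfolding col sum_distrib_left .
  qed
  have diag: "(\<Sum>i\<in>UNIV. \<Sum>j\<in>UNIV. K $ i $ j * (if j = i then of_real N0 else 0)) = (\<Sum>i\<in>UNIV. of_real N0 * K $ i $ i)"
    by (intro sum.cong refl) (simp add: mult.commute if_distrib cong: if_cong)
  have psd: "0 \<le> Re (sesq K y y)" for y using K by (simp add: gauss_precision_def)
  have "expectation (\<lambda>x. sesq K (X x) (X x)) =
     (\<Sum>i\<in>UNIV. \<Sum>j\<in>UNIV. K $ i $ j * expectation (\<lambda>x. X x $ j * cnj (X x $ i)))"
    unfolding sesq_X using XX_int by (simp del: complex_cnj_add)
  also have "\<dots> = (\<Sum>i\<in>UNIV. of_real N0 * K $ i $ i) + (\<Sum>u\<in>UNIV. of_real (d u) * sesq K (column u H) (column u H))"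
    unfolding XX_E distrib_left sum.distrib swap diag ..
  finally have "Re (expectation (\<lambda>x. sesq K (X x) (X x))) =
      Re (\<Sum>i\<in>UNIV. of_real N0 * K $ i $ i) + (\<Sum>u\<in>UNIV. d u * Re (sesq K (column u H) (column u H)))"
    by simp
  also have "\<dots> \<le> Re (\<Sum>i\<in>UNIV. of_real N0 * K $ i $ i) + (\<Sum>u\<in>UNIV. 1 * Re (sesq K (column u H) (column u H)))"
    unfolding d_def by (intro add_left_mono sum_mono mult_right_mono psd second_moments(4)[OF s s_le])
  also have "\<dots> = Re ((\<Sum>i\<in>UNIV. of_real N0 * K $ i $ i) + (\<Sum>u\<in>UNIV. of_real 1 * sesq K (column u H) (column u H)))"
    by simp
  also have "(\<Sum>i\<in>UNIV. of_real N0 * K $ i $ i) + (\<Sum>u\<in>UNIV. of_real 1 * sesq K (column u H) (column u H)) =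
      (\<Sum>i\<in>UNIV. \<Sum>j\<in>UNIV. K $ i $ j * ((if j = i then of_real N0 else 0) + (\<Sum>u\<in>UNIV. H $ j $ u * cnj (H $ i $ u) * of_real 1)))"
    unfolding distrib_left sum.distrib swap[of "\<lambda>_. 1"] diag ..
  \<comment> \<open>With unit powers the output covariance is \<open>N0\<close> times the matrix
    that \<open>K\<close> inverts, so the trace becomes that of \<open>N0\<close> times the
    identity.\<close>
  also have "\<dots> = (\<Sum>i\<in>UNIV. of_real N0 * (K ** ((1 / N0) *\<^sub>R (H ** herm H) + mat 1)) $ i $ i)"
  proof (intro sum.cong refl)
    fix i
    have "(\<Sum>j\<in>UNIV. K $ i $ j * ((if j = i then of_real N0 else 0) + (\<Sum>u\<in>UNIV. H $ j $ u * cnj (H $ i $ u) * of_real 1))) =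
      (\<Sum>j\<in>UNIV. of_real N0 * (K $ i $ j * ((1 / N0) *\<^sub>R (H ** herm H) + mat 1) $ j $ i))"
    proof (intro sum.cong refl)
      fix j
      have "(if j = i then of_real N0 else 0) + (\<Sum>u\<in>UNIV. H $ j $ u * cnj (H $ i $ u) * of_real 1) =
         of_real N0 * (((1 / N0) *\<^sub>R (H ** herm H) + mat 1) $ j $ i)"
        using N0 by (simp add: mat_def herm_def matrix_matrix_mult_def scaleR_conv_of_real[where 'a=complex] distrib_left)
      then show "K $ i $ j * ((if j = i then of_real N0 else 0) + (\<Sum>u\<in>UNIV. H $ j $ u * cnj (H $ i $ u) * of_real 1)) =
        of_real N0 * (K $ i $ j * ((1 / N0) *\<^sub>R (H ** herm H) + mat 1) $ j $ i)"
        by (simp only: mult.left_commute)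
    qed
    then show "(\<Sum>j\<in>UNIV. K $ i $ j * ((if j = i then of_real N0 else 0) + (\<Sum>u\<in>UNIV. H $ j $ u * cnj (H $ i $ u) * of_real 1))) =
      of_real N0 * (K ** ((1 / N0) *\<^sub>R (H ** herm H) + mat 1)) $ i $ i"
      unfolding matrix_matrix_mult_def[of K] vec_lambda_beta sum_distrib_left .
  qed
  also have "Re \<dots> = N0 * CARD('b)"
  proof -
    have "K ** ((1 / N0) *\<^sub>R (H ** herm H) + mat 1) = mat 1" using K by (simp add: gauss_precision_def)
    then show ?thesis by (simp add: mat_def)
  qed
  finally show "expectation (\<lambda>x. Re (sesq K (n x + H *v s x) (n x + H *v s x))) \<le> N0 * CARD('b)"
    using S_int by (simp add: X_def)
qed

text \<open>The two quadratic terms in the exponent of \<open>R\<close> have comparable means: the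
  squared noise norm contributes exactly \<open>N0 * CARD('b)\<close>, the form in the output at
  most as much. After taking logarithms only the determinant is left.\<close>

lemma quantized_mutual_information_le_log_det:
  fixes s :: "'a \<Rightarrow> complex ^ 'u" and w :: "'a \<Rightarrow> complex ^ 'i" and n :: "'a \<Rightarrow> complex ^ 'b"
    and H :: "complex ^ 'u ^ 'b" and J :: "complex ^ 'i ^ 'b"
  assumes N0: "0 < N0"
    and Q: "\<And>c. is_quantizer m (Q c)"
    and s[measurable]: "s \<in> borel_measurable M"
    and n: "circ_gaussian M N0 n" and indep: "indep3 M s w n"
    and s_le: "\<And>u. (\<integral>\<^sup>+x. ennreal ((cmod (s x $ u))\<^sup>2) \<partial>M) \<le> 1"
    and unc: "\<And>u v. u \<noteq> v \<Longrightarrow> expectation (\<lambda>x. s x $ u * cnj (s x $ v)) = 0"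
  shows "mutual_information 2 borel borel s (quant_out Q H J s w n)
    \<le> log 2 (Re (det ((1 / N0) *\<^sub>R (H ** herm H) + mat 1)))"
proof -
  obtain K D where gp: "gauss_precision N0 ((1 / N0) *\<^sub>R (H ** herm H) + mat 1) K D"
    using gauss_precision_exists[OF N0] by blast
  have D: "0 < D" and det: "Re (det ((1 / N0) *\<^sub>R (H ** herm H) + mat 1)) = D"
    and norm: "(\<integral>\<^sup>+y. ennreal (exp (- Re (sesq K y y) / N0) / ((pi * N0) ^ CARD('b) * D)) \<partial>lborel) = 1"
    using gp by (simp_all add: gauss_precision_def)
  have wn[measurable]: "w \<in> borel_measurable M" "n \<in> borel_measurable M"
    using indep by (simp_all add: indep3_def)
  note law = indep3_joint_distr[OF indep]
  note dens = circ_gaussian_density[OF n N0]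
  note [measurable] = quantizer_measurable[OF Q]
  define p where "p y = exp (- (norm y)\<^sup>2 / N0) / (pi * N0) ^ CARD('b)" for y :: "complex ^ 'b"
  define g where "g y = exp (- Re (sesq K y y) / N0) / ((pi * N0) ^ CARD('b) * D)" for y
  define R where "R x z = exp (((norm (snd z))\<^sup>2 - Re (sesq K (snd z + H *v x) (snd z + H *v x))) / N0) / D"
    for x and z :: "(complex ^ 'i) \<times> (complex ^ 'b)"
  define V where "V = {v :: real ^ ('b \<times> ri). \<forall>c. v $ c \<in> range (Q c)}"
  \<comment> \<open>Law of the quantized output when signal and noise together are replaced by the
    reference Gaussian while the jammer keeps its own law.\<close>
  define r where "r v = (\<integral>\<^sup>+\<omega>. \<integral>\<^sup>+y. ennreal (g y) * indicator {v} (quant_map Q H J 0 (\<omega>, y)) \<partial>lborel \<partial>distr M borel w)" for v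
  interpret W: prob_space "distr M borel w" by (rule prob_space_distr) measurable
  interpret n: prob_space "distr M borel n" by (rule prob_space_distr) measurable
  have p_pos: "0 < p y" and g_pos: "0 < g y" for y using N0 D by (simp_all add: p_def g_def)
  have [measurable]: "p \<in> borel_measurable borel" "g \<in> borel_measurable borel"
    unfolding p_def[abs_def] g_def[abs_def] by measurable
  have tilt: "p y * R x (\<omega>, y) = g (y + H *v x)" for x \<omega> y
  proof -
    have "exp (- (norm y)\<^sup>2 / N0) * exp (((norm y)\<^sup>2 - Re (sesq K (y + H *v x) (y + H *v x))) / N0) =
        exp (- Re (sesq K (y + H *v x) (y + H *v x)) / N0)"
      by (simp add: diff_divide_distrib flip: exp_add)
    then show ?thesis by (simp add: p_def R_def g_def)
  qed
  \<comment> \<open>The signal enters only as a translation of the noise. With \<open>tilt\<close>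
    and the invariance of Lebesgue measure it vanishes from the integral, so a single
    \<open>r\<close> serves every signal value.\<close>
  have shift: "quant_map Q H J x (\<omega>, y) = quant_map Q H J 0 (\<omega>, y + H *v x)" for x \<omega> y
    by (simp add: quant_map_def add_ac)
  have finV: "finite V" unfolding V_def using Q by (intro sum_vec_prod(1)) (simp add: is_quantizer_def)
  have Fm: "(\<lambda>(x, z). quant_map Q H J x z) \<in> borel_measurable (borel \<Otimes>\<^sub>M (borel \<Otimes>\<^sub>M borel))"
    by (rule measurable_quant_map_pair[OF quantizer_measurable[OF Q]])
  have ind_meas[measurable]: "(\<lambda>x. indicator {v} (quant_map Q H J (f x) (h x, k x)) :: ennreal) \<in> borel_measurable L"
    if [measurable]: "f \<in> borel_measurable L" "h \<in> borel_measurable L" "k \<in> borel_measurable L" for f h k v and L :: "'l measure"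
    by (rule measurable_compose[OF measurable_quant_map[OF quantizer_measurable[OF Q]] borel_measurable_indicator]) (use that in auto)
  have logR: "log 2 (R x z) = (((norm (snd z))\<^sup>2 - Re (sesq K (snd z + H *v x) (snd z + H *v x))) / N0) / ln 2 - log 2 D" for x z
    using D by (simp add: R_def log_def ln_div diff_divide_distrib)
  have n_sq: "(norm (n x))\<^sup>2 = (\<Sum>i\<in>UNIV. Re (n x $ i * cnj (n x $ i)))" for x
  proof -
    have "Re (z * cnj z) = (cmod z)\<^sup>2" for z unfolding cmod_power2 by (simp add: power2_eq_square)
    then show ?thesis by (simp only: norm_vec_def L2_set_def sum_nonneg zero_le_power2 real_sqrt_pow2)
  qed
  note cov = circ_gaussian_covariance[OF n N0]
  have n_int: "integrable M (\<lambda>x. (norm (n x))\<^sup>2)"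
    unfolding n_sq by (intro Bochner_Integration.integrable_sum integrable_Re cov(3))
  have n_E: "expectation (\<lambda>x. (norm (n x))\<^sup>2) = N0 * CARD('b)"
  proof -
    have "expectation (\<lambda>x. (norm (n x))\<^sup>2) = (\<Sum>i\<in>UNIV. expectation (\<lambda>x. Re (n x $ i * cnj (n x $ i))))"
      unfolding n_sq by (intro Bochner_Integration.integral_sum integrable_Re cov(3))
    also have "\<dots> = (\<Sum>i\<in>(UNIV :: 'b set). N0)"
    proof (intro sum.cong refl)
      fix i
      show "expectation (\<lambda>x. Re (n x $ i * cnj (n x $ i))) = N0"
        unfolding integral_Re[OF cov(3)] cov(4) by simp
    qed
    finally show ?thesis by (simp add: mult.commute)
  qed
  note quad = output_quadratic_form_le[OF N0 n s law(3) s_le unc gp]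
  have log_int: "integrable M (\<lambda>x. log 2 (R (s x) (w x, n x)))"
    unfolding logR snd_conv using n_int quad(1)
    by (intro Bochner_Integration.integrable_diff integrable_divide integrable_const)
  have "mutual_information 2 borel borel s (\<lambda>x. quant_map Q H J (s x) (w x, n x)) \<le>
      - expectation (\<lambda>x. log 2 (R (s x) (w x, n x)))"
  proof (rule mutual_information_finite_le[where V=V and r=r and N="borel \<Otimes>\<^sub>M borel" and Z="\<lambda>x. (w x, n x)"])
    show "distr M (borel \<Otimes>\<^sub>M (borel \<Otimes>\<^sub>M borel)) (\<lambda>x. (s x, (w x, n x))) =
      distr M borel s \<Otimes>\<^sub>M distr M (borel \<Otimes>\<^sub>M borel) (\<lambda>x. (w x, n x))" by (rule law(1))
    show "quant_map Q H J x z \<in> V" for x z by (simp add: V_def quant_map_def)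
    show "(\<lambda>(x, z). R x z) \<in> borel_measurable (borel \<Otimes>\<^sub>M (borel \<Otimes>\<^sub>M borel))"
      unfolding R_def split_beta by measurable
    show "AE x in M. 0 < R (s x) (w x, n x)" using D by (simp add: R_def)
    show "(\<integral>\<^sup>+z. ennreal (R x z) * indicator {v} (quant_map Q H J x z) \<partial>distr M (borel \<Otimes>\<^sub>M borel) (\<lambda>x. (w x, n x))) \<le> r v"
      for x v
    proof -
      have [measurable]: "(\<lambda>z. R x z) \<in> borel_measurable (borel \<Otimes>\<^sub>M borel)"
        unfolding R_def by measurable
      have [measurable]: "(\<lambda>z. indicator {v} (quant_map Q H J x z) :: ennreal) \<in> borel_measurable (borel \<Otimes>\<^sub>M borel)"
        using ind_meas[of "\<lambda>_. x" "borel \<Otimes>\<^sub>M borel" fst snd v] by simp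
      have "(\<integral>\<^sup>+z. ennreal (R x z) * indicator {v} (quant_map Q H J x z) \<partial>distr M (borel \<Otimes>\<^sub>M borel) (\<lambda>x. (w x, n x))) =
        (\<integral>\<^sup>+\<omega>. \<integral>\<^sup>+y. ennreal (R x (\<omega>, y)) * indicator {v} (quant_map Q H J x (\<omega>, y)) \<partial>distr M borel n \<partial>distr M borel w)"
        unfolding law(2) by (subst n.nn_integral_fst) (simp_all cong: measurable_cong_sets sets_pair_measure_cong)
      also have "\<dots> = r v"
        unfolding r_def
      proof (rule nn_integral_cong)
        fix \<omega>
        have "(\<integral>\<^sup>+y. ennreal (R x (\<omega>, y)) * indicator {v} (quant_map Q H J x (\<omega>, y)) \<partial>distr M borel n) =
          (\<integral>\<^sup>+y. ennreal (p y) * (ennreal (R x (\<omega>, y)) * indicator {v} (quant_map Q H J x (\<omega>, y))) \<partial>lborel)"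
          unfolding dens p_def[symmetric] by (rule nn_integral_density) measurable
        also have "\<dots> = (\<integral>\<^sup>+y. ennreal (g (y + H *v x)) * indicator {v} (quant_map Q H J 0 (\<omega>, y + H *v x)) \<partial>lborel)"
        proof (rule nn_integral_cong)
          fix y
          have "ennreal (p y) * ennreal (R x (\<omega>, y)) = ennreal (g (y + H *v x))"
            unfolding tilt[symmetric, of y x \<omega>] using p_pos[of y] D by (intro ennreal_mult[symmetric]) (simp_all add: R_def less_imp_le)
          then show "ennreal (p y) * (ennreal (R x (\<omega>, y)) * indicator {v} (quant_map Q H J x (\<omega>, y))) =
            ennreal (g (y + H *v x)) * indicator {v} (quant_map Q H J 0 (\<omega>, y + H *v x))"
            unfolding shift[of x] mult.assoc[symmetric] by (simp only:)
        qed
        also have "\<dots> = (\<integral>\<^sup>+y. ennreal (g y) * indicator {v} (quant_map Q H J 0 (\<omega>, y)) \<partial>lborel)"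
          by (rule nn_integral_lborel_translate[where f="\<lambda>y. ennreal (g y) * indicator {v} (quant_map Q H J 0 (\<omega>, y))"]) measurable
        finally show "(\<integral>\<^sup>+y. ennreal (R x (\<omega>, y)) * indicator {v} (quant_map Q H J x (\<omega>, y)) \<partial>distr M borel n) =
          (\<integral>\<^sup>+y. ennreal (g y) * indicator {v} (quant_map Q H J 0 (\<omega>, y)) \<partial>lborel)" .
      qed
      finally show ?thesis by simp
    qed
    have "sum r V = (\<integral>\<^sup>+\<omega>. (\<Sum>v\<in>V. \<integral>\<^sup>+y. ennreal (g y) * indicator {v} (quant_map Q H J 0 (\<omega>, y)) \<partial>lborel) \<partial>distr M borel w)"
      unfolding r_def by (rule nn_integral_sum[symmetric]) measurable
    also have "\<dots> = (\<integral>\<^sup>+\<omega>. 1 \<partial>distr M borel w)"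
    proof (rule nn_integral_cong)
      fix \<omega>
      have "(\<Sum>v\<in>V. \<integral>\<^sup>+y. ennreal (g y) * indicator {v} (quant_map Q H J 0 (\<omega>, y)) \<partial>lborel) =
        (\<integral>\<^sup>+y. (\<Sum>v\<in>V. ennreal (g y) * indicator {v} (quant_map Q H J 0 (\<omega>, y))) \<partial>lborel)"
        by (rule nn_integral_sum[symmetric]) measurable
      also have "\<dots> = (\<integral>\<^sup>+y. ennreal (g y) \<partial>lborel)"
      proof (rule nn_integral_cong)
        fix y
        have "quant_map Q H J 0 (\<omega>, y) \<in> V" by (simp add: V_def quant_map_def)
        then have "(\<Sum>v\<in>V. indicator {v} (quant_map Q H J 0 (\<omega>, y))) = (1 :: ennreal)"
          using finV by (simp add: indicator_def)
        then show "(\<Sum>v\<in>V. ennreal (g y) * indicator {v} (quant_map Q H J 0 (\<omega>, y))) = ennreal (g y)"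
          unfolding sum_distrib_left[symmetric] by simp
      qed
      finally show "(\<Sum>v\<in>V. \<integral>\<^sup>+y. ennreal (g y) * indicator {v} (quant_map Q H J 0 (\<omega>, y)) \<partial>lborel) = 1"
        using norm by (simp add: g_def)
    qed
    also have "\<dots> = 1" using W.emeasure_space_1 by simp
    finally show "sum r V \<le> 1" by simp
  qed (use finV Fm log_int in auto)
  also have "- expectation (\<lambda>x. log 2 (R (s x) (w x, n x))) =
      log 2 D + (expectation (\<lambda>x. Re (sesq K (n x + H *v s x) (n x + H *v s x))) - N0 * CARD('b)) / N0 / ln 2"
  proof -
    have "expectation (\<lambda>x. log 2 (R (s x) (w x, n x))) =
      (expectation (\<lambda>x. (norm (n x))\<^sup>2) - expectation (\<lambda>x. Re (sesq K (n x + H *v s x) (n x + H *v s x)))) / N0 / ln 2 - log 2 D"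
      unfolding logR snd_conv using n_int quad(1)
      by (simp only: Bochner_Integration.integral_diff Bochner_Integration.integrable_diff integral_divide_zero
          integrable_divide integrable_const lebesgue_integral_const) (simp add: prob_space)
    then show ?thesis unfolding n_E by (simp add: diff_divide_distrib)
  qed
  also have "\<dots> \<le> log 2 D"
    using quad(2) N0 by (simp add: divide_nonpos_pos)
  finally show ?thesis unfolding quant_out_eq_quant_map det .
qed

end

theorem theorem3:
  fixes P :: "'a measure"
    and H :: "complex ^ 'u ^ 'b" and J :: "complex ^ 'i ^ 'b"
    and N0 \<rho> :: real and M :: nat
    and s :: "'a \<Rightarrow> complex ^ 'u" and w :: "'a \<Rightarrow> complex ^ 'i" and n :: "'a \<Rightarrow> complex ^ 'b"
    and Q :: "'b \<times> ri \<Rightarrow> real \<Rightarrow> real"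
  assumes "prob_space P"
    and "N0 > 0" and "\<rho> \<ge> 0" and "M \<ge> 2"
    and "\<forall>c. is_quantizer M (Q c)"
    and "s \<in> borel_measurable P"
    and "circ_gaussian P \<rho> w"
    and "circ_gaussian P N0 n"
    and "indep3 P s w n"
    and "\<forall>u. (\<integral>\<^sup>+ x. ennreal ((cmod (s x $ u))\<^sup>2) \<partial>P) \<le> 1"
    and "\<forall>u v. u \<noteq> v \<longrightarrow> prob_space.expectation P (\<lambda>x. s x $ u * cnj (s x $ v)) = 0"
  shows "prob_space.mutual_information P 2 borel borel s (quant_out Q H J s w n)
           \<le> I_bar M N0 \<rho> H J"
proof -
  interpret prob_space P by fact
  have "mutual_information 2 borel borel s (quant_out Q H J s w n)
      \<le> (\<Sum>c\<in>UNIV. iota_bar M (SINR_bar N0 \<rho> H J c))"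
    using assms by (intro quantized_mutual_information_le_sum_iota_bar) auto
  moreover have "mutual_information 2 borel borel s (quant_out Q H J s w n)
      \<le> log 2 (Re (det ((1 / N0) *\<^sub>R (H ** herm H) + mat 1)))"
    using assms by (intro quantized_mutual_information_le_log_det[where m=M]) auto
  ultimately show ?thesis unfolding I_bar_def of_real_eq_id id_apply by (rule min.boundedI)
qed

end
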